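(* (Monodromy space of type $(-,-,3)$, Painlevé II.) Let $AnalyticData$ be the affine scheme over $\mathbb{C}$ with coordinates $\alpha,\alpha^{-1},b_1,\dots,b_6$ and relations given by the matrix identity $$\begin{pmatrix}\alpha&0\\ 0&\alpha^{-1}\end{pmatrix}M_1M_2M_3M_4M_5M_6=\begin{pmatrix}1&0\\ 0&1\end{pmatrix},$$ where $M_i=\begin{pmatrix}1&0\\ b_i&1\end{pmatrix}$ for $i$ odd and $M_i=\begin{pmatrix}1&b_i\\ 0&1\end{pmatrix}$ for $i$ even. Let $\mathbb{G}_m$ act with weight $-1$ on $b_1,b_3,b_5$, weight $+1$ on $b_2,b_4,b_6$ and weight $0$ on $\alpha$, and let $\mathcal{R}=AnalyticData/\!/\mathbb{G}_m$ with the morphism $\alpha:\mathcal{R}\to\mathcal{P}=\mathbb{C}^*$. With $x_1=b_3b_4+1$, $x_2=b_4b_5+1$, $x_3=b_5b_6+1$, the coordinate ring of $\mathcal{R}$ is $$\mathbb{C}[\alpha,\alpha^{-1},x_1,x_2,x_3]/(x_1x_2x_3-x_1-\alpha x_2-x_3+\alpha+1),$$ so $\mathcal{R}\to\mathcal{P}$ is a family of affine cubic surfaces. The locus of reducible data ($\alpha=1$ and $b_1=b_3=b_5=0$, or $\alpha=1$ and $b_2=b_4=b_6=0$) is mapped to the unique singular point $\alpha=1$, $x_1=x_2=x_3=1$ of $\mathcal{R}$. For $\alpha\ne1$ the fibre is non-singular; for $\alpha=1$ the fibre has exactly one singular point, $x_1=x_2=x_3=1$, which is of type $A_1$.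
   Context: $X/\!/G$ denotes the categorical quotient $\mathrm{Spec}(\mathcal{O}(X)^G)$ of an affine scheme by a reductive group. A surface singularity is of type $A_n$ if it is locally analytically given by $x^2+y^2+z^{n+1}=0$. "Fibre" refers to the affine surface (points at infinity are not considered). Origin of the data: rank-two differential modules on $\mathbb{P}^1$ (trivial determinant) singular only at $\infty$, unramified with Katz invariant $3$; the data are the formal monodromy $\mathrm{diag}(\alpha,\alpha^{-1})$ and six Stokes matrices, whose product, the topological monodromy, is trivial. *)

theory Defs
  imports
    "HOL-Analysis.Analysis"
    "HOL-Library.Poly_Mapping"
    "HOL-Library.Extended_Nat"
    "HOL-Algebra.Embedded_Algebras"
    "HOL-Algebra.Ideal_Product"
    "HOL-Algebra.Algebraic_Closure_Type"
begin

section \<open>Commutative algebras over the complex numbers\<close>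

record 'a calgebra = "'a ring" +
  scal :: "complex \<Rightarrow> 'a"

definition quot_alg :: "'a calgebra \<Rightarrow> 'a set \<Rightarrow> 'a set calgebra" where
  "quot_alg A I = ring.extend (A Quot I) \<lparr> scal = (\<lambda>c. I +>\<^bsub>A\<^esub> scal A c) \<rparr>"

definition calg_iso :: "'a calgebra \<Rightarrow> 'b calgebra \<Rightarrow> ('a \<Rightarrow> 'b) set" where
  "calg_iso A B = {h \<in> ring_iso A B. \<forall>c. h (scal A c) = scal B c}"

text \<open>The \<open>\<complex>\<close>-points (equivalently, for finitely generated algebras, the closed points) of the
  spectrum of \<open>A\<close>. Homomorphisms are taken extensional, so that equality of points is equality of
  functions.\<close>

definition cpoints :: "'a calgebra \<Rightarrow> ('a \<Rightarrow> complex) set" where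
  "cpoints A = {\<phi> \<in> ring_hom A (ring_of_type_algebra :: complex ring) \<inter> extensional (carrier A).
     \<forall>c. \<phi> (scal A c) = c}"

definition point_ideal :: "'a calgebra \<Rightarrow> ('a \<Rightarrow> complex) \<Rightarrow> 'a set" where
  "point_ideal A \<phi> = {a \<in> carrier A. \<phi> a = 0}"

definition ideal_height :: "'a calgebra \<Rightarrow> 'a set \<Rightarrow> enat" where
  "ideal_height A P = Sup {enat n | n. \<exists>Q. (\<forall>i\<le>n. primeideal (Q i) A)
     \<and> (\<forall>i<n. Q i \<subset> Q (Suc i)) \<and> Q n = P}"

text \<open>\<open>has_cotangent_dimension A m d\<close>: the complex vector space \<open>m/m\<^sup>2\<close>, realised
  inside the ring \<open>A/m\<^sup>2\<close>, has dimension \<open>d\<close>.\<close>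

definition has_cotangent_dimension :: "'a calgebra \<Rightarrow> 'a set \<Rightarrow> nat \<Rightarrow> bool" where
  "has_cotangent_dimension A m d \<longleftrightarrow>
     (let J = ideal_prod A m m; B = quot_alg A J
      in ring.dimension B d (range (scal B)) ((\<lambda>a. J +>\<^bsub>A\<^esub> a) ` m))"

text \<open>The local ring at the point \<open>\<phi>\<close> with maximal ideal \<open>m\<close> is regular. Its Krull dimension is
  the height of \<open>m\<close>, and its cotangent space is \<open>m/m\<^sup>2\<close>, so no localisation is needed.\<close>

definition regular_point :: "'a calgebra \<Rightarrow> ('a \<Rightarrow> complex) \<Rightarrow> bool" where
  "regular_point A \<phi> \<longleftrightarrow> (\<exists>d. has_cotangent_dimension A (point_ideal A \<phi>) d
     \<and> ideal_height A (point_ideal A \<phi>) = enat d)"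

definition singular_points :: "'a calgebra \<Rightarrow> ('a \<Rightarrow> complex) set" where
  "singular_points A = {\<phi> \<in> cpoints A. \<not> regular_point A \<phi>}"


section \<open>Polynomial algebras\<close>

type_synonym 'v cpoly = "('v \<Rightarrow>\<^sub>0 nat) \<Rightarrow>\<^sub>0 complex"

definition PConst :: "complex \<Rightarrow> 'v cpoly" where
  "PConst c = Poly_Mapping.single 0 c"

definition PVar :: "'v \<Rightarrow> 'v cpoly" where
  "PVar v = Poly_Mapping.single (Poly_Mapping.single v 1) 1"

definition psubst :: "(complex \<Rightarrow> 'b) \<Rightarrow> ('v \<Rightarrow> 'b) \<Rightarrow> 'v cpoly \<Rightarrow> 'b::comm_semiring_1" where
  "psubst \<kappa> \<sigma> p = (\<Sum>m\<in>Poly_Mapping.keys p.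
     \<kappa> (Poly_Mapping.lookup p m) * (\<Prod>v\<in>Poly_Mapping.keys m. \<sigma> v ^ Poly_Mapping.lookup m v))"

definition total_degree :: "'v cpoly \<Rightarrow> nat" where
  "total_degree p = Max ((\<lambda>m. \<Sum>v\<in>Poly_Mapping.keys m. Poly_Mapping.lookup m v) ` Poly_Mapping.keys p)"

definition poly_alg :: "'v cpoly calgebra" where
  "poly_alg = ring.extend ring_of_type_algebra \<lparr> scal = PConst \<rparr>"

text \<open>\<open>pquot S\<close> is the polynomial algebra modulo the ideal generated by \<open>S\<close>, and \<open>pclass S p\<close> is
  the class of \<open>p\<close> in it.\<close>

definition pquot :: "'v cpoly set \<Rightarrow> 'v cpoly set calgebra" where
  "pquot S = quot_alg poly_alg (Idl\<^bsub>poly_alg\<^esub> S)"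

definition pclass :: "'v cpoly set \<Rightarrow> 'v cpoly \<Rightarrow> 'v cpoly set" where
  "pclass S p = (Idl\<^bsub>poly_alg\<^esub> S) +>\<^bsub>poly_alg\<^esub> p"


section \<open>Surface singularities of type A\<close>

definition holomorphic3_on :: "(complex^3 \<Rightarrow> complex) \<Rightarrow> (complex^3) set \<Rightarrow> bool" where
  "holomorphic3_on f U \<longleftrightarrow>
     (\<forall>x\<in>U. \<exists>D. (f has_derivative D) (at x) \<and> (\<forall>c v. D (c *s v) = c * D v))"

text \<open>Near \<open>p\<close> the surface \<open>g = 0\<close> is given by \<open>x\<^sup>2 + y\<^sup>2 + z\<^sup>n\<^sup>+\<^sup>1 = 0\<close> in suitable local analytic
  coordinates \<open>(x, y, z) = \<Phi>\<close> centred at \<open>p\<close>: the two equations agree up to a unit \<open>u\<close>, that is,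
  they generate the same ideal of germs of holomorphic functions.\<close>

definition hypersurface_type_A :: "nat \<Rightarrow> 3 cpoly \<Rightarrow> complex^3 \<Rightarrow> bool" where
  "hypersurface_type_A n g p \<longleftrightarrow> (\<exists>U V \<Phi> \<Psi> u.
     open U \<and> open V \<and> p \<in> U \<and> \<Phi> p = 0
     \<and> \<Phi> ` U = V \<and> \<Psi> ` V = U \<and> (\<forall>x\<in>U. \<Psi> (\<Phi> x) = x) \<and> (\<forall>y\<in>V. \<Phi> (\<Psi> y) = y)
     \<and> (\<forall>i. holomorphic3_on (\<lambda>x. \<Phi> x $ i) U) \<and> (\<forall>i. holomorphic3_on (\<lambda>y. \<Psi> y $ i) V)
     \<and> holomorphic3_on u U \<and> (\<forall>x\<in>U. u x \<noteq> 0)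
     \<and> (\<forall>x\<in>U. psubst id (\<lambda>i. x $ i) g
            = u x * ((\<Phi> x $ 1)\<^sup>2 + (\<Phi> x $ 2)\<^sup>2 + (\<Phi> x $ 3) ^ (n + 1))))"

text \<open>For the affine surface with coordinate ring \<open>A\<close>, realised as a hypersurface in affine
  3-space; the choice of the embedding does not matter.\<close>

definition singularity_type_A :: "nat \<Rightarrow> 'a calgebra \<Rightarrow> ('a \<Rightarrow> complex) \<Rightarrow> bool" where
  "singularity_type_A n A \<phi> \<longleftrightarrow> \<phi> \<in> singular_points A \<and>
     (\<exists>g h. h \<in> calg_iso (pquot {g}) A
        \<and> hypersurface_type_A n g (\<chi> i. \<phi> (h (pclass {g} (PVar i)))))"


section \<open>The scheme of analytic data\<close>

text \<open>Variables \<open>\<alpha>\<close>, \<open>\<alpha>\<^sup>-\<^sup>1\<close> and further coordinates; the relation \<open>\<alpha> \<alpha>\<^sup>-\<^sup>1 = 1\<close> is always imposed.\<close>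

datatype 'v avar = Alpha | AlphaInv | Coord 'v

datatype bvar = B1 | B2 | B3 | B4 | B5 | B6

abbreviation PAlpha :: "'v avar cpoly" where "PAlpha \<equiv> PVar Alpha"
abbreviation PAlphaInv :: "'v avar cpoly" where "PAlphaInv \<equiv> PVar AlphaInv"
abbreviation PCoord :: "'v \<Rightarrow> 'v avar cpoly" where "PCoord v \<equiv> PVar (Coord v)"

definition lower_unip :: "'a::comm_ring_1 \<Rightarrow> 'a^2^2" where
  "lower_unip b = vector [vector [1, 0], vector [b, 1]]"

definition upper_unip :: "'a::comm_ring_1 \<Rightarrow> 'a^2^2" where
  "upper_unip b = vector [vector [1, b], vector [0, 1]]"

definition topological_monodromy :: "(bvar avar cpoly)^2^2" where
  "topological_monodromy =
     vector [vector [PAlpha, 0], vector [0, PAlphaInv]]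
     ** lower_unip (PCoord B1) ** upper_unip (PCoord B2) ** lower_unip (PCoord B3)
     ** upper_unip (PCoord B4) ** lower_unip (PCoord B5) ** upper_unip (PCoord B6)"

definition analytic_relations :: "bvar avar cpoly set" where
  "analytic_relations = insert (PAlpha * PAlphaInv - 1)
     {topological_monodromy $ i $ j - mat 1 $ i $ j | i j. True}"

definition analytic_data :: "bvar avar cpoly set calgebra" where
  "analytic_data = pquot analytic_relations"

abbreviation acl :: "bvar avar cpoly \<Rightarrow> bvar avar cpoly set" where
  "acl \<equiv> pclass analytic_relations"

fun weight :: "bvar avar \<Rightarrow> int" where
  "weight Alpha = 0"
| "weight AlphaInv = 0"
| "weight (Coord b) = (if b \<in> {B1, B3, B5} then -1 else 1)"

definition torus_act :: "complex \<Rightarrow> bvar avar cpoly \<Rightarrow> bvar avar cpoly" where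
  "torus_act t = psubst PConst (\<lambda>v. PConst (t powi weight v) * PVar v)"

text \<open>The coordinate ring of \<open>\<R> = AnalyticData // G\<^sub>m\<close>. The action preserves the ideal of relations,
  so it acts on residue classes by taking images.\<close>

definition monodromy_space :: "bvar avar cpoly set calgebra" where
  "monodromy_space = analytic_data
     \<lparr> carrier := {a \<in> carrier analytic_data. \<forall>t. t \<noteq> 0 \<longrightarrow> torus_act t ` a = a} \<rparr>"

definition alphaR :: "bvar avar cpoly set" where
  "alphaR = acl PAlpha"

definition xR :: "3 \<Rightarrow> bvar avar cpoly set" where
  "xR i = acl (if i = 1 then PCoord B3 * PCoord B4 + 1
               else if i = 2 then PCoord B4 * PCoord B5 + 1
               else PCoord B5 * PCoord B6 + 1)"

definition reducible_locus :: "(bvar avar cpoly set \<Rightarrow> complex) set" where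
  "reducible_locus = {\<xi> \<in> cpoints analytic_data. \<xi> (acl PAlpha) = 1 \<and>
     ((\<forall>b\<in>{B1, B3, B5}. \<xi> (acl (PCoord b)) = 0) \<or> (\<forall>b\<in>{B2, B4, B6}. \<xi> (acl (PCoord b)) = 0))}"

text \<open>The morphism of spectra \<open>AnalyticData \<rightarrow> \<R>\<close> on \<open>\<complex>\<close>-points.\<close>

definition git_quotient_map :: "(bvar avar cpoly set \<Rightarrow> complex) \<Rightarrow> bvar avar cpoly set \<Rightarrow> complex" where
  "git_quotient_map \<xi> = restrict \<xi> (carrier monodromy_space)"


section \<open>The cubic family and the fibres\<close>

text \<open>In \<open>cubic a\<close> the argument is \<open>\<alpha>\<close>, either as a variable or as a complex constant.\<close>

definition cubic :: "'a \<Rightarrow> (3 \<Rightarrow> 'a) \<Rightarrow> 'a::comm_ring_1" where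
  "cubic a x = x 1 * x 2 * x 3 - x 1 - a * x 2 - x 3 + a + 1"

definition family_relations :: "3 avar cpoly set" where
  "family_relations = {PAlpha * PAlphaInv - 1, cubic PAlpha PCoord}"

definition fibre_cubic :: "complex \<Rightarrow> 3 cpoly" where
  "fibre_cubic a = cubic (PConst a) PVar"

definition fibre_ideal :: "complex \<Rightarrow> bvar avar cpoly set set" where
  "fibre_ideal a = Idl\<^bsub>monodromy_space\<^esub> {alphaR \<ominus>\<^bsub>monodromy_space\<^esub> scal monodromy_space a}"

text \<open>The scheme-theoretic fibre of \<open>\<alpha> : \<R> \<rightarrow> \<complex>\<^sup>*\<close> over \<open>a\<close>, and its coordinate functions.\<close>

definition fibre :: "complex \<Rightarrow> bvar avar cpoly set set calgebra" where
  "fibre a = quot_alg monodromy_space (fibre_ideal a)"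

definition xF :: "complex \<Rightarrow> 3 \<Rightarrow> bvar avar cpoly set set" where
  "xF a i = fibre_ideal a +>\<^bsub>monodromy_space\<^esub> xR i"

end

theory Submission
  imports Defs
begin

text \<open>
  Solving the matrix identity for \<open>M\<^sub>3 M\<^sub>4 M\<^sub>5 M\<^sub>6\<close> eliminates \<open>b\<^sub>1\<close> and \<open>b\<^sub>2\<close> and expresses \<open>\<alpha>\<close> as
  \<open>b\<^sub>3 b\<^sub>6 + (b\<^sub>3 b\<^sub>4 + 1) (b\<^sub>5 b\<^sub>6 + 1)\<close>, so the analytic data are an open subset of the affine space
  with coordinates \<open>b\<^sub>3, \<dots>, b\<^sub>6\<close>. Averaging over roots of unity shows that the invariants are
  generated by \<open>\<alpha>\<^sup>\<plusminus>\<^sup>1\<close> and the products \<open>p = b\<^sub>3 b\<^sub>4\<close>, \<open>q = b\<^sub>4 b\<^sub>5\<close>, \<open>r = b\<^sub>5 b\<^sub>6\<close>, \<open>s = b\<^sub>3 b\<^sub>6\<close>, whose only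
  relation is \<open>p r = q s\<close>; this is the cubic equation.

  Singular points are found by comparing cotangent dimension and height. The former is read off
  from the partial derivatives. For an upper bound on heights, elements of the successive
  differences of a chain of primes are algebraically independent, and the number of monomials
  not divisible by \<open>x\<^sub>1 x\<^sub>2 x\<^sub>3\<close> bounds how many such elements exist. For the lower bound at a point
  where some partial derivative does not vanish, the cubic, being of degree one in each variable,
  is solved for that variable; fixing the remaining coordinates one after the other gives
  irreducible subvarieties through the point.
\<close>

section \<open>Evaluation of polynomials\<close>

text \<open>Every algebra is handled through a surjection from a polynomial ring with known kernel
  (\<open>presented\<close>): points become common zeros, primes are pulled back to polynomials, and
  only congruences modulo \<open>pideal S\<close> remain. The obstacle is the height, whose upper
  bound must hold for all prime chains at once. It comes from growth: a chain of length n yields (k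
  + 1)^n independent products of powers with exponents at most k; they lie in a filtration step
  whose index is linear in k and which is spanned by O(k^d) monomials, so n \<le> d. Here d = 2 for
  a fibre, because one of three exponents vanishes in a normal monomial, and d = 3 for the total
  space, where powers of \<alpha> and its inverse add one. At a point where all partial derivatives
  of the cubic vanish the cotangent dimension is d + 1, otherwise d. The delicate half of the
  presentation of the invariants is that no further relation exists: after a power of \<alpha> has
  cleared its inverse, the normal monomials for the toric equation p r = q s are distinct characters
  of a monoid, hence independent.\<close>

lemma poly_mapping_eq_sum_single:
  "p = (\<Sum>k\<in>Poly_Mapping.keys p. Poly_Mapping.single k (Poly_Mapping.lookup p k))"
proof (rule poly_mapping_eqI)
  fix k
  show "Poly_Mapping.lookup p k = Poly_Mapping.lookup (\<Sum>k\<in>Poly_Mapping.keys p. Poly_Mapping.single k (Poly_Mapping.lookup p k)) k"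
    by (cases "k \<in> Poly_Mapping.keys p")
      (auto simp: lookup_sum lookup_single when_def in_keys_iff sum.delta)
qed

definition mono_eval :: "('v \<Rightarrow> 'b::comm_semiring_1) \<Rightarrow> ('v \<Rightarrow>\<^sub>0 nat) \<Rightarrow> 'b" where
  "mono_eval \<sigma> m = (\<Prod>v\<in>Poly_Mapping.keys m. \<sigma> v ^ Poly_Mapping.lookup m v)"

lemma mono_eval_superset:
  assumes "finite K" "Poly_Mapping.keys m \<subseteq> K"
  shows "mono_eval \<sigma> m = (\<Prod>v\<in>K. \<sigma> v ^ Poly_Mapping.lookup m v)"
  unfolding mono_eval_def
  by (rule prod.mono_neutral_left) (use assms in \<open>auto simp: in_keys_iff\<close>)

lemma mono_eval_add: "mono_eval \<sigma> (m + m') = mono_eval \<sigma> m * mono_eval \<sigma> m'"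
proof -
  let ?K = "Poly_Mapping.keys m \<union> Poly_Mapping.keys m'"
  have "Poly_Mapping.keys (m + m') \<subseteq> ?K" by (rule keys_add)
  then show ?thesis
    by (simp add: mono_eval_superset[of ?K] lookup_add power_add prod.distrib)
qed

lemma mono_eval_zero [simp]: "mono_eval \<sigma> 0 = 1"
  by (simp add: mono_eval_def)

lemma mono_eval_single [simp]: "mono_eval \<sigma> (Poly_Mapping.single v n) = \<sigma> v ^ n"
  by (simp add: mono_eval_def)

lemma mono_eval_PVar: "mono_eval PVar m = Poly_Mapping.single m 1"
proof -
  have pw: "PVar v ^ n = (Poly_Mapping.single (Poly_Mapping.single v n) 1 :: 'v cpoly)" for v :: 'v and n
    by (induction n) (simp_all add: PVar_def mult_single single_add[symmetric])
  have "(\<Prod>v\<in>K. PVar v ^ f v) = Poly_Mapping.single (\<Sum>v\<in>K. Poly_Mapping.single v (f v)) (1::complex)"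
    if "finite K" for K :: "'v set" and f
    using that by induction (simp_all add: pw mult_single)
  from this[of "Poly_Mapping.keys m" "Poly_Mapping.lookup m"] show ?thesis
    by (simp add: mono_eval_def flip: poly_mapping_eq_sum_single)
qed

lemma single_eq_PConst_mult: "Poly_Mapping.single m c = PConst c * mono_eval PVar m"
  by (simp add: mono_eval_PVar PConst_def mult_single)

lemma cpoly_eq_sum:
  "p = (\<Sum>m\<in>Poly_Mapping.keys p. PConst (Poly_Mapping.lookup p m) * mono_eval PVar m)"
  using poly_mapping_eq_sum_single[of p] by (simp add: single_eq_PConst_mult)

lemma PConst_simps:
  "PConst 0 = 0" "PConst 1 = 1" "PConst (a + b) = PConst a + PConst b"
  "PConst (a - b) = PConst a - PConst b" "PConst (- a) = - PConst a"
  "PConst (a * b) = PConst a * PConst b"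
  by (simp_all add: PConst_def single_add single_diff single_uminus mult_single)

lemma PConst_sum: "PConst (sum f A) = (\<Sum>i\<in>A. PConst (f i))"
  by (induction A rule: infinite_finite_induct) (simp_all add: PConst_simps)

text \<open>Constants and variables generate the ring. Zero, one and the scalar coefficients all
  arise from \<open>const\<close>, so four cases suffice for every homomorphism-like claim
  below.\<close>

lemma cpoly_induct [case_names const var add mult]:
  assumes const: "\<And>c. P (PConst c)" and var: "\<And>v. P (PVar v)"
    and add: "\<And>p q. P p \<Longrightarrow> P q \<Longrightarrow> P (p + q)"
    and mult: "\<And>p q. P p \<Longrightarrow> P q \<Longrightarrow> P (p * q)"
  shows "P p"
proof -
  have sm: "P (sum f A)" if "\<And>i. i \<in> A \<Longrightarrow> P (f i)" for f :: "('a \<Rightarrow>\<^sub>0 nat) \<Rightarrow> _" and A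
    using that const[of 0] by (induction A rule: infinite_finite_induct) (auto simp: PConst_simps add)
  have pw: "P (PVar v ^ n)" for v n
    using const[of 1] by (induction n) (auto simp: PConst_simps mult var)
  have "P (\<Prod>v\<in>A. PVar v ^ f v)" for f :: "'a \<Rightarrow> nat" and A
    using const[of 1] by (induction A rule: infinite_finite_induct) (auto simp: PConst_simps mult pw)
  then have "P (mono_eval PVar m)" for m
    by (simp add: mono_eval_def)
  then show ?thesis
    by (subst cpoly_eq_sum) (intro sm mult const)
qed

text \<open>A substitution is a ring homomorphism as soon as its map on coefficients is one. The
  three instances serve for substituting polynomials, for evaluating at a point, and for restricting
  to a curve parametrised by univariate polynomials.\<close>

locale coeff_hom =
  fixes \<kappa> :: "complex \<Rightarrow> 'b::comm_ring_1"
  assumes zero: "\<kappa> 0 = 0" and one: "\<kappa> 1 = 1"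
    and add: "\<kappa> (a + b) = \<kappa> a + \<kappa> b" and mult: "\<kappa> (a * b) = \<kappa> a * \<kappa> b"
begin

lemma psubst_superset:
  assumes "finite K" "Poly_Mapping.keys p \<subseteq> K"
  shows "psubst \<kappa> \<sigma> p = (\<Sum>m\<in>K. \<kappa> (Poly_Mapping.lookup p m) * mono_eval \<sigma> m)"
  unfolding psubst_def mono_eval_def
  by (rule sum.mono_neutral_left) (use assms in \<open>auto simp: in_keys_iff zero\<close>)

lemma psubst_single: "psubst \<kappa> \<sigma> (Poly_Mapping.single m c) = \<kappa> c * mono_eval \<sigma> m"
  by (cases "c = 0") (simp_all add: psubst_superset[of "{m}"] zero)

lemma psubst_PConst [simp]: "psubst \<kappa> \<sigma> (PConst c) = \<kappa> c"
  by (simp add: PConst_def psubst_single)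

lemma psubst_PVar [simp]: "psubst \<kappa> \<sigma> (PVar v) = \<sigma> v"
  by (simp add: PVar_def psubst_single one)

lemma psubst_add [simp]: "psubst \<kappa> \<sigma> (p + q) = psubst \<kappa> \<sigma> p + psubst \<kappa> \<sigma> q"
proof -
  let ?K = "Poly_Mapping.keys p \<union> Poly_Mapping.keys q"
  have "Poly_Mapping.keys (p + q) \<subseteq> ?K" by (rule keys_add)
  then show ?thesis
    by (simp add: psubst_superset[of ?K] lookup_add add distrib_right sum.distrib)
qed

lemma psubst_zero [simp]: "psubst \<kappa> \<sigma> 0 = 0"
  by (simp add: psubst_def)

lemma psubst_one [simp]: "psubst \<kappa> \<sigma> 1 = 1"
  using psubst_PConst[of \<sigma> 1] by (simp add: PConst_simps one)

lemma psubst_sum: "psubst \<kappa> \<sigma> (sum f A) = (\<Sum>i\<in>A. psubst \<kappa> \<sigma> (f i))"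
  by (induction A rule: infinite_finite_induct) simp_all

lemma psubst_mult [simp]: "psubst \<kappa> \<sigma> (p * q) = psubst \<kappa> \<sigma> p * psubst \<kappa> \<sigma> q"
proof -
  let ?s = "\<lambda>r m. Poly_Mapping.single m (Poly_Mapping.lookup r m)"
  let ?P = "Poly_Mapping.keys p" and ?Q = "Poly_Mapping.keys q"
  have single: "psubst \<kappa> \<sigma> (?s p m * ?s q m') = psubst \<kappa> \<sigma> (?s p m) * psubst \<kappa> \<sigma> (?s q m')" for m m'
    by (simp add: mult_single psubst_single mult mono_eval_add mult_ac)
  have "p * q = (\<Sum>m\<in>?P. ?s p m) * (\<Sum>m\<in>?Q. ?s q m)"
    by (simp flip: poly_mapping_eq_sum_single)
  also have "\<dots> = (\<Sum>m\<in>?P. \<Sum>m'\<in>?Q. ?s p m * ?s q m')"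
    by (rule sum_product)
  also have "psubst \<kappa> \<sigma> \<dots> = (\<Sum>m\<in>?P. psubst \<kappa> \<sigma> (?s p m)) * (\<Sum>m\<in>?Q. psubst \<kappa> \<sigma> (?s q m))"
    by (simp add: psubst_sum single sum_product)
  also have "\<dots> = psubst \<kappa> \<sigma> p * psubst \<kappa> \<sigma> q"
    by (simp flip: psubst_sum poly_mapping_eq_sum_single)
  finally show ?thesis .
qed

lemma psubst_uminus [simp]: "psubst \<kappa> \<sigma> (- p) = - psubst \<kappa> \<sigma> p"
  using psubst_add[of \<sigma> "- p" p] by (simp del: psubst_add add: eq_neg_iff_add_eq_0)

lemma psubst_diff [simp]: "psubst \<kappa> \<sigma> (p - q) = psubst \<kappa> \<sigma> p - psubst \<kappa> \<sigma> q"
  using psubst_add[of \<sigma> p "- q"] by (simp del: psubst_add)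

lemma psubst_power [simp]: "psubst \<kappa> \<sigma> (p ^ n) = psubst \<kappa> \<sigma> p ^ n"
  by (induction n) simp_all

lemma psubst_prod: "psubst \<kappa> \<sigma> (prod f A) = (\<Prod>i\<in>A. psubst \<kappa> \<sigma> (f i))"
  by (induction A rule: infinite_finite_induct) simp_all

lemma psubst_cubic [simp]: "psubst \<kappa> \<sigma> (cubic a x) = cubic (psubst \<kappa> \<sigma> a) (\<lambda>i. psubst \<kappa> \<sigma> (x i))"
  by (simp add: cubic_def)

end

interpretation PConst: coeff_hom PConst
  by standard (simp_all add: PConst_simps)

interpretation id: coeff_hom "id :: complex \<Rightarrow> complex"
  by standard (simp_all only: id_apply)

interpretation lin: coeff_hom "\<lambda>c. [:c:]"
  by standard (simp_all add: one_pCons)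

definition ev :: "('v \<Rightarrow> complex) \<Rightarrow> 'v cpoly \<Rightarrow> complex" where
  "ev = psubst id"

lemma ev_simps [simp]:
  "ev x (PConst c) = c" "ev x (PVar v) = x v" "ev x 0 = 0" "ev x 1 = 1"
  "ev x (p + q) = ev x p + ev x q" "ev x (p - q) = ev x p - ev x q" "ev x (- p) = - ev x p"
  "ev x (p * q) = ev x p * ev x q" "ev x (p ^ n) = ev x p ^ n"
  by (simp_all only: ev_def id.psubst_PConst id.psubst_PVar id.psubst_zero id.psubst_one
      id.psubst_add id.psubst_diff id.psubst_uminus id.psubst_mult id.psubst_power id_apply)

lemma ev_sum: "ev x (sum f A) = (\<Sum>i\<in>A. ev x (f i))"
  by (simp only: ev_def id.psubst_sum)

lemma ev_cubic [simp]: "ev x (cubic a y) = cubic (ev x a) (\<lambda>i. ev x (y i))"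
  by (simp only: ev_def id.psubst_cubic)

text \<open>Turns vanishing at the points of a parametrised curve into a question about the roots of
  one univariate polynomial.\<close>

lemma poly_psubst: "poly (psubst (\<lambda>c. [:c:]) \<sigma> p) t = ev (\<lambda>v. poly (\<sigma> v) t) p"
  by (induction p rule: cpoly_induct) simp_all

section \<open>Quotients and presentations of algebras\<close>

lemma poly_alg_simps [simp]:
  "carrier poly_alg = UNIV" "\<zero>\<^bsub>poly_alg\<^esub> = 0" "\<one>\<^bsub>poly_alg\<^esub> = 1"
  "p \<oplus>\<^bsub>poly_alg\<^esub> q = p + q" "p \<otimes>\<^bsub>poly_alg\<^esub> q = p * q" "scal poly_alg = PConst"
  by (simp_all add: poly_alg_def ring_of_type_algebra_def ring.defs)

lemma complex_ring_simps [simp]: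
  "carrier (ring_of_type_algebra :: complex ring) = UNIV"
  "\<zero>\<^bsub>(ring_of_type_algebra :: complex ring)\<^esub> = 0" "\<one>\<^bsub>(ring_of_type_algebra :: complex ring)\<^esub> = 1"
  "a \<oplus>\<^bsub>(ring_of_type_algebra :: complex ring)\<^esub> b = a + b"
  "a \<otimes>\<^bsub>(ring_of_type_algebra :: complex ring)\<^esub> b = a * b"
  by (simp_all add: ring_of_type_algebra_def)

text \<open>The added record field does not touch the operations, but the extended record has
  another type, so the axioms are checked again.\<close>

lemma cring_extend:
  assumes "cring (R :: 'a ring)"
  shows "cring (ring.extend R (E :: 'b))"
proof -
  interpret cring R by fact
  show ?thesis
  proof (rule cringI)
    show "abelian_group (ring.extend R E)"
    proof (rule abelian_groupI)
      show "\<exists>y\<in>carrier (ring.extend R E). y \<oplus>\<^bsub>ring.extend R E\<^esub> x = \<zero>\<^bsub>ring.extend R E\<^esub>"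
        if "x \<in> carrier (ring.extend R E)" for x
        using that l_neg[of x] by (intro bexI[of _ "\<ominus>\<^bsub>R\<^esub> x"]) (auto simp: ring.defs)
    qed (auto simp: ring.defs a_assoc a_comm a_lcomm)
    show "Group.comm_monoid (ring.extend R E)"
      by (rule comm_monoidI) (simp_all add: ring.defs m_assoc, rule m_comm)
    show "(x \<oplus>\<^bsub>ring.extend R E\<^esub> y) \<otimes>\<^bsub>ring.extend R E\<^esub> z
        = x \<otimes>\<^bsub>ring.extend R E\<^esub> z \<oplus>\<^bsub>ring.extend R E\<^esub> y \<otimes>\<^bsub>ring.extend R E\<^esub> z"
      if "x \<in> carrier (ring.extend R E)" "y \<in> carrier (ring.extend R E)" "z \<in> carrier (ring.extend R E)" for x y z
      using that by (simp add: ring.defs l_distr)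
  qed
qed

lemma cring_poly_alg: "cring poly_alg"
  unfolding poly_alg_def by (rule cring_extend) (rule cring_from_type_algebra)

interpretation poly_alg: cring poly_alg
  by (rule cring_poly_alg)

lemma poly_alg_a_inv [simp]: "\<ominus>\<^bsub>poly_alg\<^esub> p = - p"
  by (rule poly_alg.minus_equality) simp_all

lemma poly_alg_minus [simp]: "p \<ominus>\<^bsub>poly_alg\<^esub> q = p - q"
  by (simp add: a_minus_def)

abbreviation pideal :: "'v cpoly set \<Rightarrow> 'v cpoly set" where
  "pideal S \<equiv> Idl\<^bsub>poly_alg\<^esub> S"

lemma ideal_pideal: "ideal (pideal S) poly_alg"
  by (rule poly_alg.genideal_ideal) simp

lemma pideal_self: "p \<in> S \<Longrightarrow> p \<in> pideal S"
  using poly_alg.genideal_self[of S] by auto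

lemma pideal_zero [simp]: "0 \<in> pideal S"
  using additive_subgroup.zero_closed[OF ideal.axioms(1)[OF ideal_pideal]] by simp

lemma pideal_add: "p \<in> pideal S \<Longrightarrow> q \<in> pideal S \<Longrightarrow> p + q \<in> pideal S"
  using additive_subgroup.a_closed[OF ideal.axioms(1)[OF ideal_pideal]] by simp

lemma pideal_mult: "p \<in> pideal S \<Longrightarrow> q * p \<in> pideal S"
  using ideal.I_l_closed[OF ideal_pideal] by simp

lemma pideal_uminus: "p \<in> pideal S \<Longrightarrow> - p \<in> pideal S"
  using pideal_mult[of p S "- 1"] by simp

lemma pideal_diff: "p \<in> pideal S \<Longrightarrow> q \<in> pideal S \<Longrightarrow> p - q \<in> pideal S"
  using pideal_add[OF _ pideal_uminus] by fastforce

lemma pideal_sum: "(\<And>i. i \<in> I \<Longrightarrow> f i \<in> pideal S) \<Longrightarrow> sum f I \<in> pideal S"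
  by (induction I rule: infinite_finite_induct) (auto intro: pideal_add)

lemma idealI_poly_alg:
  assumes "0 \<in> J" "\<And>p q. p \<in> J \<Longrightarrow> q \<in> J \<Longrightarrow> p + q \<in> J" "\<And>p q. p \<in> J \<Longrightarrow> q * p \<in> J"
  shows "ideal J poly_alg"
proof (rule idealI)
  show "ring poly_alg" by (rule poly_alg.ring_axioms)
  have "- p \<in> J" if "p \<in> J" for p using assms(3)[OF that, of "-1"] by simp
  moreover have "inv\<^bsub>add_monoid poly_alg\<^esub> p = - p" for p :: "'a cpoly"
    using poly_alg_a_inv[of p] by (simp add: a_inv_def)
  ultimately show "subgroup J (add_monoid poly_alg)"
    using assms by (intro subgroup.intro) auto
  show "a \<in> J \<Longrightarrow> x \<in> carrier poly_alg \<Longrightarrow> x \<otimes>\<^bsub>poly_alg\<^esub> a \<in> J"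
    and "a \<in> J \<Longrightarrow> x \<in> carrier poly_alg \<Longrightarrow> a \<otimes>\<^bsub>poly_alg\<^esub> x \<in> J" for a x
    using assms(3)[of a x] by (simp_all add: mult.commute)
qed

text \<open>Serves as induction over membership in a generated ideal, with \<open>J\<close> the set
  of polynomials that have the desired property.\<close>

lemma pideal_minimal:
  assumes "p \<in> pideal S" "\<And>s. s \<in> S \<Longrightarrow> s \<in> J" "0 \<in> J"
    "\<And>p q. p \<in> J \<Longrightarrow> q \<in> J \<Longrightarrow> p + q \<in> J" "\<And>p q. p \<in> J \<Longrightarrow> q * p \<in> J"
  shows "p \<in> J"
  using poly_alg.genideal_minimal[OF idealI_poly_alg, of J S] assms by blast

lemma ev_pideal:
  assumes "p \<in> pideal S" "\<And>s. s \<in> S \<Longrightarrow> ev x s = 0"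
  shows "ev x p = 0"
  using pideal_minimal[of p S "{p. ev x p = 0}"] assms by auto

lemma psubst_pideal:
  assumes "p \<in> pideal S" "\<And>s. s \<in> S \<Longrightarrow> psubst PConst \<sigma> s \<in> pideal T"
  shows "psubst PConst \<sigma> p \<in> pideal T"
  using pideal_minimal[of p S "{p. psubst PConst \<sigma> p \<in> pideal T}"] assms
  by (auto intro: pideal_add pideal_mult)

lemma quot_alg_simps:
  "carrier (quot_alg A I) = {I +>\<^bsub>A\<^esub> a | a. a \<in> carrier A}" "\<zero>\<^bsub>quot_alg A I\<^esub> = I"
  "\<one>\<^bsub>quot_alg A I\<^esub> = I +>\<^bsub>A\<^esub> \<one>\<^bsub>A\<^esub>" "scal (quot_alg A I) c = I +>\<^bsub>A\<^esub> scal A c"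
  by (auto simp: quot_alg_def ring.defs FactRing_simps)

lemma cring_quot_alg: "cring A \<Longrightarrow> ideal I A \<Longrightarrow> cring (quot_alg A I)"
  unfolding quot_alg_def by (intro cring_extend ideal.quotient_is_cring)

lemma quot_alg_coset_hom: "ideal I A \<Longrightarrow> (+>\<^bsub>A\<^esub>) I \<in> ring_hom A (quot_alg A I)"
  using ideal.rcos_ring_hom[of I A] by (simp add: ring_hom_def quot_alg_def ring.defs Pi_def)

lemma quot_alg_coset_zero_iff:
  assumes "ideal I A" "a \<in> carrier A"
  shows "I +>\<^bsub>A\<^esub> a = \<zero>\<^bsub>quot_alg A I\<^esub> \<longleftrightarrow> a \<in> I"
proof -
  interpret ideal I A by fact
  show ?thesis
    using a_rcos_self[OF assms(2)] a_rcos_const by (auto simp: quot_alg_simps)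
qed

locale presented =
  fixes A :: "'a calgebra" and S :: "'v cpoly set" and \<pi> :: "'v cpoly \<Rightarrow> 'a"
  assumes cring_alg: "cring A"
    and hom: "\<pi> \<in> ring_hom poly_alg A"
    and carrier_eq: "carrier A = range \<pi>"
    and scal_eq: "scal A c = \<pi> (PConst c)"
    and ker: "\<pi> p = \<zero>\<^bsub>A\<^esub> \<longleftrightarrow> p \<in> pideal S"
begin

sublocale cring A by (rule cring_alg)

lemma pi_closed [simp]: "\<pi> p \<in> carrier A"
  by (simp add: carrier_eq)

lemma pi_add: "\<pi> (p + q) = \<pi> p \<oplus>\<^bsub>A\<^esub> \<pi> q"
  using ring_hom_add[OF hom, of p q] by simp

lemma pi_mult: "\<pi> (p * q) = \<pi> p \<otimes>\<^bsub>A\<^esub> \<pi> q"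
  using ring_hom_mult[OF hom, of p q] by simp

lemma pi_one: "\<pi> 1 = \<one>\<^bsub>A\<^esub>"
  using ring_hom_one[OF hom] by simp

lemma pi_zero: "\<pi> 0 = \<zero>\<^bsub>A\<^esub>"
  by (simp add: ker)

lemma pi_uminus: "\<pi> (- p) = \<ominus>\<^bsub>A\<^esub> \<pi> p"
  using pi_add[of "- p" p] by (intro minus_equality[symmetric]) (simp_all add: pi_zero)

lemma pi_diff: "\<pi> (p - q) = \<pi> p \<ominus>\<^bsub>A\<^esub> \<pi> q"
  using pi_add[of p "- q"] by (simp add: pi_uminus a_minus_def)

lemma pi_eq_iff: "\<pi> p = \<pi> q \<longleftrightarrow> p - q \<in> pideal S"
  using ker[of "p - q"] by (simp add: pi_diff r_right_minus_eq)

lemma carrierE: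
  assumes "a \<in> carrier A" obtains p where "a = \<pi> p"
  using assms by (auto simp: carrier_eq)

text \<open>Two uses: \<open>I\<close> is generated by known relations, as for \<open>pquot\<close>,
  or \<open>T\<close> is the full preimage of \<open>I\<close>, which is its own generating set, as
  for A/m^2 and for the fibres.\<close>

lemma quotient:
  assumes "ideal I A" "\<And>p. p \<in> pideal T \<longleftrightarrow> \<pi> p \<in> I"
  shows "presented (quot_alg A I) T (\<lambda>p. I +>\<^bsub>A\<^esub> \<pi> p)"
proof (rule presented.intro)
  show "cring (quot_alg A I)" by (rule cring_quot_alg) (use assms cring_alg in auto)
  show "(\<lambda>p. I +>\<^bsub>A\<^esub> \<pi> p) \<in> ring_hom poly_alg (quot_alg A I)"
    using ring_hom_trans[OF hom quot_alg_coset_hom[OF assms(1)]] by (simp add: comp_def)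
  show "carrier (quot_alg A I) = range (\<lambda>p. I +>\<^bsub>A\<^esub> \<pi> p)"
    by (auto simp: quot_alg_simps carrier_eq)
  show "scal (quot_alg A I) c = I +>\<^bsub>A\<^esub> \<pi> (PConst c)" for c
    by (simp add: quot_alg_simps scal_eq)
  show "I +>\<^bsub>A\<^esub> \<pi> p = \<zero>\<^bsub>quot_alg A I\<^esub> \<longleftrightarrow> p \<in> pideal T" for p
    by (simp add: quot_alg_coset_zero_iff[OF assms(1)] assms(2))
qed

end

lemma pideal_empty: "p \<in> pideal {} \<longleftrightarrow> p = 0"
  using pideal_minimal[of p "{}" "{0}"] by auto

lemma presented_poly_alg: "presented poly_alg {} (\<lambda>p. p)"
  by standard (auto simp: ring_hom_def pideal_empty)

lemma presented_pquot: "presented (pquot S) S (pclass S)"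
  unfolding pquot_def pclass_def
  by (rule presented.quotient[OF presented_poly_alg]) (simp_all add: ideal_pideal)

context presented
begin

text \<open>First isomorphism theorem: equality of classes is decided by the same ideal on both
  sides, so a value computed from any chosen representative is well defined.\<close>

lemma calg_iso_exists: "\<exists>h \<in> calg_iso (pquot S) A. \<forall>p. h (pclass S p) = \<pi> p"
proof -
  interpret Q: presented "pquot S" S "pclass S" by (rule presented_pquot)
  define h where "h c = \<pi> (SOME p. c = pclass S p)" for c
  have h: "h (pclass S p) = \<pi> p" for p
  proof -
    have "pclass S p = pclass S (SOME q. pclass S p = pclass S q)"
      by (rule someI[of "\<lambda>q. pclass S p = pclass S q" p]) (rule refl)
    then show ?thesis unfolding h_def by (metis pi_eq_iff Q.pi_eq_iff)
  qed
  have "h \<in> ring_hom (pquot S) A"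
  proof (rule ring_hom_memI)
    fix a b assume "a \<in> carrier (pquot S)" "b \<in> carrier (pquot S)"
    then obtain p q where "a = pclass S p" "b = pclass S q" by (auto simp: Q.carrier_eq)
    then show "h (a \<otimes>\<^bsub>pquot S\<^esub> b) = h a \<otimes>\<^bsub>A\<^esub> h b" "h (a \<oplus>\<^bsub>pquot S\<^esub> b) = h a \<oplus>\<^bsub>A\<^esub> h b"
      by (metis h Q.pi_mult pi_mult, metis h Q.pi_add pi_add)
  qed (auto simp: h Q.carrier_eq pi_one simp flip: Q.pi_one)
  moreover have "bij_betw h (carrier (pquot S)) (carrier A)"
    by (auto simp: bij_betw_def inj_on_def Q.carrier_eq carrier_eq h pi_eq_iff Q.pi_eq_iff image_image)
  moreover have "h (scal (pquot S) c) = scal A c" for c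
    by (simp add: Q.scal_eq scal_eq h)
  ultimately show ?thesis
    using h by (auto simp: calg_iso_def ring_iso_def)
qed

lemma cpoint_eval:
  assumes "\<phi> \<in> cpoints A"
  shows "\<phi> (\<pi> p) = ev (\<lambda>v. \<phi> (\<pi> (PVar v))) p"
proof (induction p rule: cpoly_induct)
  case (const c)
  then show ?case using assms by (simp add: cpoints_def flip: scal_eq)
next
  case (add p q)
  have "\<phi> (\<pi> p \<oplus>\<^bsub>A\<^esub> \<pi> q) = \<phi> (\<pi> p) + \<phi> (\<pi> q)"
    using assms ring_hom_add[of \<phi> A ring_of_type_algebra "\<pi> p" "\<pi> q"] by (simp add: cpoints_def)
  with add show ?case by (simp add: pi_add)
next
  case (mult p q)
  have "\<phi> (\<pi> p \<otimes>\<^bsub>A\<^esub> \<pi> q) = \<phi> (\<pi> p) * \<phi> (\<pi> q)"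
    using assms ring_hom_mult[of \<phi> A ring_of_type_algebra "\<pi> p" "\<pi> q"] by (simp add: cpoints_def)
  with mult show ?case by (simp add: pi_mult)
qed simp

lemma cpoint_relations:
  assumes "\<phi> \<in> cpoints A" "p \<in> pideal S"
  shows "ev (\<lambda>v. \<phi> (\<pi> (PVar v))) p = 0"
proof -
  have "\<pi> p = \<pi> 0" using assms(2) by (simp add: pi_eq_iff)
  then have "\<phi> (\<pi> p) = \<phi> (\<pi> 0)" by simp
  then show ?thesis using cpoint_eval[OF assms(1), of p] cpoint_eval[OF assms(1), of 0] by simp
qed

lemma cpoint_eqI:
  assumes "\<phi> \<in> cpoints A" "\<psi> \<in> cpoints A" "\<And>v. \<phi> (\<pi> (PVar v)) = \<psi> (\<pi> (PVar v))"
  shows "\<phi> = \<psi>"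
proof (rule extensionalityI)
  show "\<phi> \<in> extensional (carrier A)" "\<psi> \<in> extensional (carrier A)"
    using assms by (auto simp: cpoints_def)
  show "\<phi> a = \<psi> a" if "a \<in> carrier A" for a
  proof -
    from that obtain p where "a = \<pi> p" by (rule carrierE)
    then show ?thesis
      using cpoint_eval[OF assms(1), of p] cpoint_eval[OF assms(2), of p] by (simp only: assms(3))
  qed
qed

text \<open>Meaningful when \<open>x\<close> is a common zero of \<open>S\<close>: then the choice
  of representative does not matter. The restriction to the carrier provides the extensionality
  built into \<open>cpoints\<close>.\<close>

definition point :: "('v \<Rightarrow> complex) \<Rightarrow> 'a \<Rightarrow> complex" where
  "point x = (\<lambda>a\<in>carrier A. ev x (SOME p. a = \<pi> p))"

lemma point_eval:
  assumes "\<And>s. s \<in> S \<Longrightarrow> ev x s = 0"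
  shows "point x (\<pi> p) = ev x p"
proof -
  have "\<pi> p = \<pi> (SOME q. \<pi> p = \<pi> q)"
    by (rule someI[of "\<lambda>q. \<pi> p = \<pi> q" p]) (rule refl)
  then have "p - (SOME q. \<pi> p = \<pi> q) \<in> pideal S" by (simp only: pi_eq_iff)
  from ev_pideal[OF this, of x] assms show ?thesis
    by (simp add: point_def)
qed

lemma point_cpoint:
  assumes "\<And>s. s \<in> S \<Longrightarrow> ev x s = 0"
  shows "point x \<in> cpoints A"
proof -
  note pe = point_eval[OF assms, simplified]
  have "point x \<in> ring_hom A ring_of_type_algebra"
    by (rule ring_hom_memI)
      (auto elim!: carrierE simp: pe simp flip: pi_add pi_mult pi_one)
  then show ?thesis
    by (auto simp: cpoints_def scal_eq pe) (auto simp: point_def)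
qed

end

section \<open>Cotangent spaces\<close>

text \<open>The coefficient of t in p(c + t w). The product rule is then the formula for the first
  coefficient of a product of univariate polynomials.\<close>

definition dirderiv :: "('v \<Rightarrow> complex) \<Rightarrow> ('v \<Rightarrow> complex) \<Rightarrow> 'v cpoly \<Rightarrow> complex" where
  "dirderiv c w p = Polynomial.coeff (psubst (\<lambda>a. [:a:]) (\<lambda>v. [:c v, w v:]) p) 1"

lemma coeff_0_psubst_line: "Polynomial.coeff (psubst (\<lambda>a. [:a:]) (\<lambda>v. [:c v, w v:]) p) 0 = ev c p"
  using poly_psubst[of "\<lambda>v. [:c v, w v:]" p 0] by (simp add: poly_0_coeff_0)

lemma dirderiv_simps [simp]:
  "dirderiv c w (PConst a) = 0" "dirderiv c w (PVar v) = w v" "dirderiv c w 0 = 0" "dirderiv c w 1 = 0"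
  "dirderiv c w (p + q) = dirderiv c w p + dirderiv c w q"
  "dirderiv c w (p - q) = dirderiv c w p - dirderiv c w q"
  "dirderiv c w (p * q) = ev c p * dirderiv c w q + dirderiv c w p * ev c q"
  by (simp_all add: dirderiv_def Polynomial.coeff_mult coeff_0_psubst_line)

lemma dirderiv_sum: "dirderiv c w (sum f I) = (\<Sum>i\<in>I. dirderiv c w (f i))"
  by (induction I rule: infinite_finite_induct) simp_all

abbreviation unit_vec :: "'v \<Rightarrow> 'v \<Rightarrow> complex" where
  "unit_vec u \<equiv> (\<lambda>v. if v = u then 1 else 0)"

text \<open>\<open>J\<close> stands for an ideal containing the square of the maximal ideal at
  \<open>c\<close>. For a product, the new remainder is a combination of the two old ones and of the
  product of two polynomials vanishing at \<open>c\<close>.\<close>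

lemma taylor_first_order:
  fixes c :: "'v \<Rightarrow> complex"
  assumes fin: "finite (UNIV :: 'v set)" and "ideal J poly_alg"
    and prod: "\<And>p q. ev c p = 0 \<Longrightarrow> ev c q = 0 \<Longrightarrow> p * q \<in> J"
  shows "p - PConst (ev c p) - (\<Sum>v\<in>UNIV. PConst (dirderiv c (unit_vec v) p) * (PVar v - PConst (c v))) \<in> J"
    (is "?r p \<in> J")
proof -
  interpret ideal J poly_alg by fact
  have J_add: "p \<in> J \<Longrightarrow> q \<in> J \<Longrightarrow> p + q \<in> J" and J_mult: "p \<in> J \<Longrightarrow> q * p \<in> J" for p q
    using a_closed[of p q] I_l_closed[of p q] by simp_all
  let ?L = "\<lambda>p. \<Sum>v\<in>UNIV. PConst (dirderiv c (unit_vec v) p) * (PVar v - PConst (c v))"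
  show ?thesis
  proof (induction p rule: cpoly_induct)
    case (const a)
    then show ?case using zero_closed by (simp add: PConst_simps)
  next
    case (var u)
    have "?L (PVar u) = PVar u - PConst (c u)"
      by (subst sum.remove[of _ u]) (auto simp: fin PConst_simps intro!: sum.neutral)
    then show ?case using zero_closed by simp
  next
    case (add p q)
    have "?r (p + q) = ?r p + ?r q"
      by (simp add: PConst_simps sum.distrib distrib_right)
    then show ?case using J_add[OF add] by (simp only:)
  next
    case (mult p q)
    have "?L (p * q) = PConst (ev c p) * ?L q + PConst (ev c q) * ?L p"
      by (simp add: PConst_simps sum_distrib_left algebra_simps flip: sum.distrib)
    then have "?r (p * q) = PConst (ev c p) * ?r q + (PConst (ev c q) * ?r p
        + (p - PConst (ev c p)) * (q - PConst (ev c q)))"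
      by (simp add: PConst_simps) (simp add: algebra_simps)
    then show ?case
      using mult by (simp only:) (intro J_add J_mult prod, simp_all)
  qed
qed

text \<open>The constants form a subfield of A/m^2, which is not the zero ring because m^2 lies in m
  and m omits 1; over a subfield the dimension is unique. This is what excludes every candidate
  dimension at a singular point.\<close>

lemma has_cotangent_dimension_unique:
  assumes "cring A" "ideal m A" "\<one>\<^bsub>A\<^esub> \<notin> m" "scal A \<in> ring_hom ring_of_type_algebra A"
    and "has_cotangent_dimension A m d" "has_cotangent_dimension A m d'"
  shows "d = d'"
proof -
  let ?J = "ideal_prod A m m"
  let ?B = "quot_alg A ?J"
  interpret A: cring A by fact
  have J: "ideal ?J A" by (rule A.ideal_prod_is_ideal) (use assms in auto)
  have "?J \<subseteq> m" using A.ideal_prod_inter[of m m] assms by blast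
  interpret B: cring ?B by (rule cring_quot_alg) (use assms J in auto)
  have hom: "scal ?B \<in> ring_hom ring_of_type_algebra ?B"
  proof -
    have "scal ?B = (+>\<^bsub>A\<^esub>) ?J \<circ> scal A" by (simp add: fun_eq_iff quot_alg_simps)
    then show ?thesis using ring_hom_trans[OF assms(4) quot_alg_coset_hom[OF J]] by simp
  qed
  have "\<one>\<^bsub>?B\<^esub> \<noteq> \<zero>\<^bsub>?B\<^esub>"
    using quot_alg_coset_zero_iff[OF J A.one_closed] \<open>?J \<subseteq> m\<close> assms(3) by (auto simp: quot_alg_simps)
  moreover have "subfield UNIV (ring_of_type_algebra :: complex ring)"
    using field.carrier_is_subfield[of "ring_of_type_algebra :: complex ring"]
      field_from_type_algebra by simp
  moreover have "ring_hom_ring (ring_of_type_algebra :: complex ring) ?B (scal ?B)"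
    by (rule ring_hom_ringI2) (auto intro: hom ring_from_type_algebra B.ring_axioms)
  ultimately have "subfield (range (scal ?B)) ?B"
    using ring_hom_ring.img_is_subfield(2) by blast
  then show ?thesis
    using B.dimension_is_inj assms(5,6) by (simp add: has_cotangent_dimension_def Let_def)
qed

context presented
begin

lemma scal_hom: "scal A \<in> ring_hom ring_of_type_algebra A"
  by (rule ring_hom_memI) (simp_all add: scal_eq PConst_simps pi_add pi_mult pi_one)

lemma ideal_preimage:
  assumes "ideal I A"
  shows "ideal {p. \<pi> p \<in> I} poly_alg"
proof -
  interpret ideal I A by fact
  show ?thesis
    by (rule idealI_poly_alg) (simp_all add: pi_zero pi_add pi_mult I_l_closed)
qed

lemma pideal_ideal: "ideal T poly_alg \<Longrightarrow> pideal T = T"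
  using poly_alg.genideal_minimal[of T T] pideal_self[of _ T] by blast

lemma point_ideal_iff: "\<phi> \<in> cpoints A \<Longrightarrow> \<pi> p \<in> point_ideal A \<phi> \<longleftrightarrow> ev (\<lambda>v. \<phi> (\<pi> (PVar v))) p = 0"
  using cpoint_eval[of \<phi> p] by (simp add: point_ideal_def)

lemma ideal_point_ideal:
  assumes "\<phi> \<in> cpoints A"
  shows "ideal (point_ideal A \<phi>) A"
proof (rule idealI)
  show "ring A" by (rule ring_axioms)
  note iff = point_ideal_iff[OF assms]
  have sub: "point_ideal A \<phi> \<subseteq> carrier A" by (auto simp: point_ideal_def)
  show "subgroup (point_ideal A \<phi>) (add_monoid A)"
  proof (rule add.subgroupI)
    show "point_ideal A \<phi> \<noteq> {}" using iff[of 0] by auto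
    show "\<ominus>\<^bsub>A\<^esub> a \<in> point_ideal A \<phi>" if "a \<in> point_ideal A \<phi>" for a
    proof -
      from that sub obtain p where "a = \<pi> p" by (auto simp: carrier_eq)
      with that show ?thesis using iff[of "- p"] iff[of p] by (simp add: pi_uminus)
    qed
    show "a \<oplus>\<^bsub>A\<^esub> b \<in> point_ideal A \<phi>" if "a \<in> point_ideal A \<phi>" "b \<in> point_ideal A \<phi>" for a b
    proof -
      from that sub obtain p q where "a = \<pi> p" "b = \<pi> q" unfolding carrier_eq by blast
      with that show ?thesis using iff[of "p + q"] iff[of p] iff[of q] by (simp add: pi_add)
    qed
  qed (use sub in auto)
  show "x \<otimes>\<^bsub>A\<^esub> a \<in> point_ideal A \<phi>" if "a \<in> point_ideal A \<phi>" "x \<in> carrier A" for a x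
  proof -
    from that sub obtain p q where "a = \<pi> p" "x = \<pi> q" by (auto simp: carrier_eq)
    with that show ?thesis using iff[of "q * p"] iff[of p] by (simp add: pi_mult)
  qed
  then show "a \<otimes>\<^bsub>A\<^esub> x \<in> point_ideal A \<phi>" if "a \<in> point_ideal A \<phi>" "x \<in> carrier A" for a x
    using that sub m_comm[of a x] by auto
qed

lemma one_notin_point_ideal: "\<phi> \<in> cpoints A \<Longrightarrow> \<one>\<^bsub>A\<^esub> \<notin> point_ideal A \<phi>"
  using point_ideal_iff[of \<phi> 1] by (simp add: pi_one)

lemma cotangent_dimension_unique:
  assumes "\<phi> \<in> cpoints A" "has_cotangent_dimension A (point_ideal A \<phi>) d"
    "has_cotangent_dimension A (point_ideal A \<phi>) d'"
  shows "d = d'"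
  using has_cotangent_dimension_unique[OF cring_alg ideal_point_ideal[OF assms(1)]
      one_notin_point_ideal[OF assms(1)] scal_hom assms(2,3)] .

text \<open>Jacobian criterion with chosen pivots: \<open>vs\<close> are the variables that stay
  coordinates on the tangent space. The relations from \<open>rel\<close> are in reduced form and
  eliminate the other variables, so the classes of \<open>vs\<close> span m/m^2; the tangent vectors
  from \<open>tangent\<close> are dual to \<open>vs\<close> and show independence.\<close>

lemma has_cotangent_dimension_jacobian:
  fixes c :: "'v \<Rightarrow> complex"
  assumes fin: "finite (UNIV :: 'v set)"
    and phi: "\<phi> \<in> cpoints A" and c: "\<And>v. \<phi> (\<pi> (PVar v)) = c v" and dist: "distinct vs"
    and rel: "\<And>u. u \<notin> set vs \<Longrightarrow> \<exists>r\<in>pideal S. dirderiv c (unit_vec u) r = 1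
      \<and> (\<forall>w. w \<notin> set vs \<longrightarrow> w \<noteq> u \<longrightarrow> dirderiv c (unit_vec w) r = 0)"
    and tangent: "\<And>v. v \<in> set vs \<Longrightarrow> \<exists>w. (\<forall>s\<in>S. dirderiv c w s = 0)
      \<and> (\<forall>v'\<in>set vs. w v' = unit_vec v v')"
  shows "has_cotangent_dimension A (point_ideal A \<phi>) (length vs)"
proof -
  let ?m = "point_ideal A \<phi>"
  let ?J = "ideal_prod A ?m ?m"
  let ?B = "quot_alg A ?J"
  have m_iff: "\<pi> p \<in> ?m \<longleftrightarrow> ev c p = 0" for p
    using point_ideal_iff[OF phi] by (simp add: c)
  have idm: "ideal ?m A" by (rule ideal_point_ideal[OF phi])
  have J: "ideal ?J A" by (rule ideal_prod_is_ideal) (rule idm)+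
  define T where "T = {p. \<pi> p \<in> ?J}"
  have idT: "ideal T poly_alg" unfolding T_def by (rule ideal_preimage[OF J])
  have pT: "pideal T = T" by (rule pideal_ideal[OF idT])
  define k where "k p = ?J +>\<^bsub>A\<^esub> \<pi> p" for p
  interpret B: presented ?B T k
    unfolding k_def by (rule quotient[OF J]) (subst pT, simp add: T_def)
  have S_T: "p \<in> T" if "p \<in> pideal S" for p
    using that ideal.axioms(1)[OF J] by (auto simp: T_def additive_subgroup.zero_closed simp flip: ker)
  have ev_S: "ev c p = 0" if "p \<in> pideal S" for p
    using cpoint_relations[OF phi that] by (simp add: c)
  have prodT: "p * q \<in> T" if "ev c p = 0" "ev c q = 0" for p q
    using that by (simp add: T_def pi_mult ideal_prod.prod m_iff)
  \<comment> \<open>Differentiation along a tangent vector kills the relations and all products of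
    two elements vanishing at \<open>c\<close>, hence it is a well-defined functional on
    m/m^2.\<close>
  have deriv_T: "dirderiv c w p = 0" if "p \<in> T" and w: "\<And>s. s \<in> S \<Longrightarrow> dirderiv c w s = 0" for w p
  proof -
    have S0: "dirderiv c w p = 0" if "p \<in> pideal S" for p
    proof -
      have "p \<in> {p. ev c p = 0 \<and> dirderiv c w p = 0}"
        by (rule pideal_minimal[OF that]) (auto simp: w ev_S pideal_self)
      then show ?thesis by simp
    qed
    have eqD: "dirderiv c w p = dirderiv c w q \<and> ev c p = ev c q" if "\<pi> p = \<pi> q" for p q
      using that S0[of "p - q"] ev_S[of "p - q"] by (simp add: pi_eq_iff)
    have "\<exists>q. s = \<pi> q \<and> ev c q = 0 \<and> dirderiv c w q = 0" if "s \<in> ?J" for s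
      using that
    proof induction
      case (prod i j)
      then obtain p q where "i = \<pi> p" "j = \<pi> q" by (auto simp: point_ideal_def carrier_eq)
      with prod show ?case by (intro exI[of _ "p * q"]) (auto simp: pi_mult m_iff)
    next
      case (sum s t)
      then obtain p q where "s = \<pi> p \<and> ev c p = 0 \<and> dirderiv c w p = 0"
        "t = \<pi> q \<and> ev c q = 0 \<and> dirderiv c w q = 0" by blast
      then show ?case by (intro exI[of _ "p + q"]) (auto simp: pi_add)
    qed
    then obtain q where "\<pi> p = \<pi> q" "dirderiv c w q = 0" using \<open>p \<in> T\<close> by (auto simp: T_def)
    then show ?thesis using eqD[of p q] by simp
  qed
  define y where "y v = PVar v - PConst (c v)" for v
  have [simp]: "ev c (y v) = 0" "dirderiv c w (y v) = w v" for v w by (simp_all add: y_def)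
  define L where "L us = {k (\<Sum>v\<in>set us. PConst (a v) * y v) | a. True}" for us
  have dim: "B.dimension (length us) (range (scal ?B)) (L us)" if "distinct us" "set us \<subseteq> set vs" for us
    using that
  proof (induction us)
    case Nil
    have "L [] = {\<zero>\<^bsub>?B\<^esub>}" by (auto simp: L_def B.pi_zero)
    then show ?case by (simp only: list.size) (rule B.zero_dim)
  next
    case (Cons u us)
    have sum_Cons: "(\<Sum>v\<in>set (u # us). PConst (a v) * y v)
        = PConst (a u) * y u + (\<Sum>v\<in>set us. PConst (a v) * y v)" for a
      using Cons.prems by simp
    have "k (y u) \<notin> L us"
    proof
      assume "k (y u) \<in> L us"
      then obtain a where "k (y u) = k (\<Sum>v\<in>set us. PConst (a v) * y v)"
        by (auto simp: L_def)
      then have inT: "y u - (\<Sum>v\<in>set us. PConst (a v) * y v) \<in> T"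
        by (simp add: B.pi_eq_iff pT)
      have u: "u \<in> set vs" "u \<notin> set us" using Cons.prems by simp_all
      obtain w where w: "\<forall>s\<in>S. dirderiv c w s = 0" "\<forall>v'\<in>set vs. w v' = unit_vec u v'"
        using tangent[OF u(1)] by blast
      have "dirderiv c w (y u - (\<Sum>v\<in>set us. PConst (a v) * y v)) = 0"
        by (rule deriv_T[OF inT]) (use w(1) in blast)
      moreover have "w v = 0" if "v \<in> set us" for v
        using that w(2) Cons.prems u by auto
      then have "(\<Sum>v\<in>set us. a v * w v) = 0"
        by (intro sum.neutral) simp
      moreover have "w u = 1" using w(2) u by simp
      ultimately show False by (simp add: dirderiv_sum)
    qed
    moreover have "L (u # us) = B.line_extension (range (scal ?B)) (k (y u)) (L us)"
    proof (intro Set.set_eqI iffI)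
      fix x assume "x \<in> L (u # us)"
      then obtain a where "x = k (\<Sum>v\<in>set (u # us). PConst (a v) * y v)" by (auto simp: L_def)
      then have "x = scal ?B (a u) \<otimes>\<^bsub>?B\<^esub> k (y u) \<oplus>\<^bsub>?B\<^esub> k (\<Sum>v\<in>set us. PConst (a v) * y v)"
        by (simp only: sum_Cons B.pi_add B.pi_mult B.scal_eq)
      then show "x \<in> B.line_extension (range (scal ?B)) (k (y u)) (L us)"
        unfolding B.line_extension_mem_iff L_def by blast
    next
      fix x assume "x \<in> B.line_extension (range (scal ?B)) (k (y u)) (L us)"
      then obtain b a where x: "x = scal ?B b \<otimes>\<^bsub>?B\<^esub> k (y u) \<oplus>\<^bsub>?B\<^esub> k (\<Sum>v\<in>set us. PConst (a v) * y v)"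
        unfolding B.line_extension_mem_iff L_def by blast
      have "(\<Sum>v\<in>set us. PConst ((a(u := b)) v) * y v) = (\<Sum>v\<in>set us. PConst (a v) * y v)"
        using Cons.prems by (intro sum.cong) auto
      then have "x = k (\<Sum>v\<in>set (u # us). PConst ((a(u := b)) v) * y v)"
        unfolding sum_Cons x B.pi_add B.pi_mult B.scal_eq by simp
      then show "x \<in> L (u # us)" unfolding L_def by blast
    qed
    ultimately show ?case
      using Cons.IH Cons.prems by (auto intro!: B.Suc_dim)
  qed
  have "\<forall>u. \<exists>r. u \<notin> set vs \<longrightarrow> r \<in> pideal S \<and> dirderiv c (unit_vec u) r = 1
      \<and> (\<forall>w. w \<notin> set vs \<longrightarrow> w \<noteq> u \<longrightarrow> dirderiv c (unit_vec w) r = 0)"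
    using rel by blast
  then obtain r where r: "\<And>u. u \<notin> set vs \<Longrightarrow> r u \<in> pideal S \<and> dirderiv c (unit_vec u) (r u) = 1
      \<and> (\<forall>w. w \<notin> set vs \<longrightarrow> w \<noteq> u \<longrightarrow> dirderiv c (unit_vec w) (r u) = 0)"
    using choice[of "\<lambda>u r. u \<notin> set vs \<longrightarrow> r \<in> pideal S \<and> dirderiv c (unit_vec u) r = 1
      \<and> (\<forall>w. w \<notin> set vs \<longrightarrow> w \<noteq> u \<longrightarrow> dirderiv c (unit_vec w) r = 0)"] by blast
  have "(\<lambda>a. ?J +>\<^bsub>A\<^esub> a) ` ?m = L vs"
  proof (intro Set.set_eqI iffI)
    fix x assume "x \<in> L vs"
    then obtain a where "x = k (\<Sum>v\<in>set vs. PConst (a v) * y v)" by (auto simp: L_def)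
    moreover have "\<pi> (\<Sum>v\<in>set vs. PConst (a v) * y v) \<in> ?m"
      by (simp add: m_iff ev_sum)
    ultimately show "x \<in> (\<lambda>a. ?J +>\<^bsub>A\<^esub> a) ` ?m" by (auto simp: k_def)
  next
    fix x assume "x \<in> (\<lambda>a. ?J +>\<^bsub>A\<^esub> a) ` ?m"
    then obtain a where a: "x = ?J +>\<^bsub>A\<^esub> a" "a \<in> ?m" by blast
    then have "a \<in> carrier A" by (simp add: point_ideal_def)
    then obtain p where "a = \<pi> p" by (rule carrierE)
    with a have p: "x = k p" "ev c p = 0" by (simp_all add: k_def m_iff)
    \<comment> \<open>Subtracting multiples of the reduced relations keeps the class and makes all
      derivatives along eliminated variables zero.\<close>
    define q where "q = p - (\<Sum>u\<in>- set vs. PConst (dirderiv c (unit_vec u) p) * r u)"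
    have "p - q \<in> pideal S"
      unfolding q_def using r by (auto intro!: pideal_sum pideal_mult)
    then have q: "k p = k q" "ev c q = 0"
      using ev_S[of "p - q"] p by (auto simp: B.pi_eq_iff pT S_T)
    have "dirderiv c (unit_vec u) q = 0" if "u \<notin> set vs" for u
    proof -
      have "(\<Sum>w\<in>- set vs. dirderiv c (unit_vec w) p * dirderiv c (unit_vec u) (r w))
          = (\<Sum>w\<in>- set vs. if w = u then dirderiv c (unit_vec u) p else 0)"
        using r that by (intro sum.cong) auto
      then show ?thesis
        using that fin r by (simp add: q_def dirderiv_sum ev_S finite_subset[OF subset_UNIV])
    qed
    then have "(\<Sum>v\<in>UNIV. PConst (dirderiv c (unit_vec v) q) * y v)
        = (\<Sum>v\<in>set vs. PConst (dirderiv c (unit_vec v) q) * y v)"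
      by (intro sum.mono_neutral_right) (auto simp: fin PConst_simps)
    then have "k q = k (\<Sum>v\<in>set vs. PConst (dirderiv c (unit_vec v) q) * y v)"
      using taylor_first_order[OF fin idT, of c q] prodT q(2)
      by (simp add: B.pi_eq_iff pT y_def PConst_simps)
    then show "x \<in> L vs" using p q by (auto simp: L_def)
  qed
  then show ?thesis
    using dim[OF dist] by (simp add: has_cotangent_dimension_def Let_def)
qed

end

section \<open>Heights of the ideals of points\<close>

lemma rational_curve_clear_denominator:
  "\<exists>F n. \<forall>t. poly w t \<noteq> 0 \<longrightarrow> poly F t = poly w t ^ n * ev (\<lambda>v. poly (f v) t / poly w t) p"
proof (induction p rule: cpoly_induct)
  case (const c)
  show ?case by (rule exI[of _ "[:c:]"], rule exI[of _ 0]) simp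
next
  case (var v)
  show ?case by (rule exI[of _ "f v"], rule exI[of _ 1]) simp
next
  case (add p q)
  then obtain F n G m where
    "\<forall>t. poly w t \<noteq> 0 \<longrightarrow> poly F t = poly w t ^ n * ev (\<lambda>v. poly (f v) t / poly w t) p"
    "\<forall>t. poly w t \<noteq> 0 \<longrightarrow> poly G t = poly w t ^ m * ev (\<lambda>v. poly (f v) t / poly w t) q" by blast
  then show ?case
    by (intro exI[of _ "w ^ m * F + w ^ n * G"] exI[of _ "n + m"])
      (auto simp: power_add algebra_simps)
next
  case (mult p q)
  then obtain F n G m where
    "\<forall>t. poly w t \<noteq> 0 \<longrightarrow> poly F t = poly w t ^ n * ev (\<lambda>v. poly (f v) t / poly w t) p"
    "\<forall>t. poly w t \<noteq> 0 \<longrightarrow> poly G t = poly w t ^ m * ev (\<lambda>v. poly (f v) t / poly w t) q" by blast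
  then show ?case
    by (intro exI[of _ "F * G"] exI[of _ "n + m"]) (auto simp: power_add)
qed

text \<open>Two points of the parametrised set lie on a common rational curve contained in it, so two
  polynomials that both do not vanish on the set have a product that does not vanish on it.\<close>

lemma rational_param_prime:
  fixes f :: "'v \<Rightarrow> 'w cpoly" and w :: "'w cpoly" and T and c :: "'w \<Rightarrow> complex"
  defines "r \<equiv> \<lambda>s v. ev s (f v) / ev s w"
    and "Pts \<equiv> {s. ev s w \<noteq> 0 \<and> (\<forall>v. v \<notin> T \<longrightarrow> s v = c v)}"
  assumes prod: "\<And>s. s \<in> Pts \<Longrightarrow> ev (r s) (p * q) = 0"
  shows "(\<forall>s\<in>Pts. ev (r s) p = 0) \<or> (\<forall>s\<in>Pts. ev (r s) q = 0)"
proof (rule ccontr)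
  assume "\<not> ?thesis"
  then obtain s\<^sub>1 s\<^sub>2 where s: "s\<^sub>1 \<in> Pts" "ev (r s\<^sub>1) p \<noteq> 0" "s\<^sub>2 \<in> Pts" "ev (r s\<^sub>2) q \<noteq> 0"
    by blast
  define l where "l v = [:s\<^sub>1 v, s\<^sub>2 v - s\<^sub>1 v:]" for v
  define L where "L t = (\<lambda>v. poly (l v) t)" for t
  have L01: "L 0 = s\<^sub>1" "L 1 = s\<^sub>2" by (auto simp: L_def l_def)
  define W where "W = psubst (\<lambda>a. [:a:]) l w"
  define f' where "f' v = psubst (\<lambda>a. [:a:]) l (f v)" for v
  have W: "poly W t = ev (L t) w" and f': "poly (f' v) t = ev (L t) (f v)" for t v
    by (simp_all add: W_def f'_def poly_psubst L_def)
  have r: "r (L t) = (\<lambda>v. poly (f' v) t / poly W t)" for t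
    by (simp add: r_def W f')
  obtain F n where F: "\<And>t. poly W t \<noteq> 0 \<Longrightarrow> poly F t = poly W t ^ n * ev (r (L t)) p"
    unfolding r using rational_curve_clear_denominator[of W f' p] by auto
  obtain G m where G: "\<And>t. poly W t \<noteq> 0 \<Longrightarrow> poly G t = poly W t ^ m * ev (r (L t)) q"
    unfolding r using rational_curve_clear_denominator[of W f' q] by auto
  \<comment> \<open>The factor \<open>W\<close> covers the parameters where the denominator vanishes
    and the hypothesis on the product gives no information.\<close>
  have "poly (F * G * W) t = 0" for t
  proof (cases "poly W t = 0")
    case False
    then have "L t \<in> Pts"
      using s by (auto simp: Pts_def W L_def l_def)
    then show ?thesis using F[OF False] G[OF False] prod[of "L t"] by auto
  qed simp
  then have "F * G * W = 0" using poly_all_0_iff_0[of "F * G * W"] by blast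
  moreover have "poly W 0 \<noteq> 0" "poly W 1 \<noteq> 0"
    using s by (auto simp: W L01 Pts_def)
  ultimately show False
    using F[of 0] G[of 1] s by (auto simp: L01)
qed

context presented
begin

text \<open>\<open>f v / w\<close> parametrises a piece of the zero set through \<open>c\<close>,
  with the variables \<open>vs\<close> as free parameters. The i-th prime consists of the functions
  vanishing where the first i of them are frozen at their values in \<open>c\<close>; after all of
  them are frozen only the point itself is left.\<close>

lemma chain_exists:
  fixes f :: "'v \<Rightarrow> 'v cpoly" and w :: "'v cpoly" and c :: "'v \<Rightarrow> complex"
  defines "r \<equiv> \<lambda>s v. ev s (f v) / ev s w"
  assumes phi: "\<phi> \<in> cpoints A" and c: "\<And>v. \<phi> (\<pi> (PVar v)) = c v" and dist: "distinct vs"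
    and on: "\<And>s q. ev s w \<noteq> 0 \<Longrightarrow> q \<in> S \<Longrightarrow> ev (r s) q = 0"
    and free: "\<And>s v. ev s w \<noteq> 0 \<Longrightarrow> v \<in> set vs \<Longrightarrow> r s v = s v"
    and w: "ev c w \<noteq> 0" and rc: "r c = c"
  shows "\<exists>Q. (\<forall>i\<le>length vs. primeideal (Q i) A) \<and> (\<forall>i<length vs. Q i \<subset> Q (Suc i))
    \<and> Q (length vs) = point_ideal A \<phi>"
proof -
  define Pts where "Pts T = {s. ev s w \<noteq> 0 \<and> (\<forall>v. v \<notin> T \<longrightarrow> s v = c v)}" for T
  define Q where "Q T = {a \<in> carrier A. \<forall>s\<in>Pts T. point (r s) a = 0}" for T
  have Q: "\<pi> p \<in> Q T \<longleftrightarrow> (\<forall>s\<in>Pts T. ev (r s) p = 0)" for p T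
    by (auto simp: Q_def Pts_def point_eval on)
  have c_Pts: "c \<in> Pts T" for T by (simp add: Pts_def w)
  have Q_sub: "Q T \<subseteq> carrier A" for T by (auto simp: Q_def)
  have prime: "primeideal (Q T) A" for T
  proof (rule primeidealI)
    have "Q T = \<Inter> ((\<lambda>s. point_ideal A (point (r s))) ` Pts T)"
      using c_Pts[of T] by (auto simp: Q_def point_ideal_def)
    also have "ideal \<dots> A"
    proof (rule i_Intersect)
      fix I assume "I \<in> (\<lambda>s. point_ideal A (point (r s))) ` Pts T"
      then obtain s where I: "I = point_ideal A (point (r s))" and s: "ev s w \<noteq> 0"
        by (auto simp: Pts_def)
      have "point (r s) \<in> cpoints A" by (rule point_cpoint) (rule on[OF s])
      then show "ideal I A" unfolding I by (rule ideal_point_ideal)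
    qed (use c_Pts in blast)
    finally show "ideal (Q T) A" .
    have "\<pi> 1 \<notin> Q T" using c_Pts by (auto simp: Q)
    then show "carrier A \<noteq> Q T" using pi_closed by blast
    fix a b assume ab: "a \<in> carrier A" "b \<in> carrier A" "a \<otimes>\<^bsub>A\<^esub> b \<in> Q T"
    then obtain p q where pq: "a = \<pi> p" "b = \<pi> q" by (auto simp: carrier_eq)
    have "(\<forall>s\<in>Pts T. ev (r s) p = 0) \<or> (\<forall>s\<in>Pts T. ev (r s) q = 0)"
      unfolding Pts_def r_def
      by (rule rational_param_prime)
        (use ab(3) in \<open>simp add: pq Q flip: pi_mult, simp add: Pts_def r_def\<close>)
    then show "a \<in> Q T \<or> b \<in> Q T" by (simp add: pq Q)
  qed (rule cring_alg)
  define Qi where "Qi i = Q (set (drop i vs))" for i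
  have "Qi i \<subset> Qi (Suc i)" if "i < length vs" for i
  proof
    have vs: "drop i vs = vs ! i # drop (Suc i) vs" using that by (rule Cons_nth_drop_Suc[symmetric])
    let ?v = "vs ! i"
    have v: "?v \<in> set vs" "?v \<notin> set (drop (Suc i) vs)"
      using that dist vs distinct_drop[OF dist, of i] by auto
    show "Qi i \<subseteq> Qi (Suc i)" by (auto simp: Qi_def Q_def Pts_def vs)
    have "\<pi> (PVar ?v - PConst (c ?v)) \<in> Qi (Suc i)"
      using v by (auto simp: Qi_def Q Pts_def free)
    moreover have "\<pi> (PVar ?v - PConst (c ?v)) \<notin> Qi i"
    proof -
      \<comment> \<open>Strictness: the family before the freeze contains points that differ from
        \<open>c\<close> only in the coordinate \<open>?v\<close>. Along this line the denominator
        has finitely many zeros, so a nonzero displacement avoids them.\<close>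
      define l where "l u = (if u = ?v then [:c u, 1:] else [:c u:])" for u
      define W where "W = psubst (\<lambda>a. [:a:]) l w"
      have W: "poly W t = ev (c(?v := c ?v + t)) w" for t
        unfolding W_def poly_psubst
        by (rule arg_cong[where f = "\<lambda>x. ev x w"]) (auto simp: l_def)
      have "poly W 0 \<noteq> 0" using w by (simp add: W)
      then have "W \<noteq> 0" by auto
      then have "finite {t. poly W t = 0}" by (rule poly_roots_finite)
      then have "finite (insert 0 {t. poly W t = 0})" by simp
      then obtain t where t: "t \<notin> insert 0 {t. poly W t = 0}"
        using ex_new_if_finite[OF infinite_UNIV_char_0] by blast
      let ?s = "c(?v := c ?v + t)"
      have "?s \<in> Pts (set (drop i vs))" using t by (auto simp: Pts_def vs W)
      moreover have "ev (r ?s) (PVar ?v - PConst (c ?v)) \<noteq> 0"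
        using t free[of ?s ?v] v by (simp add: W)
      ultimately show ?thesis unfolding Qi_def Q by blast
    qed
    ultimately show "Qi i \<noteq> Qi (Suc i)" by auto
  qed
  moreover have "Qi (length vs) = point_ideal A \<phi>"
  proof -
    have "Pts {} = {c}" by (auto simp: Pts_def w)
    then have *: "\<pi> p \<in> Qi (length vs) \<longleftrightarrow> \<pi> p \<in> point_ideal A \<phi>" for p
      using point_ideal_iff[OF phi, of p] by (simp add: Qi_def Q rc c)
    have "Qi (length vs) \<subseteq> range \<pi>" "point_ideal A \<phi> \<subseteq> range \<pi>"
      using Q_sub carrier_eq by (auto simp: Qi_def point_ideal_def)
    with * show ?thesis by blast
  qed
  ultimately show ?thesis using prime by (intro exI[of _ Qi]) (auto simp: Qi_def)
qed

end

section \<open>Upper bounds for heights: growth of products along a prime chain\<close>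

fun mono_list :: "(nat \<Rightarrow> 'v cpoly) \<Rightarrow> nat list \<Rightarrow> 'v cpoly" where
  "mono_list y [] = 1"
| "mono_list y (k # m) = y 0 ^ k * mono_list (\<lambda>i. y (Suc i)) m"

text \<open>Elements \<open>y i\<close> of the successive differences of a chain of prime ideals are algebraically
  independent modulo the smallest prime: cancel the lowest power of \<open>y 0\<close> from a relation and
  reduce modulo the next prime.\<close>

lemma prime_chain_independent:
  fixes P :: "nat \<Rightarrow> 'v cpoly set"
  assumes "\<And>i. i \<le> n \<Longrightarrow> primeideal (P i) poly_alg"
    and "\<And>i. i < n \<Longrightarrow> P i \<subseteq> P (Suc i) \<and> y i \<in> P (Suc i) \<and> y i \<notin> P i"
    and "finite M" "\<And>m. m \<in> M \<Longrightarrow> length m = n"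
    and "(\<Sum>m\<in>M. PConst (a m) * mono_list y m) \<in> P 0"
    and "m \<in> M"
  shows "a m = 0"
  using assms
proof (induction n arbitrary: P y M a m)
  case 0
  interpret primeideal "P 0" poly_alg using "0.prems"(1) by simp
  have M: "M = {[]}" using "0.prems"(4,6) by auto
  have "a [] = 0"
  proof (rule ccontr)
    assume "a [] \<noteq> 0"
    have "PConst (a []) \<in> P 0" using "0.prems"(5) by (simp add: M)
    from I_l_closed[OF this, of "PConst (1 / a [])"] \<open>a [] \<noteq> 0\<close> have "1 \<in> P 0"
      by (simp add: PConst_simps flip: PConst_simps(6))
    then show False using one_imp_carrier I_notcarr by simp
  qed
  then show ?case using M "0.prems"(6) by simp
next
  case (Suc n)
  interpret P0: primeideal "P 0" poly_alg using Suc.prems(1) by simp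
  interpret P1: primeideal "P 1" poly_alg using Suc.prems(1)[of 1] by simp
  have P1: "p \<in> P 1 \<Longrightarrow> q \<in> P 1 \<Longrightarrow> p + q \<in> P 1" "p \<in> P 1 \<Longrightarrow> q * p \<in> P 1" "0 \<in> P 1" for p q
    using P1.a_closed[of p q] P1.I_l_closed[of p q] P1.zero_closed by simp_all
  have y0: "y 0 \<in> P 1" "y 0 \<notin> P 0" and sub: "P 0 \<subseteq> P 1" using Suc.prems(2)[of 0] by simp_all
  have y0_pow: "y 0 ^ k \<notin> P 0" for k
    using y0(2) P0.one_imp_carrier P0.I_notcarr P0.I_prime by (induction k) auto
  show ?case
  proof (rule ccontr)
    assume "a m \<noteq> 0"
    define M' where "M' = {m \<in> M. a m \<noteq> 0}"
    define k where "k = Min (hd ` M')"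
    have M': "finite M'" "M' \<noteq> {}" using Suc.prems(3,6) \<open>a m \<noteq> 0\<close> by (auto simp: M'_def)
    have k_le: "k \<le> hd m" if "m \<in> M'" for m
      using M' that by (simp add: k_def)
    have "k \<in> hd ` M'" unfolding k_def using M' by (intro Min_in) auto
    then obtain m\<^sub>0 where m0: "m\<^sub>0 \<in> M'" "hd m\<^sub>0 = k" by auto
    have Cons: "m = hd m # tl m" "length (tl m) = n" if "m \<in> M'" for m
      using Suc.prems(4)[of m] that by (cases m; simp add: M'_def)+
    let ?y = "\<lambda>i. y (Suc i)"
    have ml: "mono_list y m = y 0 ^ hd m * mono_list ?y (tl m)" if "m \<in> M'" for m
      using arg_cong[OF Cons(1)[OF that], of "mono_list y"] by simp
    let ?R = "\<Sum>m\<in>M'. PConst (a m) * (y 0 ^ (hd m - k) * mono_list ?y (tl m))"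
    have "(\<Sum>m\<in>M. PConst (a m) * mono_list y m) = (\<Sum>m\<in>M'. PConst (a m) * mono_list y m)"
      by (rule sum.mono_neutral_right) (auto simp: M'_def PConst_simps Suc.prems(3))
    also have "\<dots> = y 0 ^ k * ?R"
      unfolding sum_distrib_left
    proof (rule sum.cong)
      fix m assume m: "m \<in> M'"
      then have "y 0 ^ hd m = y 0 ^ k * y 0 ^ (hd m - k)"
        using k_le by (simp flip: power_add)
      then show "PConst (a m) * mono_list y m
          = y 0 ^ k * (PConst (a m) * (y 0 ^ (hd m - k) * mono_list ?y (tl m)))"
        using m by (simp add: ml mult_ac)
    qed simp
    \<comment> \<open>No power of \<open>y 0\<close> lies in the prime \<open>P 0\<close>, so the
      common factor \<open>y 0 ^ k\<close> can be cancelled.\<close>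
    finally have "?R \<in> P 0"
      using Suc.prems(5) P0.I_prime[of "y 0 ^ k" ?R] y0_pow by simp
    then have R1: "?R \<in> P 1" using sub by auto
    let ?M0 = "{m \<in> M'. hd m = k}"
    have split: "?R = (\<Sum>m\<in>?M0. PConst (a m) * (y 0 ^ (hd m - k) * mono_list ?y (tl m)))
        + (\<Sum>m\<in>M' - ?M0. PConst (a m) * (y 0 ^ (hd m - k) * mono_list ?y (tl m)))"
      by (subst add.commute, rule sum.subset_diff) (auto simp: M')
    \<comment> \<open>Terms whose first exponent exceeds \<open>k\<close> still contain
      \<open>y 0\<close>, an element of \<open>P 1\<close>. Modulo \<open>P 1\<close> only the terms
      with exponent exactly \<open>k\<close> survive, and these involve the later elements
      alone.\<close>
    have tail: "(\<Sum>m\<in>M' - ?M0. PConst (a m) * (y 0 ^ (hd m - k) * mono_list ?y (tl m))) \<in> P 1"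
    proof -
      have summand: "PConst (a m) * (y 0 ^ (hd m - k) * mono_list ?y (tl m)) \<in> P 1" if "m \<in> M' - ?M0" for m
      proof -
        have "m \<in> M'" "hd m \<noteq> k" using that by simp_all
        with k_le[of m] have "hd m - k \<noteq> 0" by simp
        then obtain j where "hd m - k = Suc j" using not0_implies_Suc by blast
        then have "PConst (a m) * (y 0 ^ (hd m - k) * mono_list ?y (tl m))
            = (PConst (a m) * y 0 ^ j * mono_list ?y (tl m)) * y 0"
          by (simp add: mult_ac)
        then show ?thesis using P1(2)[OF y0(1)] by simp
      qed
      have "sum g N \<in> P 1" if "\<And>i. i \<in> N \<Longrightarrow> g i \<in> P 1" for g :: "nat list \<Rightarrow> 'v cpoly" and N
        using that
      proof (induction N rule: infinite_finite_induct)
        case (insert i N)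
        have "g i \<in> P 1" "sum g N \<in> P 1" using insert.prems insert.IH by blast+
        then show ?case using P1(1) by (simp only: sum.insert[OF insert.hyps])
      qed (simp_all only: sum.infinite sum.empty P1(3) not_False_eq_True)
      from this[OF summand] show ?thesis .
    qed
    have P1_cancel: "p \<in> P 1" if "p + q \<in> P 1" "q \<in> P 1" for p q
      using P1(1)[OF that(1) P1(2)[OF that(2), of "-1"]] by simp
    have "(\<Sum>m\<in>?M0. PConst (a m) * (y 0 ^ (hd m - k) * mono_list ?y (tl m))) \<in> P 1"
      by (rule P1_cancel[OF _ tail]) (rule R1[unfolded split])
    also have "(\<Sum>m\<in>?M0. PConst (a m) * (y 0 ^ (hd m - k) * mono_list ?y (tl m)))
        = (\<Sum>m\<in>?M0. PConst (a (k # tl m)) * mono_list ?y (tl m))"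
      using Cons(1) by (intro sum.cong) auto
    also have "\<dots> = (\<Sum>m\<in>tl ` ?M0. PConst (a (k # m)) * mono_list ?y m)"
    proof (subst sum.reindex)
      show "inj_on tl ?M0" using Cons(1) by (metis (mono_tags, lifting) inj_onI mem_Collect_eq)
    qed simp
    finally have rel: "(\<Sum>m\<in>tl ` ?M0. PConst (a (k # m)) * mono_list ?y m) \<in> P (Suc 0)" by simp
    have "a (k # tl m\<^sub>0) = 0"
    proof (rule Suc.IH[of "\<lambda>i. P (Suc i)" ?y "tl ` ?M0" "\<lambda>m. a (k # m)"])
      show "(\<Sum>m\<in>tl ` ?M0. PConst (a (k # m)) * mono_list ?y m) \<in> P (Suc 0)" by (rule rel)
      show "i \<le> n \<Longrightarrow> primeideal (P (Suc i)) poly_alg" for i using Suc.prems(1) by simp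
      show "i < n \<Longrightarrow> P (Suc i) \<subseteq> P (Suc (Suc i)) \<and> y (Suc i) \<in> P (Suc (Suc i)) \<and> y (Suc i) \<notin> P (Suc i)" for i
        using Suc.prems(2)[of "Suc i"] by simp
    qed (use M' m0 Cons in auto)
    then show False using Cons(1)[OF m0(1)] m0 by (simp add: M'_def)
  qed
qed

interpretation cpoly: vector_space "\<lambda>c (p :: 'v cpoly). PConst c * p"
  by standard (simp_all add: PConst_simps algebra_simps)

lemma polynomial_growth_degree_le:
  fixes n d K D :: nat
  assumes "\<And>k. (k + 1) ^ n \<le> K * (D * k + 1) ^ d"
  shows "n \<le> d"
proof (rule ccontr)
  assume "\<not> n \<le> d"
  \<comment> \<open>With this k the right-hand side is at most K (D + 1)^d (k + 1)^d = k (k + 1)^d,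
    just below (k + 1)^(d + 1).\<close>
  define k where "k = K * (D + 1) ^ d"
  have "(k + 1) ^ d * (k + 1) \<le> (k + 1) ^ n"
    using \<open>\<not> n \<le> d\<close> power_increasing[of "Suc d" n "k + 1"] by (simp add: mult.commute)
  also have "\<dots> \<le> K * (D * k + 1) ^ d" by (rule assms)
  also have "\<dots> \<le> K * ((D + 1) * (k + 1)) ^ d"
    by (intro mult_left_mono power_mono) auto
  also have "\<dots> = (k + 1) ^ d * k" by (simp only: k_def power_mult_distrib mult_ac)
  finally show False by simp
qed

text \<open>Pulled back to polynomials from the quotient by \<open>S\<close>, where it is the image
  of the span of \<open>B N\<close>. With a constant family it is simply a span modulo the ideal, as
  in \<open>toric_span\<close>.\<close>

definition filtration :: "'v cpoly set \<Rightarrow> (nat \<Rightarrow> 'v cpoly set) \<Rightarrow> nat \<Rightarrow> 'v cpoly set" where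
  "filtration S B N = {p. \<exists>q\<in>cpoly.span (B N). p - q \<in> pideal S}"

lemma filtration_pideal: "p \<in> pideal S \<Longrightarrow> p \<in> filtration S B N"
  unfolding filtration_def using cpoly.span_zero by (intro CollectI bexI[of _ 0]) auto

lemma filtration_base: "b \<in> B N \<Longrightarrow> b \<in> filtration S B N"
  unfolding filtration_def using cpoly.span_base by (intro CollectI bexI[of _ b]) auto

lemma filtration_add:
  assumes "p \<in> filtration S B N" "q \<in> filtration S B N" shows "p + q \<in> filtration S B N"
proof -
  from assms obtain p' q' where "p' \<in> cpoly.span (B N)" "q' \<in> cpoly.span (B N)"
    "p - p' \<in> pideal S" "q - q' \<in> pideal S" by (auto simp: filtration_def)
  moreover have "p + q - (p' + q') = (p - p') + (q - q')" by simp
  ultimately show ?thesis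
    unfolding filtration_def using cpoly.span_add pideal_add by (metis (mono_tags, lifting) mem_Collect_eq)
qed

lemma filtration_scale:
  assumes "p \<in> filtration S B N" shows "PConst a * p \<in> filtration S B N"
proof -
  from assms obtain p' where "p' \<in> cpoly.span (B N)" "p - p' \<in> pideal S" by (auto simp: filtration_def)
  then show ?thesis
    unfolding filtration_def using cpoly.span_scale pideal_mult[of "p - p'" S "PConst a"]
    by (intro CollectI bexI[of _ "PConst a * p'"]) (auto simp: right_diff_distrib)
qed

lemma filtration_diff:
  assumes "p \<in> filtration S B N" "q \<in> filtration S B N" shows "p - q \<in> filtration S B N"
  using filtration_add[OF assms(1) filtration_scale[OF assms(2), of "-1"]] by (simp add: PConst_simps)

lemma filtration_cong: "p - q \<in> pideal S \<Longrightarrow> q \<in> filtration S B N \<Longrightarrow> p \<in> filtration S B N"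
  using filtration_add[OF filtration_pideal, of "p - q" S q B N] by simp

text \<open>By linearity multiplication is tested on the spanning set only. Source and target
  families may differ, which allows the passage from \<open>U\<close> to
  \<open>normal_monos\<close>.\<close>

lemma filtration_mult:
  assumes "p \<in> filtration S B N" "\<And>b. b \<in> B N \<Longrightarrow> r * b \<in> filtration S B' M"
  shows "r * p \<in> filtration S B' M"
proof -
  from assms(1) obtain q where q: "q \<in> cpoly.span (B N)" "p - q \<in> pideal S" by (auto simp: filtration_def)
  have "r * q \<in> filtration S B' M"
    using q(1)
  proof (induction rule: cpoly.span_induct_alt)
    case base
    show ?case by (simp add: filtration_pideal)
  next
    case (step c x y)
    have "r * (PConst c * x + y) = PConst c * (r * x) + r * y" by (simp add: algebra_simps)
    then show ?case
      using filtration_add[OF filtration_scale[OF assms(2)[OF step(1)]] step(2)] by simp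
  qed
  moreover have "r * p - r * q \<in> pideal S"
    using pideal_mult[OF q(2), of r] by (simp add: right_diff_distrib)
  ultimately show ?thesis by (rule filtration_cong[rotated])
qed

context
  fixes S :: "'v cpoly set" and B :: "nat \<Rightarrow> 'v cpoly set"
  assumes one: "1 \<in> filtration S B 0"
    and mono: "\<And>N. B N \<subseteq> B (Suc N)"
    and step: "\<And>v N b. b \<in> B N \<Longrightarrow> PVar v * b \<in> filtration S B (Suc N)"
begin

lemma filtration_mono: "N \<le> M \<Longrightarrow> filtration S B N \<subseteq> filtration S B M"
  using cpoly.span_mono[OF lift_Suc_mono_le[of B N M, OF mono]] by (auto simp: filtration_def)

text \<open>Each variable raises the index by at most one, so a fixed polynomial raises it by a
  bounded amount. The amounts add up under products; for sums their sum is a common bound.\<close>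

lemma filtration_multiplier:
  obtains D where "\<And>N q. q \<in> filtration S B N \<Longrightarrow> p * q \<in> filtration S B (D + N)"
proof -
  have "\<exists>D. \<forall>N. \<forall>q\<in>filtration S B N. p * q \<in> filtration S B (D + N)"
  proof (induction p rule: cpoly_induct)
    case (const c)
    show ?case by (rule exI[of _ 0]) (simp add: filtration_scale)
  next
    case (var v)
    show ?case by (rule exI[of _ 1]) (auto intro: filtration_mult step)
  next
    case (add p q)
    then obtain D E where *: "\<forall>N. \<forall>r\<in>filtration S B N. p * r \<in> filtration S B (D + N)"
      "\<forall>N. \<forall>r\<in>filtration S B N. q * r \<in> filtration S B (E + N)" by blast
    have "(p + q) * r \<in> filtration S B (D + E + N)" if "r \<in> filtration S B N" for r N
      using *(1)[rule_format, OF that] *(2)[rule_format, OF that]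
        filtration_mono[of "D + N" "D + E + N"] filtration_mono[of "E + N" "D + E + N"]
      unfolding distrib_right by (intro filtration_add) auto
    then show ?case by blast
  next
    case (mult p q)
    then obtain D E where "\<forall>N. \<forall>r\<in>filtration S B N. p * r \<in> filtration S B (D + N)"
      "\<forall>N. \<forall>r\<in>filtration S B N. q * r \<in> filtration S B (E + N)" by blast
    then show ?case by (intro exI[of _ "D + E"]) (auto simp: mult.assoc add.assoc)
  qed
  then show ?thesis using that by blast
qed

lemma mono_list_filtration:
  assumes "\<And>i N q. i < length m \<Longrightarrow> q \<in> filtration S B N \<Longrightarrow> y i * q \<in> filtration S B (D + N)"
  shows "mono_list y m \<in> filtration S B (D * sum_list m)"
  using assms
proof (induction m arbitrary: y)
  case Nil
  show ?case using one by simp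
next
  case (Cons k m)
  have "y 0 ^ k * q \<in> filtration S B (D * k + N)" if "q \<in> filtration S B N" for q N
    using Cons.prems[of 0] that
    by (induction k) (auto simp: mult.assoc add.assoc)
  moreover have "mono_list (\<lambda>i. y (Suc i)) m \<in> filtration S B (D * sum_list m)"
    using Cons.prems by (intro Cons.IH) auto
  ultimately show ?case by (simp add: distrib_left)
qed

lemma prime_chain_length_le:
  fixes P :: "nat \<Rightarrow> 'v cpoly set"
  assumes prime: "\<And>i. i \<le> n \<Longrightarrow> primeideal (P i) poly_alg"
    and strict: "\<And>i. i < n \<Longrightarrow> P i \<subset> P (Suc i)"
    and S: "pideal S \<subseteq> P 0"
    and fin: "\<And>N. finite (B N)" and card: "\<And>N. card (B N) \<le> K * (N + 1) ^ d"
  shows "n \<le> d"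
proof -
  obtain y where y: "\<And>i. i < n \<Longrightarrow> y i \<in> P (Suc i) \<and> y i \<notin> P i"
  proof -
    have "\<forall>i. \<exists>y. i < n \<longrightarrow> y \<in> P (Suc i) \<and> y \<notin> P i" using strict by blast
    from choice[OF this] show ?thesis using that by blast
  qed
  \<comment> \<open>One shift \<open>D\<close> that works for all of the finitely many
    \<open>y i\<close>.\<close>
  have "\<exists>D. \<forall>i<l. \<forall>N. \<forall>q\<in>filtration S B N. y i * q \<in> filtration S B (D + N)" for l
  proof (induction l)
    case (Suc l)
    then obtain D where D: "\<forall>i<l. \<forall>N. \<forall>q\<in>filtration S B N. y i * q \<in> filtration S B (D + N)" by blast
    obtain E where E: "\<And>N q. q \<in> filtration S B N \<Longrightarrow> y l * q \<in> filtration S B (E + N)"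
      using filtration_multiplier[of "y l"] by blast
    have "y i * q \<in> filtration S B (D + E + N)" if "i < Suc l" "q \<in> filtration S B N" for i N q
      using that D E[OF that(2)] filtration_mono[of "D + N" "D + E + N"] filtration_mono[of "E + N" "D + E + N"]
      by (cases "i = l") auto
    then show ?case by blast
  qed simp
  from this[of n] obtain D
    where D: "\<And>i N q. i < n \<Longrightarrow> q \<in> filtration S B N \<Longrightarrow> y i * q \<in> filtration S B (D + N)"
    by blast
  have "(k + 1) ^ n \<le> K * (D * n * k + 1) ^ d" for k
  proof -
    define M where "M = {m :: nat list. set m \<subseteq> {..k} \<and> length m = n}"
    have M: "finite M" "card M = (k + 1) ^ n"
      using finite_lists_length_eq[of "{..k}" n] card_lists_length_eq[of "{..k}" n] by (auto simp: M_def)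
    have ind: "\<forall>m\<in>M. a m = 0" if "(\<Sum>m\<in>M. PConst (a m) * mono_list y m) \<in> P 0" for a
    proof
      fix m assume "m \<in> M"
      show "a m = 0"
        by (rule prime_chain_independent[of n P y M a, OF prime _ M(1) _ that \<open>m \<in> M\<close>])
          (use strict y in \<open>auto simp: M_def\<close>)
    qed
    let ?N = "D * n * k"
    have "\<exists>q\<in>cpoly.span (B ?N). mono_list y m - q \<in> pideal S" if "m \<in> M" for m
    proof -
      have "sum_list m \<le> n * k"
        using that sum_list_mono[of m "\<lambda>x. x" "\<lambda>_. k"] by (auto simp: M_def sum_list_triv)
      then have "D * sum_list m \<le> ?N" by (simp add: mult.assoc)
      moreover have "mono_list y m \<in> filtration S B (D * sum_list m)"
        using that by (intro mono_list_filtration D) (auto simp: M_def)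
      ultimately have "mono_list y m \<in> filtration S B ?N" using filtration_mono by blast
      then show ?thesis by (simp add: filtration_def)
    qed
    then obtain b where b: "\<And>m. m \<in> M \<Longrightarrow> b m \<in> cpoly.span (B ?N) \<and> mono_list y m - b m \<in> pideal S"
      by metis
    \<comment> \<open>The replacements \<open>b m\<close> differ from the products by elements of
      \<open>pideal S\<close>, which lies in \<open>P 0\<close>. Thus a relation between them is one
      between the products modulo \<open>P 0\<close>, and independence is inherited.\<close>
    have b_ind: "\<forall>m\<in>M. a m = 0" if "(\<Sum>m\<in>M. PConst (a m) * b m) = 0" for a
    proof (rule ind)
      have "(\<Sum>m\<in>M. PConst (a m) * mono_list y m) - (\<Sum>m\<in>M. PConst (a m) * b m)
          = (\<Sum>m\<in>M. PConst (a m) * (mono_list y m - b m))"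
        by (simp add: sum_subtractf right_diff_distrib)
      also have "\<dots> \<in> pideal S" using b by (intro pideal_sum pideal_mult) auto
      finally show "(\<Sum>m\<in>M. PConst (a m) * mono_list y m) \<in> P 0" using that S by auto
    qed
    have inj: "inj_on b M"
    proof (rule inj_onI, rule ccontr)
      fix m m' assume m: "m \<in> M" "m' \<in> M" "b m = b m'" "m \<noteq> m'"
      let ?a = "\<lambda>l. if l = m then 1 else if l = m' then -1 else 0 :: complex"
      have "(\<Sum>l\<in>M. PConst (?a l) * b l) = (\<Sum>l\<in>{m, m'}. PConst (?a l) * b l)"
        using m M by (intro sum.mono_neutral_right) (auto simp: PConst_simps)
      also have "\<dots> = 0" using m by (simp add: PConst_simps)
      finally have "\<forall>l\<in>M. ?a l = 0" by (rule b_ind)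
      from bspec[OF this m(1)] have "?a m = 0" .
      then show False by simp
    qed
    have "cpoly.independent (b ` M)"
      unfolding cpoly.dependent_finite[OF finite_imageI[OF M(1)]]
    proof safe
      fix u m assume "(\<Sum>v\<in>b ` M. PConst (u v) * v) = 0" "m \<in> M" "u (b m) \<noteq> 0"
      then show False using b_ind[of "\<lambda>m. u (b m)"] by (simp add: sum.reindex[OF inj])
    qed
    moreover have "b ` M \<subseteq> cpoly.span (B ?N)" using b by auto
    ultimately have "card (b ` M) \<le> card (B ?N)"
      using cpoly.independent_span_bound[OF fin] by blast
    then show ?thesis using card[of ?N] M(2) by (simp add: card_image[OF inj])
  qed
  then show ?thesis by (rule polynomial_growth_degree_le)
qed

end

context presented
begin

lemma primeideal_preimage:
  assumes "primeideal I A"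
  shows "primeideal {p. \<pi> p \<in> I} poly_alg"
proof (rule primeidealI)
  interpret I: primeideal I A by fact
  show "ideal {p. \<pi> p \<in> I} poly_alg" by (rule ideal_preimage[OF I.is_ideal])
  have "\<pi> 1 \<notin> I" using I.one_imp_carrier I.I_notcarr by (auto simp: pi_one)
  then show "carrier poly_alg \<noteq> {p. \<pi> p \<in> I}" by auto
  show "a \<otimes>\<^bsub>poly_alg\<^esub> b \<in> {p. \<pi> p \<in> I} \<Longrightarrow> a \<in> {p. \<pi> p \<in> I} \<or> b \<in> {p. \<pi> p \<in> I}" for a b
    using I.I_prime[of "\<pi> a" "\<pi> b"] by (simp add: pi_mult)
qed (rule cring_poly_alg)

lemma prime_chain_le:
  assumes "1 \<in> filtration S B 0" "\<And>N. B N \<subseteq> B (Suc N)"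
    and "\<And>v N b. b \<in> B N \<Longrightarrow> PVar v * b \<in> filtration S B (Suc N)"
    and "\<And>N. finite (B N)" "\<And>N. card (B N) \<le> K * (N + 1) ^ d"
    and prime: "\<forall>i\<le>n. primeideal (Q i) A" and strict: "\<forall>i<n. Q i \<subset> Q (Suc i)"
  shows "n \<le> d"
proof (rule prime_chain_length_le[where S = S and B = B and K = K and P = "\<lambda>i. {p. \<pi> p \<in> Q i}"])
  show "PVar v * b \<in> filtration S B (Suc N)" if "b \<in> B N" for v N b
    using that by (rule assms(3))
  show "primeideal {p. \<pi> p \<in> Q i} poly_alg" if "i \<le> n" for i
    using prime that by (intro primeideal_preimage) auto
  show "{p. \<pi> p \<in> Q i} \<subset> {p. \<pi> p \<in> Q (Suc i)}" if "i < n" for i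
  proof -
    interpret I: primeideal "Q (Suc i)" A using prime that by simp
    have sub: "Q i \<subset> Q (Suc i)" using strict that by simp
    then obtain a where a: "a \<in> Q (Suc i)" "a \<notin> Q i" by blast
    then obtain p where "a = \<pi> p" using I.a_subset by (blast elim: carrierE)
    with a have "p \<in> {p. \<pi> p \<in> Q (Suc i)}" "p \<notin> {p. \<pi> p \<in> Q i}" by simp_all
    moreover have "{p. \<pi> p \<in> Q i} \<subseteq> {p. \<pi> p \<in> Q (Suc i)}" using sub by auto
    ultimately show ?thesis by blast
  qed
  have "ideal (Q 0) A" using prime primeideal.axioms(1) by blast
  then show "pideal S \<subseteq> {p. \<pi> p \<in> Q 0}"
    using additive_subgroup.zero_closed[OF ideal.axioms(1)] by (auto simp flip: ker)
qed (rule assms)+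

end

lemma ideal_height_le:
  assumes "\<forall>n Q. (\<forall>i\<le>n. primeideal (Q i) A) \<longrightarrow> (\<forall>i<n. Q i \<subset> Q (Suc i)) \<longrightarrow> n \<le> d"
  shows "ideal_height A P \<le> enat d"
  unfolding ideal_height_def by (rule Sup_least) (use assms in auto)

lemma ideal_height_ge:
  assumes "\<exists>Q. (\<forall>i\<le>d. primeideal (Q i) A) \<and> (\<forall>i<d. Q i \<subset> Q (Suc i)) \<and> Q d = P"
  shows "enat d \<le> ideal_height A P"
  unfolding ideal_height_def by (rule Sup_upper) (use assms in auto)

section \<open>The cubic family\<close>

lemma forall_3_cases: "P (1::3) \<Longrightarrow> P 2 \<Longrightarrow> P 3 \<Longrightarrow> P k"
  using exhaust_3[of k] by auto

definition cubic_partial :: "'a \<Rightarrow> (3 \<Rightarrow> 'a) \<Rightarrow> 3 \<Rightarrow> 'a::comm_ring_1" where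
  "cubic_partial a x k = (if k = 1 then x 2 * x 3 - 1 else if k = 2 then x 1 * x 3 - a else x 1 * x 2 - 1)"

text \<open>The first-order expansion in one coordinate is exact, and the coefficient does not
  involve that coordinate. Hence the equation can be solved for it wherever the coefficient is
  nonzero.\<close>

lemma cubic_update: "cubic a (x(k := z)) = cubic a x + cubic_partial a x k * (z - x k)"
  by (rule forall_3_cases[of _ k]) (simp_all add: cubic_def cubic_partial_def algebra_simps)

lemma cubic_update_param: "cubic b x = cubic a x + (1 - x 2) * (b - a)"
  by (simp add: cubic_def algebra_simps)

lemma ev_cubic_partial [simp]:
  "ev s (cubic_partial a x k) = cubic_partial (ev s a) (\<lambda>i. ev s (x i)) k"
  by (simp add: cubic_partial_def)

lemma sum_3_UNIV: "(\<Sum>k\<in>UNIV. f k) = f 1 + f 2 + f (3::3)"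
  by (rule sum_3)

lemma dirderiv_cubic:
  "dirderiv c w (cubic a x) = (1 - ev c (x 2)) * dirderiv c w a
    + (\<Sum>k\<in>UNIV. cubic_partial (ev c a) (\<lambda>i. ev c (x i)) k * dirderiv c w (x k))"
  by (simp add: sum_3_UNIV cubic_def cubic_partial_def algebra_simps)

text \<open>The critical equations give x_1 = x_3, a x_2 = x_3 and a = x_3^2, and with these the
  cubic collapses to (x_3 - 1)^2.\<close>

lemma cubic_critical_point:
  fixes x :: "3 \<Rightarrow> complex"
  assumes "cubic a x = 0" "\<And>k. cubic_partial a x k = 0"
  shows "a = 1 \<and> x = (\<lambda>_. 1)"
proof -
  have 1: "x 2 * x 3 = 1" "x 1 * x 3 = a" "x 1 * x 2 = 1"
    using assms(2)[of 1] assms(2)[of 2] assms(2)[of 3] by (simp_all add: cubic_partial_def)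
  have "x 1 = (x 1 * x 2) * x 3" using 1(1) by (simp add: mult.assoc)
  then have 2: "x 1 = x 3" by (simp only: 1(3) mult_1)
  have "a * x 2 = x 1 * (x 2 * x 3)" by (simp add: mult_ac flip: 1(2))
  then have 3: "a * x 2 = x 3" by (simp only: 1(1) 2 mult_1_right)
  have "x 1 * x 2 * x 3 - x 1 - a * x 2 - x 3 + a + 1 = (x 3 - 1)\<^sup>2"
    unfolding 1(3) 3 2 1(2)[symmetric] by (simp add: power2_eq_square algebra_simps)
  then have x3: "x 3 = 1" using assms(1) by (simp add: cubic_def)
  then have "x 1 = 1" "x 2 = 1" "a = 1" using 1 2 by simp_all
  with x3 have "x 1 = 1" "x 2 = 1" "x 3 = 1" "a = 1" by simp_all
  then have "x k = 1" for k using forall_3_cases[of "\<lambda>k. x k = 1"] by blast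
  with \<open>a = 1\<close> show ?thesis by auto
qed

text \<open>Normal monomials are those not divisible by \<open>x 1 * x 2 * x 3\<close>, the leading term of the cubic;
  \<open>U\<close> supplies the monomials in the remaining variables.\<close>

definition normal_monos :: "(3 \<Rightarrow> 'v cpoly) \<Rightarrow> (nat \<Rightarrow> 'v cpoly set) \<Rightarrow> nat \<Rightarrow> 'v cpoly set" where
  "normal_monos x U N = {u * (x 1 ^ i * x 2 ^ j * x 3 ^ k) | u l i j k.
     u \<in> U l \<and> l + i + j + k \<le> N \<and> (i = 0 \<or> j = 0 \<or> k = 0)}"

lemma normal_monosI:
  "u \<in> U l \<Longrightarrow> l + i + j + k \<le> N \<Longrightarrow> i = 0 \<or> j = 0 \<or> k = 0 \<Longrightarrow>
    u * (x 1 ^ i * x 2 ^ j * x 3 ^ k) \<in> normal_monos x U N"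
  unfolding normal_monos_def by blast

lemma normal_monosE:
  assumes "b \<in> normal_monos x U N"
  obtains u l i j k where "b = u * (x 1 ^ i * x 2 ^ j * x 3 ^ k)" "u \<in> U l"
    "l + i + j + k \<le> N" "i = 0 \<or> j = 0 \<or> k = 0"
proof -
  from assms have "\<exists>u l i j k. b = u * (x 1 ^ i * x 2 ^ j * x 3 ^ k) \<and>
     u \<in> U l \<and> l + i + j + k \<le> N \<and> (i = 0 \<or> j = 0 \<or> k = 0)"
    unfolding normal_monos_def by (rule CollectD)
  then show ?thesis by (elim exE conjE) (rule that)
qed

context
  fixes S :: "'v cpoly set" and a :: "'v cpoly" and x :: "3 \<Rightarrow> 'v cpoly" and U :: "nat \<Rightarrow> 'v cpoly set"
  assumes cubic: "cubic a x \<in> pideal S"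
    and U_step: "\<forall>l. \<forall>u\<in>U l. a * u \<in> filtration S U (Suc l)"
begin

text \<open>The cubic rewrites x_1 x_2 x_3 as x_1 + a x_2 + x_3 - a - 1. The total exponent drops by
  at least two, which pays for the single step in \<open>U\<close> that multiplication by
  \<open>a\<close> costs.\<close>

lemma normal_monos_spanning:
  "u \<in> U l \<Longrightarrow> l + i + j + k \<le> N \<Longrightarrow>
    u * (x 1 ^ i * x 2 ^ j * x 3 ^ k) \<in> filtration S (normal_monos x U) N"
proof (induction "i + j + k" arbitrary: u l i j k rule: less_induct)
  case less
  show ?case
  proof (cases "i = 0 \<or> j = 0 \<or> k = 0")
    case True
    with less.prems show ?thesis
      by (intro filtration_base normal_monosI)
  next
    case False
    then obtain i' j' k' where ijk: "i = Suc i'" "j = Suc j'" "k = Suc k'"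
      using not0_implies_Suc[of i] not0_implies_Suc[of j] not0_implies_Suc[of k] by auto
    let ?F = "filtration S (normal_monos x U) N"
    let ?x = "\<lambda>i j k. x 1 ^ i * x 2 ^ j * x 3 ^ k"
    have F: "w * ?x p q r \<in> ?F" if "w \<in> U m" "p + q + r < i + j + k" "m + p + q + r \<le> N" for w m p q r
      by (rule less.hyps[OF that(2,1,3)])
    have aF: "a * u * ?x p q r \<in> ?F" if pqr: "p + q + r < i + j + k" "Suc l + p + q + r \<le> N" for p q r
    proof -
      have "?x p q r * (a * u) \<in> ?F"
      proof (rule filtration_mult[OF U_step[rule_format, OF less.prems(1)]])
        fix b assume "b \<in> U (Suc l)"
        from F[OF this pqr] show "?x p q r * b \<in> ?F" by (simp only: mult.commute)
      qed
      then show ?thesis by (simp only: mult.commute)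
    qed
    have mem: "u * ?x (Suc i') j' k' + a * u * ?x i' (Suc j') k' + u * ?x i' j' (Suc k')
        - a * u * ?x i' j' k' - u * ?x i' j' k' \<in> ?F"
      by (intro filtration_add filtration_diff F[OF less.prems(1)] aF)
        (use less.prems(2) in \<open>simp_all add: ijk\<close>)
    have eq: "u * ?x i j k - (u * ?x (Suc i') j' k' + a * u * ?x i' (Suc j') k' + u * ?x i' j' (Suc k')
        - a * u * ?x i' j' k' - u * ?x i' j' k') = u * ?x i' j' k' * cubic a x"
      by (simp add: cubic_def ijk algebra_simps)
    show ?thesis
      by (rule filtration_cong[OF _ mem]) (simp only: eq pideal_mult[OF cubic])
  qed
qed

end

text \<open>Normal monomials have two free exponents and so contribute growth of degree 2; the
  remaining variables act within \<open>U\<close>, which grows with degree \<open>d\<close>.\<close>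

lemma (in presented) cubic_prime_chain_le:
  fixes x :: "3 \<Rightarrow> 'v cpoly"
  assumes cubic: "cubic a x \<in> pideal S"
    and a_step: "\<forall>l. \<forall>u\<in>U l. a * u \<in> filtration S U (Suc l)"
    and vars: "\<And>v. (\<exists>k. PVar v = x k) \<or> (\<forall>l. \<forall>u\<in>U l. PVar v * u \<in> filtration S U (Suc l))"
    and one: "1 \<in> U 0" and mono: "\<And>N. U N \<subseteq> U (Suc N)"
    and fin: "\<And>N. finite (U N)" and card: "\<And>N. card (U N) \<le> K * (N + 1) ^ d"
    and prime: "\<forall>i\<le>n. primeideal (Q i) A" and strict: "\<forall>i<n. Q i \<subset> Q (Suc i)"
  shows "n \<le> d + 2"
proof (rule prime_chain_le[where B = "normal_monos x U" and K = "3 * K"])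
  note spanning = normal_monos_spanning[OF cubic a_step]
  show "1 \<in> filtration S (normal_monos x U) 0"
    using spanning[of 1 0 0 0 0 0] one by simp
  show "normal_monos x U N \<subseteq> normal_monos x U (Suc N)" for N
    by (auto elim!: normal_monosE intro!: normal_monosI)
  show "PVar v * b \<in> filtration S (normal_monos x U) (Suc N)" if "b \<in> normal_monos x U N" for v b N
  proof -
    from that obtain u l i j k where b: "b = u * (x 1 ^ i * x 2 ^ j * x 3 ^ k)" and u: "u \<in> U l"
      and le: "l + i + j + k \<le> N" by (rule normal_monosE)
    from vars[of v] show ?thesis
    proof (elim disjE exE)
      fix m assume v: "PVar v = x m"
      have "x 1 * b \<in> filtration S (normal_monos x U) (Suc N)"
        using spanning[OF u, of "Suc i" j k "Suc N"] le by (simp add: b mult_ac)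
      moreover have "x 2 * b \<in> filtration S (normal_monos x U) (Suc N)"
        using spanning[OF u, of i "Suc j" k "Suc N"] le by (simp add: b mult_ac)
      moreover have "x 3 * b \<in> filtration S (normal_monos x U) (Suc N)"
        using spanning[OF u, of i j "Suc k" "Suc N"] le by (simp add: b mult_ac)
      ultimately show ?thesis unfolding v by (rule forall_3_cases)
    next
      assume "\<forall>l. \<forall>u\<in>U l. PVar v * u \<in> filtration S U (Suc l)"
      then have "PVar v * u \<in> filtration S U (Suc l)" using u by blast
      then have "(x 1 ^ i * x 2 ^ j * x 3 ^ k) * (PVar v * u) \<in> filtration S (normal_monos x U) (Suc N)"
      proof (rule filtration_mult)
        fix w assume "w \<in> U (Suc l)"
        then show "(x 1 ^ i * x 2 ^ j * x 3 ^ k) * w \<in> filtration S (normal_monos x U) (Suc N)"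
          using spanning[of w "Suc l" i j k "Suc N"] le by (simp add: mult.commute)
      qed
      then show ?thesis by (simp add: b mult_ac)
    qed
  qed
  have U_mono: "l \<le> N \<Longrightarrow> U l \<subseteq> U N" for l N
    using lift_Suc_mono_le[of U l N] mono by blast
  \<comment> \<open>Three faces of a cube of exponents, of (N + 1)^2 elements each; hence the factor
    3.\<close>
  define I where "I N = {0::nat} \<times> {..N} \<times> {..N} \<union> {..N} \<times> {0} \<times> {..N} \<union> {..N} \<times> {..N} \<times> {0::nat}" for N :: nat
  have I: "finite (I N)" for N by (simp add: I_def)
  have card_I: "card (I N) \<le> 3 * (N + 1) ^ 2" for N
  proof -
    have "card (I N) \<le> card ({0::nat} \<times> {..N} \<times> {..N}) + card ({..N} \<times> {0::nat} \<times> {..N})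
        + card ({..N} \<times> {..N} \<times> {0::nat})"
      unfolding I_def by (intro order_trans[OF card_Un_le] add_mono card_Un_le order_refl)
    then show ?thesis by (simp add: card_cartesian_product power2_eq_square)
  qed
  have sub: "normal_monos x U N \<subseteq> (\<lambda>(u, i, j, k). u * (x 1 ^ i * x 2 ^ j * x 3 ^ k)) ` (U N \<times> I N)" for N
  proof
    fix b assume "b \<in> normal_monos x U N"
    then obtain u l i j k where b: "b = u * (x 1 ^ i * x 2 ^ j * x 3 ^ k)" and u: "u \<in> U l"
      and le: "l + i + j + k \<le> N" and z: "i = 0 \<or> j = 0 \<or> k = 0"
      by (rule normal_monosE)
    have "u \<in> U N" using u U_mono[of l N] le by auto
    moreover have "(i, j, k) \<in> I N" using le z by (auto simp: I_def)
    ultimately show "b \<in> (\<lambda>(u, i, j, k). u * (x 1 ^ i * x 2 ^ j * x 3 ^ k)) ` (U N \<times> I N)"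
      by (intro image_eqI[where x = "(u, i, j, k)"]) (simp_all add: b)
  qed
  show "finite (normal_monos x U N)" for N
    by (rule finite_subset[OF sub]) (simp add: fin I)
  show "card (normal_monos x U N) \<le> 3 * K * (N + 1) ^ (d + 2)" for N
  proof -
    have "card (normal_monos x U N) \<le> card (U N \<times> I N)"
      by (rule order_trans[OF card_mono[OF _ sub] card_image_le]) (simp_all add: fin I)
    also have "\<dots> \<le> (K * (N + 1) ^ d) * (3 * (N + 1) ^ 2)"
      unfolding card_cartesian_product by (rule mult_mono[OF card card_I]) auto
    finally show ?thesis by (simp only: power_add mult_ac)
  qed
qed (fact prime, fact strict)

lemma fibre_prime_chain_le:
  assumes "presented A {fibre_cubic a} \<pi>"
    and "\<forall>i\<le>n. primeideal (Q i) A" "\<forall>i<n. Q i \<subset> Q (Suc i)"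
  shows "n \<le> 2"
proof -
  interpret presented A "{fibre_cubic a}" \<pi> by fact
  let ?U = "\<lambda>_ :: nat. {1 :: 3 cpoly}"
  have "n \<le> 0 + 2"
  proof (rule cubic_prime_chain_le[where a = "PConst a" and x = PVar and U = ?U and K = 1])
    show "cubic (PConst a) PVar \<in> pideal {fibre_cubic a}"
      by (rule pideal_self) (simp add: fibre_cubic_def)
    show "\<forall>l. \<forall>u\<in>?U l. PConst a * u \<in> filtration {fibre_cubic a} ?U (Suc l)"
      by (intro allI ballI filtration_scale filtration_base) auto
  qed (use assms in auto)
  then show ?thesis by simp
qed

lemma family_relations_pideal:
  "PAlpha * PAlphaInv - 1 \<in> pideal family_relations" "cubic PAlpha PCoord \<in> pideal family_relations"
  by (rule pideal_self, simp add: family_relations_def)+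

lemma family_prime_chain_le:
  assumes "presented A family_relations \<pi>"
    and "\<forall>i\<le>n. primeideal (Q i) A" "\<forall>i<n. Q i \<subset> Q (Suc i)"
  shows "n \<le> 3"
proof -
  interpret presented A family_relations \<pi> by fact
  \<comment> \<open>Laurent monomials in \<alpha>: mixed products reduce by the unit relation. There
    are at most 2 (N + 1) of them, which gives K = 2 and d = 1.\<close>
  let ?U = "\<lambda>N. (\<lambda>e. PAlpha ^ e :: 3 avar cpoly) ` {..N} \<union> (\<lambda>e. PAlphaInv ^ e) ` {..N}"
  let ?S = "family_relations"
  note rel = family_relations_pideal
  have step: "p * u \<in> filtration ?S ?U (Suc l)"
    if pq: "(p, q) \<in> {(PAlpha, PAlphaInv), (PAlphaInv, PAlpha)}" and u: "u \<in> ?U l" for p q u :: "3 avar cpoly" and l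
  proof -
    have pow: "p ^ e \<in> ?U m" "q ^ e \<in> ?U m" if "e \<le> m" for e m
      using that pq by auto
    from u obtain e where e: "e \<le> l" "u = p ^ e \<or> u = q ^ e" using pq by auto
    show ?thesis
    proof (cases "u = p ^ e \<or> e = 0")
      case True
      then have "p * u = p ^ Suc e" using e by auto
      then show ?thesis using pow(1)[of "Suc e" "Suc l"] e by (auto intro!: filtration_base)
    next
      case False
      then obtain e' where e': "e = Suc e'" by (cases e) auto
      have "p * q - 1 \<in> pideal ?S" using pq rel(1) by (auto simp: mult.commute)
      moreover have "p * u - q ^ e' = q ^ e' * (p * q - 1)"
        using False e e' by (simp add: algebra_simps)
      ultimately have "p * u - q ^ e' \<in> pideal ?S" by (simp add: pideal_mult)
      moreover have "q ^ e' \<in> ?U (Suc l)" using e e' by (intro pow) simp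
      ultimately show ?thesis by (intro filtration_cong[OF _ filtration_base])
    qed
  qed
  have "n \<le> 1 + 2"
  proof (rule cubic_prime_chain_le[where a = PAlpha and x = PCoord and U = ?U and K = 2])
    show "(\<exists>k. PVar v = PCoord k) \<or> (\<forall>l. \<forall>u\<in>?U l. PVar v * u \<in> filtration ?S ?U (Suc l))" for v :: "3 avar"
    proof (cases v)
      case Alpha
      then show ?thesis using step[of PAlpha PAlphaInv] by simp
    next
      case AlphaInv
      then show ?thesis using step[of PAlphaInv PAlpha] by simp
    qed blast
    show "\<forall>l. \<forall>u\<in>?U l. PAlpha * u \<in> filtration ?S ?U (Suc l)"
      using step[of PAlpha PAlphaInv] by simp
    show "1 \<in> ?U 0" by simp
    show "?U N \<subseteq> ?U (Suc N)" for N by (intro Un_mono image_mono) auto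
    show "card (?U N) \<le> 2 * (N + 1) ^ 1" for N
      using card_image_le[of "{..N}" "\<lambda>e. PAlpha ^ e :: 3 avar cpoly"]
        card_image_le[of "{..N}" "\<lambda>e. PAlphaInv ^ e :: 3 avar cpoly"]
      by (intro order_trans[OF card_Un_le]) auto
  qed (use assms rel in auto)
  then show ?thesis by simp
qed

lemma UNIV_avar: "UNIV = insert Alpha (insert AlphaInv (range Coord))"
proof -
  have "v \<in> insert Alpha (insert AlphaInv (range Coord))" for v :: "'v avar"
    by (cases v) simp_all
  then show ?thesis by blast
qed

lemma finite_UNIV_3avar: "finite (UNIV :: 3 avar set)"
  unfolding UNIV_avar by simp

lemma card_UNIV_3avar: "card (UNIV :: 3 avar set) = 5"
proof -
  have "card (range (Coord :: 3 \<Rightarrow> 3 avar)) = 3"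
    by (simp add: card_image inj_on_def)
  moreover have "(AlphaInv :: 3 avar) \<notin> range Coord" "(Alpha :: 3 avar) \<notin> range Coord"
    by (simp_all add: image_iff)
  ultimately show ?thesis unfolding UNIV_avar by (simp add: card_insert_if)
qed

section \<open>Singular points of the fibres and of the total space\<close>

context presented
begin

lemma regular_pointI:
  assumes "has_cotangent_dimension A (point_ideal A \<phi>) d"
    and "\<exists>Q. (\<forall>i\<le>d. primeideal (Q i) A) \<and> (\<forall>i<d. Q i \<subset> Q (Suc i)) \<and> Q d = point_ideal A \<phi>"
    and "\<forall>n Q. (\<forall>i\<le>n. primeideal (Q i) A) \<longrightarrow> (\<forall>i<n. Q i \<subset> Q (Suc i)) \<longrightarrow> n \<le> d"
  shows "regular_point A \<phi>"
  unfolding regular_point_def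
  using assms(1) ideal_height_ge[OF assms(2)] ideal_height_le[OF assms(3)] by (meson antisym)

lemma not_regular_pointI:
  assumes "\<phi> \<in> cpoints A" "has_cotangent_dimension A (point_ideal A \<phi>) e" "d < e"
    and "\<forall>n Q. (\<forall>i\<le>n. primeideal (Q i) A) \<longrightarrow> (\<forall>i<n. Q i \<subset> Q (Suc i)) \<longrightarrow> n \<le> d"
  shows "\<not> regular_point A \<phi>"
proof
  assume "regular_point A \<phi>"
  then obtain d' where d': "has_cotangent_dimension A (point_ideal A \<phi>) d'"
    and h: "ideal_height A (point_ideal A \<phi>) = enat d'"
    unfolding regular_point_def by blast
  have "d' = e" by (rule cotangent_dimension_unique[OF assms(1) d' assms(2)])
  with h ideal_height_le[OF assms(4)] have "enat e \<le> enat d" by metis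
  with assms(3) show False by simp
qed

end

text \<open>A nonzero partial derivative eliminates one variable from the cotangent space and lets
  the cubic be solved for it, so dimension and height are both 2. If all partials vanish, the
  relation has no linear part and the dimension is 3, above the bound for heights.\<close>

lemma fibre_singular_points:
  assumes "presented A {fibre_cubic a} \<pi>"
  shows "singular_points A = {\<phi> \<in> cpoints A. \<forall>k. cubic_partial a (\<lambda>i. \<phi> (\<pi> (PVar i))) k = 0}"
proof -
  interpret presented A "{fibre_cubic a}" \<pi> by fact
  have "regular_point A \<phi> \<longleftrightarrow> (\<exists>k. cubic_partial a (\<lambda>i. \<phi> (\<pi> (PVar i))) k \<noteq> 0)"
    if phi: "\<phi> \<in> cpoints A" for \<phi>
  proof -
    define c where "c = (\<lambda>i. \<phi> (\<pi> (PVar i)))"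
    have phi_c: "\<phi> (\<pi> (PVar v)) = c v" for v by (simp add: c_def)
    have "ev c (fibre_cubic a) = 0"
      using cpoint_relations[OF phi pideal_self] by (simp add: c_def)
    then have cubic_c: "cubic a c = 0" by (simp add: fibre_cubic_def)
    let ?g = "fibre_cubic a"
    let ?P = "cubic_partial a c"
    have g: "?g \<in> pideal {?g}" by (simp add: pideal_self)
    have dg: "dirderiv c w ?g = (\<Sum>k\<in>UNIV. ?P k * w k)" for w
      by (simp add: fibre_cubic_def dirderiv_cubic)
    have dg_unit: "dirderiv c (unit_vec v) ?g = ?P v" for v
      by (simp add: dg if_distrib[of "\<lambda>t. _ * t"] cong: if_cong)
    have bound: "\<forall>n Q. (\<forall>i\<le>n. primeideal (Q i) A) \<longrightarrow> (\<forall>i<n. Q i \<subset> Q (Suc i)) \<longrightarrow> n \<le> 2"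
      using fibre_prime_chain_le[OF assms] by blast
    show ?thesis
    proof (cases "\<exists>k. ?P k \<noteq> 0")
      case True
      then obtain k where k: "?P k \<noteq> 0" by blast
      obtain vs where vs: "set vs = UNIV - {k}" "distinct vs"
        using finite_distinct_list[of "UNIV - {k}"] by auto
      have len: "length vs = 2" using distinct_card[OF vs(2)] by (simp add: vs(1))
      have "has_cotangent_dimension A (point_ideal A \<phi>) (length vs)"
      proof (rule has_cotangent_dimension_jacobian[OF _ phi phi_c vs(2)])
        fix u assume "u \<notin> set vs"
        then have "u = k" by (simp add: vs(1))
        moreover have "PConst (1 / ?P k) * ?g \<in> pideal {?g}" by (rule pideal_mult[OF g])
        ultimately show "\<exists>r\<in>pideal {?g}. dirderiv c (unit_vec u) r = 1
            \<and> (\<forall>w. w \<notin> set vs \<longrightarrow> w \<noteq> u \<longrightarrow> dirderiv c (unit_vec w) r = 0)"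
          using k by (intro bexI[of _ "PConst (1 / ?P k) * ?g"]) (simp_all add: vs(1) dg_unit)
      next
        fix v assume v: "v \<in> set vs"
        \<comment> \<open>The dual vector of \<open>v\<close>; its \<open>k\<close>-entry is forced
          by tangency to the cubic.\<close>
        let ?w = "\<lambda>u. if u = k then - ?P v / ?P k else unit_vec v u"
        have "(\<Sum>u\<in>UNIV. ?P u * ?w u) = ?P k * ?w k + (\<Sum>u\<in>UNIV - {k}. ?P u * ?w u)"
          by (rule sum.remove) auto
        also have "(\<Sum>u\<in>UNIV - {k}. ?P u * ?w u) = (\<Sum>u\<in>UNIV - {k}. if u = v then ?P v else 0)"
          by (rule sum.cong) auto
        also have "\<dots> = ?P v" using v by (simp add: vs(1))
        finally have "dirderiv c ?w ?g = 0" using k by (simp add: dg)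
        then show "\<exists>w. (\<forall>s\<in>{?g}. dirderiv c w s = 0) \<and> (\<forall>v'\<in>set vs. w v' = unit_vec v v')"
          by (intro exI[of _ ?w]) (auto simp: vs(1))
      qed simp
      moreover have "\<exists>Q. (\<forall>i\<le>length vs. primeideal (Q i) A) \<and> (\<forall>i<length vs. Q i \<subset> Q (Suc i))
          \<and> Q (length vs) = point_ideal A \<phi>"
      proof (rule chain_exists[OF phi phi_c vs(2)])
        \<comment> \<open>The parametrisation replaces x_k by x_k - g / (partial of g), the root of
          the equation that is linear in x_k; the partial is the common denominator. The point
          \<open>c\<close> is fixed because g vanishes there.\<close>
        let ?w = "cubic_partial (PConst a) PVar k"
        let ?f = "\<lambda>v. if v = k then ?w * PVar k - ?g else ?w * PVar v"
        have r: "(\<lambda>v. ev s (?f v) / ev s ?w) = s(k := s k - cubic a s / cubic_partial a s k)"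
          if "ev s ?w \<noteq> 0" for s
          using that by (auto simp: fun_eq_iff fibre_cubic_def field_simps)
        show "ev (\<lambda>v. ev s (?f v) / ev s ?w) q = 0" if s: "ev s ?w \<noteq> 0" and "q \<in> {?g}" for s q
        proof -
          have "ev (s(k := z)) ?g = cubic a s + cubic_partial a s k * (z - s k)" for z
            by (simp only: fibre_cubic_def ev_cubic ev_simps cubic_update)
          with that show ?thesis unfolding r[OF s] by simp
        qed
        show "ev s (?f v) / ev s ?w = s v" if "ev s ?w \<noteq> 0" "v \<in> set vs" for s v
          using that by (simp add: vs(1))
        show w: "ev c ?w \<noteq> 0" using k by simp
        show "(\<lambda>v. ev c (?f v) / ev c ?w) = c"
          unfolding r[OF w] by (simp add: cubic_c)
      qed
      ultimately have "regular_point A \<phi>"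
        unfolding len using bound by (rule regular_pointI)
      then show ?thesis using True by (simp add: c_def)
    next
      case False
      have "has_cotangent_dimension A (point_ideal A \<phi>) (length [1, 2, 3 :: 3])"
      proof (rule has_cotangent_dimension_jacobian[OF _ phi phi_c])
        show "\<exists>w. (\<forall>s\<in>{?g}. dirderiv c w s = 0) \<and> (\<forall>v'\<in>set [1, 2, 3]. w v' = unit_vec v v')" for v
          using False by (intro exI[of _ "unit_vec v"]) (simp add: dg_unit)
      qed (use exhaust_3 in auto)
      then have "\<not> regular_point A \<phi>"
        by (rule not_regular_pointI[OF phi _ _ bound]) simp_all
      then show ?thesis using False by (simp add: c_def)
    qed
  qed
  then show ?thesis by (auto simp: singular_points_def)
qed

lemma fibre_singular_points_empty:
  assumes "presented A {fibre_cubic a} \<pi>" "a \<noteq> 1"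
  shows "singular_points A = {}"
proof -
  interpret presented A "{fibre_cubic a}" \<pi> by fact
  have "cubic a (\<lambda>i. \<phi> (\<pi> (PVar i))) = 0" if "\<phi> \<in> cpoints A" for \<phi>
    using cpoint_relations[OF that pideal_self, of "fibre_cubic a"] by (simp add: fibre_cubic_def)
  then show ?thesis
    using cubic_critical_point assms(2) unfolding fibre_singular_points[OF assms(1)] by blast
qed

lemma fibre_singular_point:
  assumes "presented A {fibre_cubic 1} \<pi>"
  obtains \<phi> where "singular_points A = {\<phi>}" "\<And>i. \<phi> (\<pi> (PVar i)) = 1"
proof -
  interpret presented A "{fibre_cubic 1}" \<pi> by fact
  let ?\<phi> = "point (\<lambda>_. 1)"
  have 1: "ev (\<lambda>_. 1) s = 0" if "s \<in> {fibre_cubic 1}" for s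
    using that by (simp add: fibre_cubic_def cubic_def)
  have phi: "?\<phi> \<in> cpoints A" "?\<phi> (\<pi> (PVar i)) = 1" for i
    using point_cpoint[OF 1] point_eval[OF 1] by simp_all
  have "\<phi> = ?\<phi>" if "\<phi> \<in> singular_points A" for \<phi>
  proof -
    from that have *: "\<phi> \<in> cpoints A" "\<And>k. cubic_partial 1 (\<lambda>i. \<phi> (\<pi> (PVar i))) k = 0"
      by (auto simp: fibre_singular_points[OF assms])
    have "cubic 1 (\<lambda>i. \<phi> (\<pi> (PVar i))) = 0"
      using cpoint_relations[OF *(1) pideal_self, of "fibre_cubic 1"] by (simp add: fibre_cubic_def)
    from cubic_critical_point[OF this *(2)] have "(\<lambda>i. \<phi> (\<pi> (PVar i))) = (\<lambda>_. 1)" by simp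
    then have "\<phi> (\<pi> (PVar i)) = 1" for i by metis
    then show ?thesis using phi by (intro cpoint_eqI[OF *(1)]) auto
  qed
  moreover have "?\<phi> \<in> singular_points A"
    using phi by (simp add: fibre_singular_points[OF assms] cubic_partial_def)
  ultimately have "singular_points A = {?\<phi>}" by blast
  then show ?thesis using phi(2) that by blast
qed

text \<open>The gradient of the cubic alone. The relation between \<alpha> and its inverse accounts
  for \<open>AlphaInv\<close> separately: it always eliminates this variable.\<close>

definition family_partial :: "'a \<Rightarrow> (3 \<Rightarrow> 'a) \<Rightarrow> 3 avar \<Rightarrow> 'a::comm_ring_1" where
  "family_partial a x v = (case v of Alpha \<Rightarrow> 1 - x 2 | AlphaInv \<Rightarrow> 0 | Coord k \<Rightarrow> cubic_partial a x k)"

lemma family_partial_simps [simp]: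
  "family_partial a x Alpha = 1 - x 2" "family_partial a x AlphaInv = 0"
  "family_partial a x (Coord k) = cubic_partial a x k"
  by (simp_all add: family_partial_def)

lemma ev_family_partial [simp]:
  "ev s (family_partial a x v) = family_partial (ev s a) (\<lambda>i. ev s (x i)) v"
  by (cases v) simp_all

lemma family_cubic_update:
  "v \<noteq> AlphaInv \<Longrightarrow> cubic ((s(v := z)) Alpha) (\<lambda>i. (s(v := z)) (Coord i))
    = cubic (s Alpha) (\<lambda>i. s (Coord i)) + family_partial (s Alpha) (\<lambda>i. s (Coord i)) v * (z - s v)"
proof (cases v)
  case Alpha
  then show ?thesis using cubic_update_param[of z "\<lambda>i. s (Coord i)" "s Alpha"] by simp
next
  case (Coord k)
  have "(\<lambda>i. (s(v := z)) (Coord i)) = (\<lambda>i. s (Coord i))(k := z)" by (auto simp: Coord)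
  then show ?thesis using cubic_update[of "s Alpha" "\<lambda>i. s (Coord i)" k z] by (simp add: Coord)
qed simp

text \<open>As for the fibres, with \<alpha> as a fourth coordinate. Eliminating
  \<open>AlphaInv\<close> and a pivot leaves dimension 3, the maximal height; at a critical point of
  the cubic only \<open>AlphaInv\<close> is eliminated and the dimension is 4.\<close>

lemma family_singular_points:
  assumes "presented A family_relations \<pi>"
  shows "singular_points A = {\<phi> \<in> cpoints A.
    \<forall>v. family_partial (\<phi> (\<pi> PAlpha)) (\<lambda>i. \<phi> (\<pi> (PCoord i))) v = 0}"
proof -
  interpret presented A family_relations \<pi> by fact
  have "regular_point A \<phi> \<longleftrightarrow> (\<exists>v. family_partial (\<phi> (\<pi> PAlpha)) (\<lambda>i. \<phi> (\<pi> (PCoord i))) v \<noteq> 0)"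
    if phi: "\<phi> \<in> cpoints A" for \<phi>
  proof -
    define c where "c = (\<lambda>v. \<phi> (\<pi> (PVar v)))"
    have phi_c: "\<phi> (\<pi> (PVar v)) = c v" for v by (simp add: c_def)
    let ?g = "cubic PAlpha PCoord :: 3 avar cpoly" and ?h = "PAlpha * PAlphaInv - 1 :: 3 avar cpoly"
    let ?P = "family_partial (c Alpha) (\<lambda>i. c (Coord i))"
    note gh = family_relations_pideal(2,1)
    have "ev c ?g = 0" "ev c ?h = 0"
      using cpoint_relations[OF phi gh(1)] cpoint_relations[OF phi gh(2)] by (simp_all only: phi_c)
    then have cubic_c: "cubic (c Alpha) (\<lambda>i. c (Coord i)) = 0" and inv_c: "c Alpha * c AlphaInv = 1"
      by simp_all
    then have c0: "c Alpha \<noteq> 0" by auto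
    have dg: "dirderiv c w ?g = ?P Alpha * w Alpha + (\<Sum>k\<in>UNIV. ?P (Coord k) * w (Coord k))" for w
      by (simp add: dirderiv_cubic)
    have dg_unit: "dirderiv c (unit_vec v) ?g = ?P v" for v
      by (cases v) (simp_all add: dg if_distrib[of "\<lambda>t. _ * t"] cong: if_cong)
    have dh: "dirderiv c w ?h = c Alpha * w AlphaInv + w Alpha * c AlphaInv" for w by simp
    have bound: "\<forall>n Q. (\<forall>i\<le>n. primeideal (Q i) A) \<longrightarrow> (\<forall>i<n. Q i \<subset> Q (Suc i)) \<longrightarrow> n \<le> 3"
      using family_prime_chain_le[OF assms] by blast
    show ?thesis
    proof (cases "\<exists>k. ?P k \<noteq> 0")
      case True
      then obtain k where k: "?P k \<noteq> 0" by blast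
      then have k_inv: "k \<noteq> AlphaInv" by auto
      obtain vs where vs: "set vs = UNIV - {k, AlphaInv}" "distinct vs"
        using finite_distinct_list[of "UNIV - {k, AlphaInv}"] finite_UNIV_3avar by auto
      have len: "length vs = 3"
        using distinct_card[OF vs(2)] k_inv finite_UNIV_3avar card_UNIV_3avar
        by (simp add: vs(1) card_Diff_subset)
      have "has_cotangent_dimension A (point_ideal A \<phi>) (length vs)"
      proof (rule has_cotangent_dimension_jacobian[OF finite_UNIV_3avar phi phi_c vs(2)])
        fix u assume "u \<notin> set vs"
        then consider "u = k" | "u = AlphaInv" by (auto simp: vs(1))
        then show "\<exists>r\<in>pideal family_relations. dirderiv c (unit_vec u) r = 1
            \<and> (\<forall>w. w \<notin> set vs \<longrightarrow> w \<noteq> u \<longrightarrow> dirderiv c (unit_vec w) r = 0)"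
        proof cases
          case 1
          have "dirderiv c (unit_vec v) (PConst (1 / ?P k) * ?g) = ?P v / ?P k" for v
            by (simp only: dirderiv_simps ev_simps dg_unit) simp
          then show ?thesis using 1 k pideal_mult[OF gh(1), of "PConst (1 / ?P k)"]
            by (intro bexI[of _ "PConst (1 / ?P k) * ?g"]) (auto simp: vs(1))
        next
          case 2
          \<comment> \<open>The unit relation also has a linear term in \<alpha>. When \<alpha> is
            the pivot, a multiple of the cubic removes it, so that the two relations are in reduced
            form.\<close>
          let ?q = "if k = Alpha then c AlphaInv / (c Alpha * ?P k) else 0"
          let ?r = "PConst (1 / c Alpha) * ?h - PConst ?q * ?g"
          have "?r \<in> pideal family_relations"
            by (intro pideal_diff pideal_mult gh)
          moreover have dr: "dirderiv c (unit_vec v) ?r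
              = (c Alpha * unit_vec v AlphaInv + unit_vec v Alpha * c AlphaInv) / c Alpha - ?q * ?P v" for v
            by (simp only: dirderiv_simps(1-6) dirderiv_simps(7)[of _ _ "PConst _"] ev_simps dg_unit dh) simp
          have "dirderiv c (unit_vec AlphaInv) ?r = 1" unfolding dr using c0 by simp
          moreover have "dirderiv c (unit_vec k) ?r = 0" unfolding dr using k_inv k c0 by (cases k) simp_all
          ultimately show ?thesis using 2 by (intro bexI[of _ ?r]) (auto simp: vs(1))
        qed
      next
        fix v assume v: "v \<in> set vs"
        then have v_ne: "v \<noteq> k" "v \<noteq> AlphaInv" by (simp_all add: vs(1))
        let ?w' = "\<lambda>u. if u = k then - ?P v / ?P k else unit_vec v u"
        \<comment> \<open>The \<open>AlphaInv\<close>-entry is then determined by differentiating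
          the unit relation.\<close>
        let ?w = "?w'(AlphaInv := - c AlphaInv / c Alpha * ?w' Alpha)"
        have "dirderiv c ?w ?g = ?P Alpha * ?w' Alpha + (\<Sum>j\<in>UNIV. ?P (Coord j) * ?w' (Coord j))"
          unfolding dg by simp
        also have "\<dots> = 0"
        proof (cases k)
          case Alpha
          then obtain j where j: "v = Coord j" using v_ne by (cases v) auto
          have "(\<Sum>i\<in>UNIV. ?P (Coord i) * ?w' (Coord i)) = (\<Sum>i\<in>UNIV. if i = j then ?P v else 0)"
            using Alpha j by (intro sum.cong) auto
          then show ?thesis using Alpha k by simp
        next
          case (Coord i)
          have "(\<Sum>j\<in>UNIV. ?P (Coord j) * ?w' (Coord j))
              = ?P (Coord i) * ?w' (Coord i) + (\<Sum>j\<in>UNIV - {i}. ?P (Coord j) * ?w' (Coord j))"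
            by (rule sum.remove) auto
          also have "(\<Sum>j\<in>UNIV - {i}. ?P (Coord j) * ?w' (Coord j))
              = (\<Sum>j\<in>UNIV - {i}. if Coord j = v then ?P v else 0)"
            using Coord by (intro sum.cong) auto
          also have "\<dots> = (if v = Alpha then 0 else ?P v)"
          proof (cases v)
            case (Coord j)
            then show ?thesis using v_ne \<open>k = Coord i\<close> by simp
          qed (use v_ne in auto)
          finally show ?thesis using k Coord v_ne by auto
        qed (use k_inv in simp)
        finally have "dirderiv c ?w ?g = 0" .
        moreover have "dirderiv c ?w ?h = 0" unfolding dh using c0 by simp
        ultimately have "\<forall>s\<in>family_relations. dirderiv c ?w s = 0"
          by (simp only: family_relations_def) blast
        then show "\<exists>w. (\<forall>s\<in>family_relations. dirderiv c w s = 0) \<and> (\<forall>v'\<in>set vs. w v' = unit_vec v v')"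
          by (intro exI[of _ ?w] conjI) (auto simp: vs(1))
      qed
      moreover have "\<exists>Q. (\<forall>i\<le>length vs. primeideal (Q i) A) \<and> (\<forall>i<length vs. Q i \<subset> Q (Suc i))
          \<and> Q (length vs) = point_ideal A \<phi>"
      proof (rule chain_exists[OF phi phi_c vs(2)])
        define p where "p = (family_partial PAlpha PCoord k :: 3 avar cpoly)"
        \<comment> \<open>The new value of \<alpha> is \<open>al / p\<close>, whether or not
          \<alpha> is the solved coordinate. The denominator \<open>p * al\<close> therefore ensures
          both that the cubic can be solved and that the new \<alpha> is invertible, with inverse
          \<open>p / al\<close>.\<close>
        define al where "al = (if k = Alpha then p * PAlpha - ?g else p * PAlpha)"
        let ?w = "p * al"
        let ?f = "\<lambda>v. if v = AlphaInv then p * p else if v = k then (p * PVar k - ?g) * al else ?w * PVar v"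
        let ?P = "\<lambda>s. family_partial (s Alpha) (\<lambda>i. s (Coord i)) k" and ?G = "\<lambda>s. cubic (s Alpha) (\<lambda>i. s (Coord i))"
        let ?s = "\<lambda>s. s(k := s k - ?G s / ?P s)"
        have p: "ev s p = ?P s" for s by (simp add: p_def)
        have al: "ev s al = (if k = Alpha then ?P s * s Alpha - ?G s else ?P s * s Alpha)" for s
          by (simp add: al_def p)
        have r: "(\<lambda>v. ev s (?f v) / ev s ?w) = (?s s)(AlphaInv := 1 / ?s s Alpha) \<and> ?s s Alpha \<noteq> 0"
          if s: "ev s ?w \<noteq> 0" for s
        proof -
          have ne: "?P s \<noteq> 0" "ev s al \<noteq> 0" using s by (simp_all add: p)
          have al': "?s s Alpha = ev s al / ?P s"
          proof -
            have field: "P * x / P = x" "(P * x - G) / P = x - G / P" if "P \<noteq> 0" for G P x :: complex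
              using that by (simp_all add: diff_divide_distrib)
            show ?thesis
            proof (cases "k = Alpha")
              case True
              have "?s s Alpha = ?s s k" by (simp only: True)
              also have "\<dots> = s k - ?G s / ?P s" by (rule fun_upd_same)
              also have "\<dots> = (?P s * s k - ?G s) / ?P s" by (rule field(2)[OF ne(1), symmetric])
              also have "?P s * s k - ?G s = ev s al" by (simp only: al True simp_thms if_True)
              finally show ?thesis .
            next
              case False
              have "?s s Alpha = s Alpha" using False by (intro fun_upd_other) simp
              moreover have "ev s al = ?P s * s Alpha" by (subst al) (rule if_not_P[OF False])
              ultimately show ?thesis by (simp only: field(1)[OF ne(1)])
            qed
          qed
          have "ev s (?f v) / ev s ?w = ((?s s)(AlphaInv := 1 / ?s s Alpha)) v" for v
          proof -
            consider "v = AlphaInv" | "v = k" | "v \<noteq> AlphaInv" "v \<noteq> k" by blast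
            then show ?thesis
            proof cases
              case 1
              then show ?thesis unfolding al' using ne by (simp add: p)
            next
              case 2
              then show ?thesis using ne k_inv by (simp add: p diff_divide_distrib)
            next
              case 3
              then show ?thesis using ne by (simp add: p)
            qed
          qed
          moreover have "?s s Alpha \<noteq> 0" unfolding al' using ne by simp
          ultimately show ?thesis by blast
        qed
        show "ev (\<lambda>v. ev s (?f v) / ev s ?w) q = 0" if s: "ev s ?w \<noteq> 0" and q: "q \<in> family_relations" for s q
        proof -
          have p0: "?P s \<noteq> 0" using s by (simp add: p)
          have "?G (?s s) = 0"
          proof -
            have "G + P * (x - G / P - x) = 0" if "P \<noteq> 0" for G P x :: complex
              using that by simp
            from this[OF p0] show ?thesis by (simp only: family_cubic_update[OF k_inv] fun_upd_same)
          qed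
          moreover have "(\<lambda>i. ((?s s)(AlphaInv := z)) (Coord i)) = (\<lambda>i. ?s s (Coord i))" for z
            by simp
          ultimately have "ev ((?s s)(AlphaInv := 1 / ?s s Alpha)) ?g = 0"
            by (simp only: ev_cubic ev_simps fun_upd_other avar.distinct not_False_eq_True)
          moreover have "ev ((?s s)(AlphaInv := 1 / ?s s Alpha)) ?h = 0"
            using r[OF s] by (simp only: ev_simps fun_upd_same fun_upd_other avar.distinct
              not_False_eq_True) simp
          ultimately show ?thesis
            using q r[OF s] by (simp only: family_relations_def) blast
        qed
        show "ev s (?f v) / ev s ?w = s v" if "ev s ?w \<noteq> 0" "v \<in> set vs" for s v
          using that by (simp add: vs(1))
        have "ev c al = ?P c * c Alpha" by (simp only: al cubic_c diff_0_right if_cancel)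
        then show w: "ev c ?w \<noteq> 0" using k c0 by (simp only: ev_simps p mult_eq_0_iff simp_thms)
        have "1 / c Alpha = c AlphaInv" using inv_c c0 by (simp add: field_simps)
        moreover have "?s c = c" by (simp add: cubic_c)
        ultimately show "(\<lambda>v. ev c (?f v) / ev c ?w) = c"
          using r[OF w] by (simp only: fun_upd_triv)
      qed
      ultimately have "regular_point A \<phi>"
        unfolding len using bound by (rule regular_pointI)
      then show ?thesis using True by (simp add: c_def)
    next
      case False
      let ?vs = "[Alpha, Coord 1, Coord 2, Coord 3] :: 3 avar list"
      have vs: "u \<in> set ?vs \<longleftrightarrow> u \<noteq> AlphaInv" for u
        using exhaust_3 by (cases u) auto
      have "has_cotangent_dimension A (point_ideal A \<phi>) (length ?vs)"
      proof (rule has_cotangent_dimension_jacobian[OF finite_UNIV_3avar phi phi_c])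
        fix u assume "u \<notin> set ?vs"
        then have u: "u = AlphaInv" using vs by blast
        have "PConst (1 / c Alpha) * ?h \<in> pideal family_relations" by (rule pideal_mult[OF gh(2)])
        moreover have "dirderiv c (unit_vec AlphaInv) (PConst (1 / c Alpha) * ?h) = 1"
          using c0 by simp
        ultimately show "\<exists>r\<in>pideal family_relations. dirderiv c (unit_vec u) r = 1
            \<and> (\<forall>w. w \<notin> set ?vs \<longrightarrow> w \<noteq> u \<longrightarrow> dirderiv c (unit_vec w) r = 0)"
          unfolding vs u by blast
      next
        fix v assume "v \<in> set ?vs"
        let ?w = "(unit_vec v)(AlphaInv := - c AlphaInv / c Alpha * unit_vec v Alpha)"
        have "?P u = 0" for u using False by blast
        then have "dirderiv c ?w ?g = 0"
          by (simp only: dg mult_zero_left sum.neutral_const add_0)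
        moreover have "dirderiv c ?w ?h = 0" unfolding dh using c0 by simp
        ultimately have "\<forall>s\<in>family_relations. dirderiv c ?w s = 0"
          by (simp only: family_relations_def) blast
        then show "\<exists>w. (\<forall>s\<in>family_relations. dirderiv c w s = 0) \<and> (\<forall>v'\<in>set ?vs. w v' = unit_vec v v')"
          unfolding vs by (intro exI[of _ ?w] conjI) auto
      qed simp
      then have "\<not> regular_point A \<phi>"
        by (rule not_regular_pointI[OF phi _ _ bound]) simp_all
      then show ?thesis using False by (simp add: c_def)
    qed
  qed
  then show ?thesis by (auto simp: singular_points_def)
qed

text \<open>The last clause identifies a point from the values of \<alpha> and the x_i alone; it is
  applied to the images of reducible data.\<close>

lemma family_singular_point:
  assumes "presented A family_relations \<pi>"
  obtains \<phi> where "singular_points A = {\<phi>}" "\<phi> (\<pi> PAlpha) = 1" "\<And>i. \<phi> (\<pi> (PCoord i)) = 1"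
    "\<And>\<psi>. \<psi> \<in> cpoints A \<Longrightarrow> \<psi> (\<pi> PAlpha) = 1 \<Longrightarrow> (\<And>i. \<psi> (\<pi> (PCoord i)) = 1) \<Longrightarrow> \<psi> = \<phi>"
proof -
  interpret presented A family_relations \<pi> by fact
  let ?\<phi> = "point (\<lambda>_. 1)"
  have 1: "ev (\<lambda>_. 1) s = 0" if "s \<in> family_relations" for s
    using that by (auto simp: family_relations_def cubic_def)
  have phi: "?\<phi> \<in> cpoints A" "?\<phi> (\<pi> (PVar i)) = 1" for i
    using point_cpoint[OF 1] point_eval[OF 1] by simp_all
  have uniq: "\<psi> = ?\<phi>"
    if psi: "\<psi> \<in> cpoints A" "\<psi> (\<pi> PAlpha) = 1" "\<And>i. \<psi> (\<pi> (PCoord i)) = 1" for \<psi>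
  proof (rule cpoint_eqI[OF psi(1) phi(1)])
    fix v
    from cpoint_relations[OF psi(1) family_relations_pideal(1)]
    have "\<psi> (\<pi> PAlphaInv) = 1" by (simp add: psi(2))
    then show "\<psi> (\<pi> (PVar v)) = ?\<phi> (\<pi> (PVar v))"
      using psi by (cases v) (simp_all add: phi(2))
  qed
  have "\<psi> = ?\<phi>" if "\<psi> \<in> singular_points A" for \<psi>
  proof -
    from that have *: "\<psi> \<in> cpoints A"
      "\<And>v. family_partial (\<psi> (\<pi> PAlpha)) (\<lambda>i. \<psi> (\<pi> (PCoord i))) v = 0"
      by (auto simp: family_singular_points[OF assms])
    from cpoint_relations[OF *(1) family_relations_pideal(2)]
    have "cubic (\<psi> (\<pi> PAlpha)) (\<lambda>i. \<psi> (\<pi> (PCoord i))) = 0" by simp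
    from cubic_critical_point[OF this] *(2)[of "Coord _"]
    have "\<psi> (\<pi> PAlpha) = 1 \<and> (\<lambda>i. \<psi> (\<pi> (PCoord i))) = (\<lambda>_. 1)" by simp
    then show ?thesis using uniq[OF *(1)] by metis
  qed
  moreover have "?\<phi> \<in> singular_points A"
  proof -
    have "family_partial 1 (\<lambda>_. 1) v = (0 :: complex)" for v by (cases v) (simp_all add: cubic_partial_def)
    then show ?thesis using phi by (simp add: family_singular_points[OF assms])
  qed
  ultimately have "singular_points A = {?\<phi>}" by blast
  then show ?thesis using phi(2) uniq that by blast
qed

section \<open>The monodromy relations\<close>

text \<open>Both sides of the matrix identity are compared through
  \<open>M\<^sub>3 M\<^sub>4 M\<^sub>5 M\<^sub>6 = (diag(\<alpha>, \<alpha>\<^sup>-\<^sup>1) M\<^sub>1 M\<^sub>2)\<^sup>-\<^sup>1\<close>; the entries of the left-hand side are the \<open>nij\<close>.\<close>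

definition n11 :: "'b \<Rightarrow> 'b \<Rightarrow> 'b \<Rightarrow> 'b \<Rightarrow> 'b::comm_ring_1" where "n11 b3 b4 b5 b6 = b4 * b5 + 1"
definition n12 :: "'b \<Rightarrow> 'b \<Rightarrow> 'b \<Rightarrow> 'b \<Rightarrow> 'b::comm_ring_1" where "n12 b3 b4 b5 b6 = b6 + b4 * (b5 * b6 + 1)"
definition n21 :: "'b \<Rightarrow> 'b \<Rightarrow> 'b \<Rightarrow> 'b \<Rightarrow> 'b::comm_ring_1" where "n21 b3 b4 b5 b6 = b3 + (b3 * b4 + 1) * b5"
definition n22 :: "'b \<Rightarrow> 'b \<Rightarrow> 'b \<Rightarrow> 'b \<Rightarrow> 'b::comm_ring_1" where "n22 b3 b4 b5 b6 = b3 * b6 + (b3 * b4 + 1) * (b5 * b6 + 1)"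

abbreviation "N11 \<equiv> n11 (PCoord B3) (PCoord B4) (PCoord B5) (PCoord B6)"
abbreviation "N12 \<equiv> n12 (PCoord B3) (PCoord B4) (PCoord B5) (PCoord B6)"
abbreviation "N21 \<equiv> n21 (PCoord B3) (PCoord B4) (PCoord B5) (PCoord B6)"
abbreviation "N22 \<equiv> n22 (PCoord B3) (PCoord B4) (PCoord B5) (PCoord B6)"

lemma mat2_mult:
  "(vector [vector [a, b], vector [c, d]] :: 'b^2^2) ** (vector [vector [a', b'], vector [c', d']] :: 'b^2^2)
    = (vector [vector [a * a' + b * c', a * b' + b * d'], vector [c * a' + d * c', c * b' + d * d']] :: 'b::comm_ring_1^2^2)"
  by (simp add: vec_eq_iff forall_2 matrix_matrix_mult_def UNIV_2)

lemma topological_monodromy_entries: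
  "topological_monodromy $ 1 $ 1 = PAlpha * (N11 + PCoord B2 * N21)"
  "topological_monodromy $ 1 $ 2 = PAlpha * (N12 + PCoord B2 * N22)"
  "topological_monodromy $ 2 $ 1 = PAlphaInv * (PCoord B1 * N11 + (PCoord B1 * PCoord B2 + 1) * N21)"
  "topological_monodromy $ 2 $ 2 = PAlphaInv * (PCoord B1 * N12 + (PCoord B1 * PCoord B2 + 1) * N22)"
  unfolding topological_monodromy_def lower_unip_def upper_unip_def mat2_mult
  by (simp_all add: n11_def n12_def n21_def n22_def algebra_simps)

lemma analytic_relations_eq:
  "analytic_relations = {PAlpha * PAlphaInv - 1,
     PAlpha * (N11 + PCoord B2 * N21) - 1, PAlpha * (N12 + PCoord B2 * N22),
     PAlphaInv * (PCoord B1 * N11 + (PCoord B1 * PCoord B2 + 1) * N21),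
     PAlphaInv * (PCoord B1 * N12 + (PCoord B1 * PCoord B2 + 1) * N22) - 1}"
proof -
  have "{f i j | i j. True} = {f 1 1, f 1 2, f 2 1, f 2 2}" for f :: "2 \<Rightarrow> 2 \<Rightarrow> bvar avar cpoly"
    using exhaust_2 by (auto, metis)
  then show ?thesis
    unfolding analytic_relations_def by (simp add: topological_monodromy_entries mat_def)
qed

abbreviation AI :: "bvar avar cpoly set" where "AI \<equiv> pideal analytic_relations"

lemma AI_alpha: "PAlpha * PAlphaInv - 1 \<in> AI"
  by (rule pideal_self) (simp add: analytic_relations_def)

lemma AI_entries:
  "PAlpha * (N11 + PCoord B2 * N21) - 1 \<in> AI" "PAlpha * (N12 + PCoord B2 * N22) \<in> AI"
  "PAlphaInv * (PCoord B1 * N11 + (PCoord B1 * PCoord B2 + 1) * N21) \<in> AI"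
  "PAlphaInv * (PCoord B1 * N12 + (PCoord B1 * PCoord B2 + 1) * N22) - 1 \<in> AI"
  by (rule pideal_self, simp add: analytic_relations_eq)+

text \<open>The inverse of diag(\<alpha>, \<alpha>^-1) M_1 M_2 has second column (-\<alpha> b_2,
  \<alpha>) and lower left entry -\<alpha>^-1 b_1. Comparison of entries yields this relation and
  the next two; each displayed identity certifies membership in the ideal.\<close>

lemma AI_N22: "N22 - PAlpha \<in> AI"
proof -
  have "N22 - PAlpha
    = PAlpha * (PAlphaInv * (PCoord B1 * N12 + (PCoord B1 * PCoord B2 + 1) * N22) - 1)
      - PCoord B1 * PAlphaInv * (PAlpha * (N12 + PCoord B2 * N22))
      - N22 * (PAlpha * PAlphaInv - 1)"
    by (simp add: algebra_simps)
  also have "\<dots> \<in> AI"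
    by (intro pideal_diff pideal_mult AI_entries AI_alpha)
  finally show ?thesis .
qed

lemma AI_B2: "PCoord B2 + PAlphaInv * N12 \<in> AI"
proof -
  have "PCoord B2 + PAlphaInv * N12
    = PAlphaInv * (PAlphaInv * (PAlpha * (N12 + PCoord B2 * N22))
      - (N12 + PCoord B2 * N22) * (PAlpha * PAlphaInv - 1) - PCoord B2 * (N22 - PAlpha))
      - PCoord B2 * (PAlpha * PAlphaInv - 1)"
    by (simp add: algebra_simps)
  also have "\<dots> \<in> AI"
    by (intro pideal_diff pideal_mult AI_entries AI_alpha AI_N22)
  finally show ?thesis .
qed

lemma AI_B1: "PCoord B1 + PAlpha * N21 \<in> AI"
proof -
  have "PCoord B1 + PAlpha * N21
    = PAlpha * (PAlpha * (PAlphaInv * (PCoord B1 * N11 + (PCoord B1 * PCoord B2 + 1) * N21))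
      - PCoord B1 * PAlphaInv * (PAlpha * (N11 + PCoord B2 * N21) - 1)
      - N21 * (PAlpha * PAlphaInv - 1)) - PCoord B1 * (PAlpha * PAlphaInv - 1)"
    by (simp add: algebra_simps)
  also have "\<dots> \<in> AI"
    by (intro pideal_diff pideal_mult AI_entries AI_alpha)
  finally show ?thesis .
qed

text \<open>Every choice of b_3, ..., b_6 for which the prescribed \<alpha> is nonzero extends to
  analytic data. The equations that remain after inserting \<alpha>, b_1 and b_2 follow from the
  determinant of M_3 M_4 M_5 M_6 being 1.\<close>

lemma analytic_point:
  fixes b :: "bvar \<Rightarrow> complex"
  defines "a \<equiv> n22 (b B3) (b B4) (b B5) (b B6)"
  assumes a: "a \<noteq> 0" and s: "s \<in> analytic_relations"
    and x: "x Alpha = a" "x AlphaInv = 1 / a"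
      "x (Coord B1) = - a * n21 (b B3) (b B4) (b B5) (b B6)"
      "x (Coord B2) = - n12 (b B3) (b B4) (b B5) (b B6) / a"
      "\<And>v. v \<in> {B3, B4, B5, B6} \<Longrightarrow> x (Coord v) = b v"
  shows "ev x s = 0"
proof -
  define p q r where "p = n11 (b B3) (b B4) (b B5) (b B6)"
    and "q = n12 (b B3) (b B4) (b B5) (b B6)" and "r = n21 (b B3) (b B4) (b B5) (b B6)"
  have ev_N: "ev x N11 = p" "ev x N12 = q" "ev x N21 = r" "ev x N22 = a"
    by (simp_all add: p_def q_def r_def a_def n11_def n12_def n21_def n22_def x(5))
  have det: "p * a - q * r = 1"
    by (simp add: p_def q_def r_def a_def n11_def n12_def n21_def n22_def algebra_simps)
  then have pa: "p * a = 1 + q * r" by (simp add: algebra_simps)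
  have "a * (p * r) = (p * a) * r" by simp
  then have pr: "a * (p * r) = r + q * (r * r)" unfolding pa by (simp add: algebra_simps)
  have x': "x (Coord B1) = - a * r" "x (Coord B2) = - q / a" using x(3,4) by (simp_all add: q_def r_def)
  have e: "a * (p + - q / a * r) - 1 = 0" "a * (q + - q / a * a) = 0"
    "1 / a * (- a * r * p + (- a * r * (- q / a) + 1) * r) = 0"
    "1 / a * (- a * r * q + (- a * r * (- q / a) + 1) * a) - 1 = 0"
    using a pa pr by (simp_all add: field_simps)
  show ?thesis
    using s a unfolding analytic_relations_eq
    by (elim insertE emptyE) (simp_all only: ev_simps ev_N x(1,2) x' e nonzero_mult_divide_mult_cancel_left, simp)
qed

section \<open>Weights and invariants\<close>

definition homogeneous :: "int \<Rightarrow> bvar avar cpoly \<Rightarrow> bool" where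
  "homogeneous w p \<longleftrightarrow> (\<forall>t. t \<noteq> 0 \<longrightarrow> torus_act t p = PConst (t powi w) * p)"

lemma torus_act_simps [simp]:
  "torus_act t (PConst c) = PConst c" "torus_act t 0 = 0" "torus_act t 1 = 1"
  "torus_act t (p + q) = torus_act t p + torus_act t q"
  "torus_act t (p - q) = torus_act t p - torus_act t q"
  "torus_act t (p * q) = torus_act t p * torus_act t q"
  by (simp_all add: torus_act_def)

lemma torus_act_sum: "torus_act t (sum f I) = (\<Sum>i\<in>I. torus_act t (f i))"
  by (simp add: torus_act_def PConst.psubst_sum)

lemma homogeneous_const: "homogeneous 0 (PConst c)"
  by (simp add: homogeneous_def PConst_simps)

lemma homogeneous_one: "homogeneous 0 1"
  using homogeneous_const[of 1] by (simp add: PConst_simps)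

lemma homogeneous_PVar: "homogeneous (weight v) (PVar v)"
  by (simp add: homogeneous_def torus_act_def)

lemma homogeneous_add: "homogeneous w p \<Longrightarrow> homogeneous w q \<Longrightarrow> homogeneous w (p + q)"
  by (simp add: homogeneous_def distrib_left)

lemma homogeneous_diff: "homogeneous w p \<Longrightarrow> homogeneous w q \<Longrightarrow> homogeneous w (p - q)"
  by (simp add: homogeneous_def right_diff_distrib)

lemma homogeneous_mult:
  "homogeneous w p \<Longrightarrow> homogeneous w' q \<Longrightarrow> w'' = w + w' \<Longrightarrow> homogeneous w'' (p * q)"
  by (simp add: homogeneous_def power_int_add PConst_simps mult_ac)

lemma homogeneous_power: "homogeneous w p \<Longrightarrow> homogeneous (int n * w) (p ^ n)"
  by (induction n) (auto simp: homogeneous_one algebra_simps intro: homogeneous_mult)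

lemma homogeneous_prod:
  "(\<And>v. v \<in> I \<Longrightarrow> homogeneous (w v) (f v)) \<Longrightarrow> homogeneous (\<Sum>v\<in>I. w v) (\<Prod>v\<in>I. f v)"
  by (induction I rule: infinite_finite_induct) (auto simp: homogeneous_one intro: homogeneous_mult)

lemma homogeneous_gens:
  "homogeneous 0 PAlpha" "homogeneous 0 PAlphaInv"
  "homogeneous (-1) (PCoord B1)" "homogeneous (-1) (PCoord B3)" "homogeneous (-1) (PCoord B5)"
  "homogeneous 1 (PCoord B2)" "homogeneous 1 (PCoord B4)" "homogeneous 1 (PCoord B6)"
  using homogeneous_PVar[of Alpha] homogeneous_PVar[of AlphaInv] 
    homogeneous_PVar[of "Coord B1"] homogeneous_PVar[of "Coord B2"] homogeneous_PVar[of "Coord B3"]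
    homogeneous_PVar[of "Coord B4"] homogeneous_PVar[of "Coord B5"] homogeneous_PVar[of "Coord B6"]
  by simp_all

lemma homogeneous_mult_zero:
  "homogeneous w p \<Longrightarrow> homogeneous (- w) q \<Longrightarrow> homogeneous 0 (p * q)"
  "homogeneous 0 p \<Longrightarrow> homogeneous w q \<Longrightarrow> homogeneous w (p * q)"
  "homogeneous w p \<Longrightarrow> homogeneous 0 q \<Longrightarrow> homogeneous w (p * q)"
  using homogeneous_mult[of w p "- w" q 0] homogeneous_mult[of 0 p w q w] homogeneous_mult[of w p 0 q w]
  by simp_all

lemma homogeneous_products:
  "homogeneous 0 (PCoord B4 * PCoord B5 + 1)" "homogeneous 0 (PCoord B5 * PCoord B6 + 1)"
  "homogeneous 0 (PCoord B3 * PCoord B4 + 1)" "homogeneous 0 (PCoord B1 * PCoord B2 + 1)"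
  "homogeneous 0 (PCoord B3 * PCoord B6)"
  using homogeneous_mult[OF homogeneous_gens(7,5), of 0] homogeneous_mult[OF homogeneous_gens(5,8), of 0]
    homogeneous_mult[OF homogeneous_gens(4,7), of 0] homogeneous_mult[OF homogeneous_gens(3,6), of 0]
    homogeneous_mult[OF homogeneous_gens(4,8), of 0]
  by (simp_all add: homogeneous_add homogeneous_one)

lemma homogeneous_N:
  "homogeneous 0 N11" "homogeneous 1 N12" "homogeneous (-1) N21" "homogeneous 0 N22"
  unfolding n11_def n12_def n21_def n22_def
  by (intro homogeneous_add homogeneous_products homogeneous_gens
    homogeneous_mult_zero(2)[OF homogeneous_products(3)] homogeneous_mult_zero(3)[OF homogeneous_gens(7)])+

text \<open>The torus conjugates all matrices by a diagonal matrix, so diagonal entries have weight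
  0 and the off-diagonal ones weight 1 and -1. This makes the ideal stable under the action.\<close>

lemma analytic_relations_homogeneous:
  assumes "s \<in> analytic_relations"
  shows "\<exists>w. homogeneous w s"
proof -
  note mult = homogeneous_mult_zero
  have products: "homogeneous 0 (PCoord B2 * N21)" "homogeneous 0 (PCoord B1 * N12)"
    using homogeneous_mult[OF homogeneous_gens(6) homogeneous_N(3), of 0]
      homogeneous_mult[OF homogeneous_gens(3) homogeneous_N(2), of 0] by simp_all
  have "homogeneous 0 (PAlpha * PAlphaInv - 1)"
    by (rule homogeneous_diff[OF mult(2)[OF homogeneous_gens(1,2)] homogeneous_one])
  moreover have "homogeneous 0 (PAlpha * (N11 + PCoord B2 * N21) - 1)"
    by (rule homogeneous_diff[OF mult(2)[OF homogeneous_gens(1)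
      homogeneous_add[OF homogeneous_N(1) products(1)]] homogeneous_one])
  moreover have "homogeneous 1 (PAlpha * (N12 + PCoord B2 * N22))"
    by (rule mult(2)[OF homogeneous_gens(1)
      homogeneous_add[OF homogeneous_N(2) mult(3)[OF homogeneous_gens(6) homogeneous_N(4)]]])
  moreover have "homogeneous (-1) (PAlphaInv * (PCoord B1 * N11 + (PCoord B1 * PCoord B2 + 1) * N21))"
    by (rule mult(2)[OF homogeneous_gens(2) homogeneous_add[OF
      mult(3)[OF homogeneous_gens(3) homogeneous_N(1)] mult(2)[OF homogeneous_products(4) homogeneous_N(3)]]])
  moreover have "homogeneous 0 (PAlphaInv * (PCoord B1 * N12 + (PCoord B1 * PCoord B2 + 1) * N22) - 1)"
    by (rule homogeneous_diff[OF mult(2)[OF homogeneous_gens(2) homogeneous_add[OF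
      products(2) mult(2)[OF homogeneous_products(4) homogeneous_N(4)]]] homogeneous_one])
  ultimately have "\<forall>s\<in>analytic_relations. \<exists>w. homogeneous w s"
    unfolding analytic_relations_eq by blast
  with assms show ?thesis by blast
qed

lemma torus_act_AI:
  assumes "t \<noteq> 0" "p \<in> AI"
  shows "torus_act t p \<in> AI"
  unfolding torus_act_def
proof (rule psubst_pideal[OF assms(2)])
  fix s :: "bvar avar cpoly" assume s: "s \<in> analytic_relations"
  then obtain w where "homogeneous w s" using analytic_relations_homogeneous by blast
  then have "torus_act t s = PConst (t powi w) * s" using assms(1) by (simp add: homogeneous_def)
  then show "psubst PConst (\<lambda>v. PConst (t powi weight v) * PVar v) s \<in> AI"
    using pideal_mult[OF pideal_self[OF s]] by (simp add: torus_act_def)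
qed

interpretation AD: presented analytic_data analytic_relations acl
  unfolding analytic_data_def by (rule presented_pquot)

lemma torus_act_inverse: "t \<noteq> 0 \<Longrightarrow> torus_act t (torus_act (1 / t) p) = p"
proof (induction p rule: cpoly_induct)
  case (var v)
  have act: "torus_act u (PVar v) = PConst (u powi weight v) * PVar v" for u
    by (simp add: torus_act_def)
  have "(1 / t) powi weight v * t powi weight v = 1"
    using var by (simp add: power_int_divide_distrib)
  then have eq: "PConst ((1 / t) powi weight v) * PConst (t powi weight v) = (1 :: bvar avar cpoly)"
    by (simp only: PConst_simps(2) flip: PConst_simps(6))
  show ?case
    unfolding act torus_act_simps by (simp only: mult.assoc[symmetric] eq mult_1)
qed simp_all

lemma acl_mem_iff: "q \<in> acl p \<longleftrightarrow> q - p \<in> AI"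
proof -
  have "acl p = {i + p | i. i \<in> AI}"
    by (auto simp: pclass_def a_r_coset_def r_coset_def)
  moreover have "(\<exists>i. q = i + p \<and> i \<in> AI) \<longleftrightarrow> q - p \<in> AI"
    by (auto intro: exI[of _ "q - p"])
  ultimately show ?thesis by simp
qed

text \<open>A class is a set of polynomials. Its image is a whole class, not just part of one,
  because the action of 1/t also preserves the ideal.\<close>

lemma torus_act_acl:
  assumes "t \<noteq> 0"
  shows "torus_act t ` acl p = acl (torus_act t p)"
proof (intro Set.set_eqI iffI)
  fix q assume "q \<in> torus_act t ` acl p"
  then obtain r where "q = torus_act t r" "r - p \<in> AI" by (auto simp: acl_mem_iff)
  then show "q \<in> acl (torus_act t p)"
    using torus_act_AI[OF assms, of "r - p"] by (simp add: acl_mem_iff)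
next
  fix q assume q: "q \<in> acl (torus_act t p)"
  have "torus_act (1 / t) (q - torus_act t p) \<in> AI"
    using q assms by (intro torus_act_AI) (simp_all add: acl_mem_iff)
  moreover have "torus_act (1 / t) (torus_act t p) = p"
    using torus_act_inverse[of "1 / t" p] assms by simp
  ultimately have "torus_act (1 / t) q \<in> acl p" by (simp add: acl_mem_iff)
  moreover have "q = torus_act t (torus_act (1 / t) q)" by (simp add: torus_act_inverse assms)
  ultimately show "q \<in> torus_act t ` acl p" by blast
qed

lemma carrier_monodromy_space_iff:
  "acl p \<in> carrier monodromy_space \<longleftrightarrow> (\<forall>t. t \<noteq> 0 \<longrightarrow> torus_act t p - p \<in> AI)"
  by (simp add: monodromy_space_def torus_act_acl AD.pi_eq_iff cong: conj_cong)

text \<open>Averaging over the \<open>n\<close>-th roots of unity, for \<open>n\<close> larger than all weights that occur,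
  projects a polynomial to its part of weight zero.\<close>

lemma sum_roots_of_unity_powi:
  fixes n :: nat and w :: int
  assumes "\<bar>w\<bar> < int n"
  shows "(\<Sum>j<n. (exp (2 * of_real pi * \<i> * of_nat j / of_nat n) :: complex) powi w) = (if w = 0 then of_nat n else 0)"
proof -
  define z where "z = (exp (2 * of_real pi * \<i> * of_int w / of_nat n) :: complex)"
  have n: "n \<noteq> 0" using assms by auto
  have "(exp (2 * of_real pi * \<i> * of_nat j / of_nat n) :: complex) powi w = z ^ j" for j
    unfolding z_def exp_of_nat_mult[symmetric] exp_power_int by (simp add: mult_ac)
  then have sum: "(\<Sum>j<n. (exp (2 * of_real pi * \<i> * of_nat j / of_nat n) :: complex) powi w) = (\<Sum>j<n. z ^ j)"
    by simp
  show ?thesis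
  proof (cases "w = 0")
    case True
    then show ?thesis by simp
  next
    case False
    \<comment> \<open>Otherwise n would divide w, which is impossible for 0 < |w| < n.\<close>
    have "z \<noteq> 1"
    proof
      assume "z = 1"
      then obtain m :: int where "2 * pi * real_of_int w / real n = of_int (2 * m) * pi"
        unfolding z_def exp_eq_1 by auto
      then have "real_of_int w = real_of_int (m * int n)" using n by (simp add: field_simps)
      then have w: "w = m * int n" by (simp only: of_int_eq_iff)
      then have "m \<noteq> 0" using False by auto
      then have "1 \<le> \<bar>m\<bar>" by linarith
      then have "1 * int n \<le> \<bar>m\<bar> * int n" by (rule mult_right_mono) simp
      then have "int n \<le> \<bar>w\<bar>" by (simp add: w abs_mult)
      with assms show False by simp
    qed
    moreover have "z ^ n = 1"
      unfolding z_def exp_of_nat_mult[symmetric] using n exp_integer_2pi[of "of_int w"]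
      by (simp add: mult_ac)
    ultimately show ?thesis using False unfolding sum by (simp add: sum_gp_strict)
  qed
qed

section \<open>The ring of invariants\<close>

fun emb_var :: "3 avar \<Rightarrow> bvar avar cpoly" where
  "emb_var Alpha = PAlpha"
| "emb_var AlphaInv = PAlphaInv"
| "emb_var (Coord i) = (if i = 1 then PCoord B3 * PCoord B4 + 1
     else if i = 2 then PCoord B4 * PCoord B5 + 1 else PCoord B5 * PCoord B6 + 1)"

definition emb :: "3 avar cpoly \<Rightarrow> bvar avar cpoly" where
  "emb = psubst PConst emb_var"

lemma emb_simps [simp]:
  "emb (PConst c) = PConst c" "emb (PVar v) = emb_var v" "emb 0 = 0" "emb 1 = 1"
  "emb (p + q) = emb p + emb q" "emb (p - q) = emb p - emb q" "emb (- p) = - emb p"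
  "emb (p * q) = emb p * emb q" "emb (p ^ n) = emb p ^ n"
  by (simp_all add: emb_def)

lemma emb_sum: "emb (sum f I) = (\<Sum>i\<in>I. emb (f i))"
  by (simp add: emb_def PConst.psubst_sum)

definition emb_range :: "bvar avar cpoly set" where
  "emb_range = {q. \<exists>f. q - emb f \<in> AI}"

lemma emb_rangeI: "q - emb f \<in> AI \<Longrightarrow> q \<in> emb_range"
  by (auto simp: emb_range_def)

lemma emb_range_emb: "emb f \<in> emb_range"
  by (rule emb_rangeI[of _ f]) simp

lemma emb_range_PConst: "PConst c \<in> emb_range"
  using emb_range_emb[of "PConst c"] by simp

lemma emb_range_add: "p \<in> emb_range \<Longrightarrow> q \<in> emb_range \<Longrightarrow> p + q \<in> emb_range"
proof -
  assume "p \<in> emb_range" "q \<in> emb_range"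
  then obtain f g where "p - emb f \<in> AI" "q - emb g \<in> AI" by (auto simp: emb_range_def)
  then have "(p - emb f) + (q - emb g) \<in> AI" by (rule pideal_add)
  then show ?thesis by (intro emb_rangeI[of _ "f + g"]) (simp add: algebra_simps)
qed

lemma emb_range_mult: "p \<in> emb_range \<Longrightarrow> q \<in> emb_range \<Longrightarrow> p * q \<in> emb_range"
proof -
  assume "p \<in> emb_range" "q \<in> emb_range"
  then obtain f g where "p - emb f \<in> AI" "q - emb g \<in> AI" by (auto simp: emb_range_def)
  then have "q * (p - emb f) + emb f * (q - emb g) \<in> AI" by (intro pideal_add pideal_mult)
  then show ?thesis by (intro emb_rangeI[of _ "f * g"]) (simp add: algebra_simps)
qed

lemma emb_range_power: "p \<in> emb_range \<Longrightarrow> p ^ n \<in> emb_range"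
  using emb_range_emb[of 1] by (induction n) (auto intro: emb_range_mult)

lemma emb_range_uminus: "p \<in> emb_range \<Longrightarrow> - p \<in> emb_range"
  using emb_range_mult[OF emb_range_PConst[of "-1"]] by (simp add: PConst_simps)

lemma emb_range_cong: "p - q \<in> AI \<Longrightarrow> q \<in> emb_range \<Longrightarrow> p \<in> emb_range"
proof -
  assume "p - q \<in> AI" "q \<in> emb_range"
  then obtain f where "q - emb f \<in> AI" by (auto simp: emb_range_def)
  with \<open>p - q \<in> AI\<close> have "(p - q) + (q - emb f) \<in> AI" by (rule pideal_add)
  then show ?thesis by (intro emb_rangeI[of _ f]) simp
qed

lemma emb_range_sum: "(\<And>i. i \<in> I \<Longrightarrow> f i \<in> emb_range) \<Longrightarrow> sum f I \<in> emb_range"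
  using emb_range_emb[of 0] by (induction I rule: infinite_finite_induct) (auto intro: emb_range_add)

lemma emb_range_gens: "PAlpha \<in> emb_range" "PAlphaInv \<in> emb_range"
  "PCoord B3 * PCoord B4 + 1 \<in> emb_range" "PCoord B5 * PCoord B6 + 1 \<in> emb_range"
  using emb_range_emb[of PAlpha] emb_range_emb[of PAlphaInv]
    emb_range_emb[of "PCoord 1"] emb_range_emb[of "PCoord 3"] by simp_all

lemma emb_range_products_3456:
  assumes "i \<in> {B3, B5}" "j \<in> {B4, B6}"
  shows "PCoord i * PCoord j \<in> emb_range"
proof -
  have "PCoord B3 * PCoord B4 \<in> emb_range" "PCoord B5 * PCoord B4 \<in> emb_range" "PCoord B5 * PCoord B6 \<in> emb_range"
    using emb_range_emb[of "PCoord 1 - 1"] emb_range_emb[of "PCoord 2 - 1"] emb_range_emb[of "PCoord 3 - 1"]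
    by (simp_all add: mult.commute)
  \<comment> \<open>The one product that is not an x_i up to a constant: \<open>AI_N22\<close> reads
    b_3 b_6 = \<alpha> - x_1 x_3.\<close>
  moreover have "PCoord B3 * PCoord B6 \<in> emb_range"
    using AI_N22 by (intro emb_rangeI[of _ "PAlpha - PCoord 1 * PCoord 3"]) (simp add: n22_def algebra_simps)
  ultimately show ?thesis using assms by auto
qed

text \<open>Products with b_1 or b_2 reduce to those of b_3, ..., b_6 through \<open>AI_B1\<close>
  and \<open>AI_B2\<close>. The factor b_2 is treated first, since reducing b_1 b_2 leaves b_3 b_2
  and b_5 b_2.\<close>

lemma emb_range_products:
  assumes "i \<in> {B1, B3, B5}" "j \<in> {B2, B4, B6}"
  shows "PCoord i * PCoord j \<in> emb_range"
proof -
  have i2: "PCoord i * PCoord B2 \<in> emb_range" if i: "i \<in> {B3, B5}" for i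
  proof (rule emb_range_cong)
    let ?q = "- (PAlphaInv * (PCoord i * PCoord B6 + PCoord i * PCoord B4 * (PCoord B5 * PCoord B6 + 1)))"
    have "PCoord i * PCoord B2 - ?q
        = PCoord i * (PCoord B2 + PAlphaInv * N12)"
      by (simp add: n12_def algebra_simps)
    also have "\<dots> \<in> AI" by (intro pideal_mult AI_B2)
    finally show "PCoord i * PCoord B2 - ?q \<in> AI" .
    show "?q \<in> emb_range"
      using i by (intro emb_range_uminus emb_range_mult[OF emb_range_gens(2)] emb_range_add
        emb_range_mult[OF _ emb_range_gens(4)] emb_range_products_3456) auto
  qed
  have 1: "PCoord B1 * PCoord j \<in> emb_range" if j: "j \<in> {B2, B4, B6}" for j
  proof (rule emb_range_cong)
    let ?q = "- (PAlpha * (PCoord B3 * PCoord j + (PCoord B3 * PCoord B4 + 1) * (PCoord B5 * PCoord j)))"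
    have ij: "PCoord i * PCoord j \<in> emb_range" if "i \<in> {B3, B5}" for i
      using i2[OF that] emb_range_products_3456[of i j] that j by auto
    have "PCoord B1 * PCoord j - ?q
        = PCoord j * (PCoord B1 + PAlpha * N21)"
      by (simp add: n21_def algebra_simps)
    also have "\<dots> \<in> AI" by (intro pideal_mult AI_B1)
    finally show "PCoord B1 * PCoord j - ?q \<in> AI" .
    show "?q \<in> emb_range"
      by (intro emb_range_uminus emb_range_mult[OF emb_range_gens(1)] emb_range_add
        emb_range_mult[OF emb_range_gens(3)] ij) auto
  qed
  show ?thesis using assms i2[of i] 1[of j] emb_range_products_3456[of i j] by auto
qed

text \<open>In a monomial of weight zero the factors of weight -1 and of weight 1 are equally many.
  Listing them with multiplicity lets them be paired off into the products above.\<close>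

lemma emb_range_prod_list:
  assumes "length ls = length rs" "set ls \<subseteq> {B1, B3, B5}" "set rs \<subseteq> {B2, B4, B6}"
  shows "prod_list (map PCoord ls) * prod_list (map PCoord rs) \<in> emb_range"
  using assms
proof (induction ls rs rule: list_induct2)
  case Nil
  show ?case using emb_range_emb[of 1] by simp
next
  case (Cons i ls j rs)
  have "(PCoord i * PCoord j) * (prod_list (map PCoord ls) * prod_list (map PCoord rs)) \<in> emb_range"
    using Cons by (intro emb_range_mult[OF emb_range_products]) auto
  then show ?case by (simp add: mult_ac)
qed

definition mono_weight :: "(bvar avar \<Rightarrow>\<^sub>0 nat) \<Rightarrow> int" where
  "mono_weight m = (\<Sum>v\<in>Poly_Mapping.keys m. int (Poly_Mapping.lookup m v) * weight v)"

lemma homogeneous_mono: "homogeneous (mono_weight m) (mono_eval PVar m)"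
  unfolding mono_weight_def mono_eval_def
  by (intro homogeneous_prod homogeneous_power homogeneous_PVar)

lemma mono_weight_zero_emb_range:
  assumes "mono_weight m = 0"
  shows "mono_eval PVar m \<in> emb_range"
proof -
  let ?K = "{Alpha, AlphaInv, Coord B1, Coord B2, Coord B3, Coord B4, Coord B5, Coord B6}"
  have K: "Poly_Mapping.keys m \<subseteq> ?K"
  proof
    fix v
    show "v \<in> ?K"
    proof (cases v)
      case (Coord b)
      then show ?thesis by (cases b) simp_all
    qed simp_all
  qed
  let ?e = "Poly_Mapping.lookup m"
  let ?c = "\<lambda>b. ?e (Coord b)"
  have "mono_weight m = (\<Sum>v\<in>?K. int (?e v) * weight v)"
    unfolding mono_weight_def by (rule sum.mono_neutral_left) (use K in \<open>auto simp: in_keys_iff\<close>)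
  then have len: "?c B1 + (?c B3 + ?c B5) = ?c B2 + (?c B4 + ?c B6)"
    using assms by simp
  let ?ls = "replicate (?c B1) B1 @ replicate (?c B3) B3 @ replicate (?c B5) B5"
  let ?rs = "replicate (?c B2) B2 @ replicate (?c B4) B4 @ replicate (?c B6) B6"
  have "prod_list (map PCoord ?ls) * prod_list (map PCoord ?rs) \<in> emb_range"
    by (rule emb_range_prod_list) (use len in auto)
  then have "(PAlpha ^ ?e Alpha * PAlphaInv ^ ?e AlphaInv)
      * (prod_list (map PCoord ?ls) * prod_list (map PCoord ?rs)) \<in> emb_range"
    by (rule emb_range_mult[OF emb_range_mult[OF emb_range_power[OF emb_range_gens(1)]
      emb_range_power[OF emb_range_gens(2)]]])
  also have "(PAlpha ^ ?e Alpha * PAlphaInv ^ ?e AlphaInv)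
      * (prod_list (map PCoord ?ls) * prod_list (map PCoord ?rs)) = (\<Prod>v\<in>?K. PVar v ^ ?e v)"
    by (simp add: map_replicate_const mult_ac)
  also have "\<dots> = mono_eval PVar m"
    by (rule mono_eval_superset[symmetric]) (use K in auto)
  finally show ?thesis .
qed

lemma invariant_emb_range:
  assumes inv: "\<And>t. t \<noteq> 0 \<Longrightarrow> torus_act t p - p \<in> AI"
  shows "p \<in> emb_range"
proof -
  let ?M = "Poly_Mapping.keys p" and ?a = "Poly_Mapping.lookup p"
  \<comment> \<open>Larger than the absolute value of every weight in \<open>p\<close>, as the
    root-of-unity filter demands.\<close>
  define n where "n = Suc (\<Sum>m\<in>?M. nat \<bar>mono_weight m\<bar>)"
  have n: "\<bar>mono_weight m\<bar> < int n" if "m \<in> ?M" for m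
  proof -
    have "nat \<bar>mono_weight m\<bar> \<le> (\<Sum>m\<in>?M. nat \<bar>mono_weight m\<bar>)"
      using that by (intro member_le_sum) auto
    then have "nat \<bar>mono_weight m\<bar> < n" unfolding n_def by (rule le_imp_less_Suc)
    then show ?thesis by linarith
  qed
  define t where "t j = (exp (2 * of_real pi * \<i> * of_nat j / of_nat n) :: complex)" for j
  have t: "t j \<noteq> 0" for j by (simp add: t_def)
  define p0 where "p0 = (\<Sum>m\<in>?M. if mono_weight m = 0 then PConst (?a m) * mono_eval PVar m else 0)"
  have act: "torus_act (t j) p = (\<Sum>m\<in>?M. PConst (?a m * t j powi mono_weight m) * mono_eval PVar m)" for j
  proof -
    have "torus_act (t j) (mono_eval PVar m) = PConst (t j powi mono_weight m) * mono_eval PVar m" for m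
      using homogeneous_mono[of m] t by (simp add: homogeneous_def)
    then have "torus_act (t j) (\<Sum>m\<in>?M. PConst (?a m) * mono_eval PVar m)
        = (\<Sum>m\<in>?M. PConst (?a m * t j powi mono_weight m) * mono_eval PVar m)"
      by (simp only: torus_act_sum torus_act_simps PConst_simps(6) mult.assoc)
    then show ?thesis by (simp only: cpoly_eq_sum[symmetric])
  qed
  have "(\<Sum>j<n. torus_act (t j) p)
      = (\<Sum>m\<in>?M. PConst (?a m * (\<Sum>j<n. t j powi mono_weight m)) * mono_eval PVar m)"
    unfolding act by (subst sum.swap) (simp add: sum_distrib_left sum_distrib_right PConst_sum)
  also have "\<dots> = (\<Sum>m\<in>?M. PConst (of_nat n) * (if mono_weight m = 0 then PConst (?a m) * mono_eval PVar m else 0))"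
  proof (rule sum.cong)
    fix m assume "m \<in> ?M"
    then have sum: "(\<Sum>j<n. t j powi mono_weight m) = (if mono_weight m = 0 then of_nat n else 0)"
      unfolding t_def by (intro sum_roots_of_unity_powi n)
    show "PConst (?a m * (\<Sum>j<n. t j powi mono_weight m)) * mono_eval PVar m
        = PConst (of_nat n) * (if mono_weight m = 0 then PConst (?a m) * mono_eval PVar m else 0)"
      unfolding sum by (cases "mono_weight m = 0") (simp_all add: PConst_simps mult_ac)
  qed simp
  also have "\<dots> = PConst (of_nat n) * p0"
    by (simp add: p0_def sum_distrib_left)
  finally have avg: "(\<Sum>j<n. torus_act (t j) p) = PConst (of_nat n) * p0" .
  have const: "(\<Sum>j<n. p) = PConst (of_nat n) * p"
  proof -
    have "PConst (of_nat n) = (of_nat n :: bvar avar cpoly)" for n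
      by (induction n) (simp_all add: PConst_simps)
    then show ?thesis by (simp only: sum_constant card_lessThan)
  qed
  have "(1 / of_nat n) * of_nat n = (1 :: complex)" unfolding n_def by (simp only: nonzero_eq_divide_eq times_divide_eq_left mult_1 divide_self of_nat_neq_0 not_False_eq_True)
  then have unit: "PConst (1 / of_nat n) * PConst (of_nat n) = (1 :: bvar avar cpoly)"
    by (simp only: PConst_simps(2) flip: PConst_simps(6))
  \<comment> \<open>The polynomial is invariant only modulo \<open>AI\<close>; averaging therefore
    shows that it is congruent to its part of weight zero.\<close>
  have "PConst (1 / of_nat n) * (\<Sum>j<n. torus_act (t j) p - p) \<in> AI"
    by (rule pideal_mult, rule pideal_sum, rule inv, rule t)
  also have "PConst (1 / of_nat n) * (\<Sum>j<n. torus_act (t j) p - p) = p0 - p"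
    by (simp only: sum_subtractf avg const right_diff_distrib[symmetric] mult.assoc[symmetric] unit mult_1)
  finally have "- (p0 - p) \<in> AI" by (rule pideal_uminus)
  then have "p - p0 \<in> AI" by simp
  moreover have "p0 \<in> emb_range"
    unfolding p0_def
  proof (rule emb_range_sum)
    show "(if mono_weight m = 0 then PConst (?a m) * mono_eval PVar m else 0) \<in> emb_range" for m
      using emb_range_emb[of 0] by (simp add: emb_range_mult emb_range_PConst mono_weight_zero_emb_range)
  qed
  ultimately show ?thesis by (rule emb_range_cong)
qed

lemma carrier_monodromy_space: "carrier monodromy_space = range (\<lambda>f. acl (emb f))"
proof (intro Set.set_eqI iffI)
  fix c assume c: "c \<in> carrier monodromy_space"
  then have "c \<in> carrier analytic_data" by (simp add: monodromy_space_def)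
  then obtain p where p: "c = acl p" by (rule AD.carrierE)
  with c have "p \<in> emb_range" by (intro invariant_emb_range) (simp add: carrier_monodromy_space_iff)
  then obtain f where "p - emb f \<in> AI" by (auto simp: emb_range_def)
  then have "c = acl (emb f)" by (simp add: p AD.pi_eq_iff)
  then show "c \<in> range (\<lambda>f. acl (emb f))" by blast
next
  fix c assume "c \<in> range (\<lambda>f. acl (emb f))"
  then obtain f where f: "c = acl (emb f)" by blast
  have "homogeneous 0 (emb f)"
  proof (induction f rule: cpoly_induct)
    case (var v)
    show ?case
    proof (cases v)
      case (Coord i)
      have "homogeneous 0 (PCoord B3 * PCoord B4 + 1)" "homogeneous 0 (PCoord B4 * PCoord B5 + 1)"
        "homogeneous 0 (PCoord B5 * PCoord B6 + 1)" by (rule homogeneous_products)+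
      then show ?thesis by (simp add: Coord)
    qed (simp_all add: homogeneous_gens)
  qed (simp_all add: homogeneous_const homogeneous_add homogeneous_mult_zero)
  then have "torus_act t (emb f) = emb f" if "t \<noteq> 0" for t
    using that by (simp add: homogeneous_def PConst_simps)
  then show "c \<in> carrier monodromy_space"
    by (simp add: f carrier_monodromy_space_iff)
qed

section \<open>Relations between the invariants\<close>

text \<open>Dedekind's argument: comparing the relation at \<open>mul y x\<close> with
  \<open>ch m y\<close> times the relation at \<open>x\<close> removes the character
  \<open>m\<close>, and a \<open>y\<close> separating \<open>m\<close> from \<open>k\<close> then
  forces the coefficient of \<open>k\<close> to vanish.\<close>

lemma characters_independent:
  fixes ch :: "'m \<Rightarrow> 'g \<Rightarrow> complex" and e :: 'g and mul :: "'g \<Rightarrow> 'g \<Rightarrow> 'g"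
  assumes "finite T" and "\<And>m x y. ch m (mul x y) = ch m x * ch m y" "\<And>m. ch m e = 1"
    and "\<And>m m'. m \<in> T \<Longrightarrow> m' \<in> T \<Longrightarrow> m \<noteq> m' \<Longrightarrow> \<exists>x. ch m x \<noteq> ch m' x"
    and "\<And>x. (\<Sum>m\<in>T. a m * ch m x) = 0"
  shows "\<forall>m\<in>T. a m = 0"
  using assms(1,4,5)
proof (induction T arbitrary: a rule: finite_induct)
  case (insert m T)
  have T: "\<forall>k\<in>T. a k * (ch k y - ch m y) = 0" for y
  proof (rule insert.IH)
    fix x
    have "(\<Sum>k\<in>insert m T. a k * ch k (mul y x)) - ch m y * (\<Sum>k\<in>insert m T. a k * ch k x) = 0"
      using insert.prems(2)[of "mul y x"] insert.prems(2)[of x] by simp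
    then show "(\<Sum>k\<in>T. a k * (ch k y - ch m y) * ch k x) = 0"
      using insert.hyps by (simp add: assms(2) sum_distrib_left algebra_simps sum_subtractf)
  qed (use insert.prems(1) in blast)
  have aT: "a k = 0" if "k \<in> T" for k
  proof -
    have "m \<noteq> k" using that insert.hyps by auto
    with that obtain y where "ch m y \<noteq> ch k y" using insert.prems(1)[of m k] by blast
    then show ?thesis using T[of y] that by auto
  qed
  then have "a m = 0" using insert.prems(2)[of e] insert.hyps by (simp add: assms(3))
  with aT show ?case by simp
qed simp

text \<open>In the coordinates \<open>p = x\<^sub>1 - 1\<close>, \<open>q = x\<^sub>2 - 1\<close>, \<open>r = x\<^sub>3 - 1\<close>, \<open>s = \<alpha> - x\<^sub>1 x\<^sub>3\<close>, which are the
  invariants \<open>b\<^sub>3 b\<^sub>4\<close>, \<open>b\<^sub>4 b\<^sub>5\<close>, \<open>b\<^sub>5 b\<^sub>6\<close>, \<open>b\<^sub>3 b\<^sub>6\<close>, the cubic becomes \<open>p r - q s\<close>.\<close>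

definition toric :: "nat \<times> nat \<times> nat \<times> nat \<Rightarrow> 3 avar cpoly" where
  "toric = (\<lambda>(u, v, k, j). (PCoord 1 - 1) ^ u * (PCoord 3 - 1) ^ v * (PCoord 2 - 1) ^ k
     * (PAlpha - PCoord 1 * PCoord 3) ^ j)"

text \<open>The value of the monomial \<open>toric\<close> at analytic data: a multiplicative
  character of complex 4-space under coordinatewise multiplication. The exponents belong to p, r, q,
  s in this order.\<close>

definition toric_char :: "nat \<times> nat \<times> nat \<times> nat \<Rightarrow> (bvar \<Rightarrow> complex) \<Rightarrow> complex" where
  "toric_char = (\<lambda>(u, v, k, j) b. (b B3 * b B4) ^ u * (b B5 * b B6) ^ v * (b B4 * b B5) ^ k * (b B3 * b B6) ^ j)"

definition toric_normal :: "3 avar cpoly set" where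
  "toric_normal = toric ` {(u, v, k, j). u = 0 \<or> v = 0}"

abbreviation toric_span :: "3 avar cpoly set" where
  "toric_span \<equiv> filtration family_relations (\<lambda>_. toric_normal) 0"

text \<open>The cubic equals p r - q s, so each factor p r can be traded for q s until p or r is
  used up.\<close>

lemma toric_in_span: "toric (u, v, k, j) \<in> toric_span"
proof (induction u arbitrary: v k j)
  case 0
  show ?case by (rule filtration_base) (auto simp: toric_normal_def)
next
  case (Suc u)
  show ?case
  proof (cases v)
    case 0
    then show ?thesis by (intro filtration_base) (auto simp: toric_normal_def)
  next
    case (Suc v')
    have "toric (Suc u, v, k, j) - toric (u, v', Suc k, Suc j) = toric (u, v', k, j) * cubic PAlpha PCoord"
      by (simp add: toric_def Suc cubic_def algebra_simps)
    then have "toric (Suc u, v, k, j) - toric (u, v', Suc k, Suc j) \<in> pideal family_relations"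
      using pideal_mult[OF family_relations_pideal(2)] by simp
    then show ?thesis by (rule filtration_cong[OF _ Suc.IH])
  qed
qed

lemma toric_span_mult:
  assumes "f \<in> toric_span"
  shows "(PCoord 1 - 1) * f \<in> toric_span" "(PCoord 2 - 1) * f \<in> toric_span"
    "(PCoord 3 - 1) * f \<in> toric_span" "(PAlpha - PCoord 1 * PCoord 3) * f \<in> toric_span"
proof -
  have gen: "g * f \<in> toric_span" if "\<And>i. g * toric i \<in> toric_span" for g
  proof (rule filtration_mult[OF assms])
    fix b assume "b \<in> toric_normal"
    then obtain i where "b = toric i" by (auto simp: toric_normal_def)
    then show "g * b \<in> toric_span" using that by simp
  qed
  have "(PCoord 1 - 1) * toric i \<in> toric_span" "(PCoord 2 - 1) * toric i \<in> toric_span"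
    "(PCoord 3 - 1) * toric i \<in> toric_span" "(PAlpha - PCoord 1 * PCoord 3) * toric i \<in> toric_span" for i
  proof -
    obtain u v k j where i: "i = (u, v, k, j)" by (rule prod_cases4)
    show "(PCoord 1 - 1) * toric i \<in> toric_span" "(PCoord 2 - 1) * toric i \<in> toric_span"
      "(PCoord 3 - 1) * toric i \<in> toric_span" "(PAlpha - PCoord 1 * PCoord 3) * toric i \<in> toric_span"
      using toric_in_span[of "Suc u" v k j] toric_in_span[of u v "Suc k" j]
        toric_in_span[of u "Suc v" k j] toric_in_span[of u v k "Suc j"]
      by (simp_all add: i toric_def mult_ac)
  qed
  then show "(PCoord 1 - 1) * f \<in> toric_span" "(PCoord 2 - 1) * f \<in> toric_span"
    "(PCoord 3 - 1) * f \<in> toric_span" "(PAlpha - PCoord 1 * PCoord 3) * f \<in> toric_span"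
    by (blast intro: gen)+
qed

lemma toric_span_PCoord: "f \<in> toric_span \<Longrightarrow> PCoord i * f \<in> toric_span"
proof -
  assume f: "f \<in> toric_span"
  have "g * f \<in> toric_span" if "(g - 1) * f \<in> toric_span" for g
  proof -
    have "g * f = (g - 1) * f + f" by (simp add: algebra_simps)
    then show ?thesis using filtration_add[OF that f] by simp
  qed
  from this[OF toric_span_mult(1)[OF f]] this[OF toric_span_mult(2)[OF f]] this[OF toric_span_mult(3)[OF f]]
  have "PCoord 1 * f \<in> toric_span" "PCoord 2 * f \<in> toric_span" "PCoord 3 * f \<in> toric_span" .
  then show ?thesis by (rule forall_3_cases)
qed

lemma toric_span_PAlpha: "f \<in> toric_span \<Longrightarrow> PAlpha * f \<in> toric_span"
proof -
  assume f: "f \<in> toric_span"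
  have "PAlpha * f = (PAlpha - PCoord 1 * PCoord 3) * f + PCoord 1 * (PCoord 3 * f)"
    by (simp add: algebra_simps)
  then show ?thesis
    using filtration_add[OF toric_span_mult(4)[OF f] toric_span_PCoord[OF toric_span_PCoord[OF f]]] by simp
qed

lemma toric_span_PAlpha_power: "f \<in> toric_span \<Longrightarrow> PAlpha ^ n * f \<in> toric_span"
  by (induction n) (simp_all add: mult.assoc toric_span_PAlpha)

text \<open>The toric monomials generate \<alpha> and the x_i, but \<alpha>^-1 has to be cleared.
  The exponent is uniform in \<open>f\<close>, so that it adds up under sums and products of
  multipliers.\<close>

lemma toric_span_multiplier: "\<exists>n. \<forall>f\<in>toric_span. PAlpha ^ n * (g * f) \<in> toric_span"
proof (induction g rule: cpoly_induct)
  case (const c)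
  show ?case by (rule exI[of _ 0]) (simp add: filtration_scale)
next
  case (var v)
  show ?case
  proof (cases v)
    case AlphaInv
    have "PAlpha ^ 1 * (PAlphaInv * f) \<in> toric_span" if "f \<in> toric_span" for f
    proof (rule filtration_cong[OF _ that])
      have "PAlpha ^ 1 * (PAlphaInv * f) - f = f * (PAlpha * PAlphaInv - 1)" by (simp add: algebra_simps)
      then show "PAlpha ^ 1 * (PAlphaInv * f) - f \<in> pideal family_relations"
        using pideal_mult[OF family_relations_pideal(1)] by simp
    qed
    then show ?thesis unfolding AlphaInv by blast
  qed (auto intro!: exI[of _ 0] toric_span_PAlpha toric_span_PCoord)
next
  case (add p q)
  then obtain n m where nm: "\<forall>f\<in>toric_span. PAlpha ^ n * (p * f) \<in> toric_span"
    "\<forall>f\<in>toric_span. PAlpha ^ m * (q * f) \<in> toric_span" by blast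
  have "PAlpha ^ (n + m) * ((p + q) * f) \<in> toric_span" if "f \<in> toric_span" for f
  proof -
    have "PAlpha ^ (n + m) * ((p + q) * f) = PAlpha ^ m * (PAlpha ^ n * (p * f)) + PAlpha ^ n * (PAlpha ^ m * (q * f))"
      by (simp add: power_add algebra_simps)
    then show ?thesis using nm that by (simp add: filtration_add toric_span_PAlpha_power)
  qed
  then show ?case by blast
next
  case (mult p q)
  then obtain n m where nm: "\<forall>f\<in>toric_span. PAlpha ^ n * (p * f) \<in> toric_span"
    "\<forall>f\<in>toric_span. PAlpha ^ m * (q * f) \<in> toric_span" by blast
  have "PAlpha ^ (n + m) * ((p * q) * f) \<in> toric_span" if "f \<in> toric_span" for f
  proof -
    have "PAlpha ^ (n + m) * ((p * q) * f) = PAlpha ^ n * (p * (PAlpha ^ m * (q * f)))"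
      by (simp add: power_add mult_ac)
    then show ?thesis using nm that by simp
  qed
  then show ?case by blast
qed

lemma emb_family_pideal: "p \<in> pideal family_relations \<Longrightarrow> emb p \<in> AI"
  unfolding emb_def
proof (erule psubst_pideal)
  fix s assume "s \<in> family_relations"
  then consider "s = PAlpha * PAlphaInv - 1" | "s = cubic PAlpha PCoord" by (auto simp: family_relations_def)
  then show "psubst PConst emb_var s \<in> AI"
  proof cases
    case 1
    then show ?thesis using AI_alpha by simp
  next
    case 2
    \<comment> \<open>In the b_i the products b_3 b_4 b_5 b_6 formed as p r and as q b_3 b_6 agree,
      so the cubic measures only the difference of b_3 b_6 and \<alpha> - x_1 x_3.\<close>
    have "psubst PConst emb_var s = PCoord B4 * PCoord B5 * (N22 - PAlpha)"
      by (simp add: 2) (simp add: cubic_def n22_def algebra_simps)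
    then show ?thesis using AI_N22 by (simp add: pideal_mult)
  qed
qed

text \<open>Setting one coordinate to 2 and the others to 1 reveals u + j, u + k, v + k and v + j.
  These determine u - v, hence u and v since one of them is 0, and then k and j.\<close>

lemma toric_char_distinct:
  assumes "fst i = 0 \<or> fst (snd i) = 0" "fst i' = 0 \<or> fst (snd i') = 0" "i \<noteq> i'"
  shows "\<exists>b. toric_char i b \<noteq> toric_char i' b"
proof (rule ccontr)
  obtain u v k j where "i = (u, v, k, j)" by (rule prod_cases4)
  moreover obtain u' v' k' j' where "i' = (u', v', k', j')" by (rule prod_cases4)
  ultimately have i: "i = (u, v, k, j)" "i' = (u', v', k', j')" by blast+
  assume "\<nexists>b. toric_char i b \<noteq> toric_char i' b"
  then have "toric_char i ((\<lambda>_. 1)(c := 2)) = toric_char i' ((\<lambda>_. 1)(c := 2))" for c by blast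
  from this[of B3] this[of B4] this[of B5] this[of B6]
  have "(2 :: complex) ^ (u + j) = 2 ^ (u' + j')" "(2 :: complex) ^ (u + k) = 2 ^ (u' + k')"
    "(2 :: complex) ^ (v + k) = 2 ^ (v' + k')" "(2 :: complex) ^ (v + j) = 2 ^ (v' + j')"
    by (simp_all add: toric_char_def i power_add)
  moreover have "m = m'" if "(2 :: complex) ^ m = 2 ^ m'" for m m'
  proof -
    have "norm ((2 :: complex) ^ m) = norm ((2 :: complex) ^ m')" using that by simp
    then have "(2 :: real) ^ m = 2 ^ m'" by (simp add: norm_power)
    then show ?thesis by simp
  qed
  ultimately have "u + j = u' + j'" "u + k = u' + k'" "v + k = v' + k'" "v + j = v' + j'" by blast+
  with assms i show False by auto
qed

lemma toric_normal_vanishing: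
  assumes "finite T" "T \<subseteq> {(u, v, k, j). u = 0 \<or> v = 0}"
    and zero: "\<And>b. n22 (b B3) (b B4) (b B5) (b B6) \<noteq> 0 \<Longrightarrow> (\<Sum>i\<in>T. a i * toric_char i b) = 0"
  shows "\<forall>i\<in>T. a i = 0"
proof (rule characters_independent[where ch = toric_char and mul = "\<lambda>b c v. b v * c v" and e = "\<lambda>_. 1"])
  show "toric_char i (\<lambda>v. b v * c v) = toric_char i b * toric_char i c" for i b c
    by (cases i) (simp add: toric_char_def power_mult_distrib mult_ac)
  show "toric_char i (\<lambda>_. 1) = 1" for i
    by (cases i) (simp add: toric_char_def)
  show "\<exists>b. toric_char i b \<noteq> toric_char i' b" if "i \<in> T" "i' \<in> T" "i \<noteq> i'" for i i'
    using that assms(2) by (intro toric_char_distinct) auto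
  fix b
  text \<open>Restrict to the line through \<open>b\<close> and \<open>0\<close>, where the value imposed on \<open>\<alpha>\<close> is \<open>1\<close>.\<close>
  define d where "d = (\<lambda>(u, v, k, j). 2 * (u + v + k + j) :: nat)"
  have scale: "toric_char i (\<lambda>v. t * b v) = toric_char i b * t ^ d i" for i t
  proof -
    obtain u v k j where i: "i = (u, v, k, j)" by (rule prod_cases4)
    have "t ^ (2 * (u + v + k + j)) = (t * t) ^ u * (t * t) ^ v * (t * t) ^ k * (t * t) ^ j"
      by (simp add: power_mult power2_eq_square power_add)
    then show ?thesis
      by (simp add: toric_char_def i d_def power_mult_distrib mult_ac)
  qed
  define H where "H = (\<Sum>i\<in>T. Polynomial.monom (a i * toric_char i b) (d i))"
  have H: "poly H t = (\<Sum>i\<in>T. a i * toric_char i (\<lambda>v. t * b v))" for t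
    by (simp add: H_def poly_sum poly_monom scale mult_ac)
  \<comment> \<open>The value of \<open>n22\<close> on the line t b. Its constant term 1 makes it a
    nonzero polynomial, so it cancels from W H = 0.\<close>
  define W where "W = [:1, 0, b B3 * b B6 + b B3 * b B4 + b B5 * b B6, 0, b B3 * b B4 * b B5 * b B6:]"
  have W: "poly W t = n22 (t * b B3) (t * b B4) (t * b B5) (t * b B6)" for t
    by (simp add: W_def n22_def algebra_simps)
  have "poly (W * H) t = 0" for t
    using zero[of "\<lambda>v. t * b v"] by (cases "poly W t = 0") (simp_all add: W H)
  then have "W * H = 0" using poly_all_0_iff_0[of "W * H"] by blast
  moreover have "W \<noteq> 0" by (simp add: W_def)
  ultimately have "H = 0" by simp
  then show "(\<Sum>i\<in>T. a i * toric_char i b) = 0" using H[of 1] by simp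
qed (rule assms(1))

text \<open>After multiplication by a power of \<alpha>, \<open>f\<close> has a toric normal form
  \<open>g\<close>. Its image vanishes at all analytic data, an open set of choices of b_3, ...,
  b_6, so the coefficients of \<open>g\<close> vanish.\<close>

lemma emb_kernel:
  assumes "emb f \<in> AI"
  shows "f \<in> pideal family_relations"
proof -
  have "1 \<in> toric_span" using toric_in_span[of 0 0 0 0] by (simp add: toric_def)
  then obtain n where "PAlpha ^ n * f \<in> toric_span"
    using toric_span_multiplier[of f] by (metis mult.right_neutral)
  then obtain g where g: "g \<in> cpoly.span toric_normal" "PAlpha ^ n * f - g \<in> pideal family_relations"
    by (auto simp: filtration_def)
  have "emb g \<in> AI"
    using pideal_diff[OF pideal_mult[OF assms, of "PAlpha ^ n"] emb_family_pideal[OF g(2)]] by simp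
  obtain t c where t: "finite t" "t \<subseteq> toric_normal" and g_sum: "g = (\<Sum>m\<in>t. PConst (c m) * m)"
    using g(1) unfolding cpoly.span_explicit by blast
  \<comment> \<open>The coefficients of \<open>g\<close> are indexed by polynomials; this re-indexes
    them by exponent vectors, as the independence result expects.\<close>
  define idx where "idx = inv_into {(u, v, k, j). u = 0 \<or> v = 0} toric"
  have idx: "toric (idx m) = m" "idx m \<in> {(u, v, k, j). u = 0 \<or> v = 0}" if "m \<in> t" for m
  proof -
    have m: "m \<in> toric ` {(u, v, k, j). u = 0 \<or> v = 0}"
      using that t(2) unfolding toric_normal_def by (rule subsetD[rotated])
    show "toric (idx m) = m" unfolding idx_def by (rule f_inv_into_f[OF m])
    show "idx m \<in> {(u, v, k, j). u = 0 \<or> v = 0}" unfolding idx_def by (rule inv_into_into[OF m])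
  qed
  have inj: "inj_on idx t"
  proof (rule inj_onI)
    fix m m' assume m: "m \<in> t" "m' \<in> t" "idx m = idx m'"
    from arg_cong[OF m(3), of toric] show "m = m'" by (simp only: idx(1)[OF m(1)] idx(1)[OF m(2)])
  qed
  have "\<forall>i\<in>idx ` t. c (toric i) = 0"
  proof (rule toric_normal_vanishing)
    fix b :: "bvar \<Rightarrow> complex"
    let ?a = "n22 (b B3) (b B4) (b B5) (b B6)"
    assume a: "?a \<noteq> 0"
    define x where "x = (\<lambda>v. case v of Alpha \<Rightarrow> ?a | AlphaInv \<Rightarrow> 1 / ?a | Coord w \<Rightarrow>
      if w = B1 then - ?a * n21 (b B3) (b B4) (b B5) (b B6)
      else if w = B2 then - n12 (b B3) (b B4) (b B5) (b B6) / ?a else b w)"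
    have x: "x Alpha = ?a" "\<And>v. v \<in> {B3, B4, B5, B6} \<Longrightarrow> x (Coord v) = b v"
      by (auto simp: x_def)
    have "ev x s = 0" if "s \<in> analytic_relations" for s
      by (rule analytic_point[OF a that]) (auto simp: x_def)
    then have "ev x (emb g) = 0" using \<open>emb g \<in> AI\<close> by (rule ev_pideal[rotated])
    moreover have "ev x (emb (toric i)) = toric_char i b" for i
      by (cases i) (simp add: toric_def toric_char_def x n22_def mult_ac)
    then have "ev x (emb g) = (\<Sum>m\<in>t. c m * toric_char (idx m) b)"
      unfolding g_sum emb_sum ev_sum
    proof (intro sum.cong refl)
      fix m assume "m \<in> t"
      from \<open>\<And>i. ev x (emb (toric i)) = toric_char i b\<close>[of "idx m"]
      show "ev x (emb (PConst (c m) * m)) = c m * toric_char (idx m) b"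
        by (simp only: idx(1)[OF \<open>m \<in> t\<close>] emb_simps ev_simps)
    qed
    ultimately have "(\<Sum>m\<in>t. c m * toric_char (idx m) b) = 0" by simp
    moreover have "(\<Sum>m\<in>t. c m * toric_char (idx m) b) = (\<Sum>m\<in>t. c (toric (idx m)) * toric_char (idx m) b)"
      by (intro sum.cong refl) (simp only: idx(1))
    ultimately show "(\<Sum>i\<in>idx ` t. c (toric i) * toric_char i b) = 0"
      by (simp only: sum.reindex[OF inj] comp_def)
  next
    show "finite (idx ` t)" using t(1) by (rule finite_imageI)
    show "idx ` t \<subseteq> {(u, v, k, j). u = 0 \<or> v = 0}" using idx(2) by (rule image_subsetI)
  qed
  then have "c (toric (idx m)) = 0" if "m \<in> t" for m using that by (rule bspec[OF _ imageI])
  then have "c m = 0" if "m \<in> t" for m using that by (simp only: idx(1))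
  then have "g = 0" unfolding g_sum by (intro sum.neutral ballI) (simp only: PConst_simps mult_zero_left)
  with g(2) have "PAlphaInv ^ n * (PAlpha ^ n * f) \<in> pideal family_relations"
    by (simp add: pideal_mult)
  \<comment> \<open>\<alpha> is a unit modulo the relations, so the power introduced above can be
    divided out.\<close>
  moreover have "1 - (PAlpha * PAlphaInv) ^ n \<in> pideal family_relations"
  proof (induction n)
    case (Suc n)
    have eq: "1 - (PAlpha * PAlphaInv) ^ Suc n
        = (1 - (PAlpha * PAlphaInv) ^ n) - (PAlpha * PAlphaInv) ^ n * (PAlpha * PAlphaInv - 1)"
      by (simp add: algebra_simps)
    show ?case unfolding eq by (intro pideal_diff pideal_mult Suc family_relations_pideal(1))
  qed simp
  then have "f * (1 - (PAlpha * PAlphaInv) ^ n) \<in> pideal family_relations" by (rule pideal_mult)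
  ultimately have "f * (1 - (PAlpha * PAlphaInv) ^ n) + PAlphaInv ^ n * (PAlpha ^ n * f) \<in> pideal family_relations"
    by (rule pideal_add[rotated])
  then show ?thesis by (simp add: power_mult_distrib algebra_simps)
qed

lemma presented_monodromy_space: "presented monodromy_space family_relations (\<lambda>f. acl (emb f))"
proof (rule presented.intro)
  have hom: "(\<lambda>f. acl (emb f)) \<in> ring_hom poly_alg analytic_data"
    by (rule ring_hom_memI) (simp_all add: AD.pi_add AD.pi_mult AD.pi_one)
  have "ring_hom_ring poly_alg analytic_data (\<lambda>f. acl (emb f))"
    by (rule ring_hom_ringI2) (rule poly_alg.ring_axioms AD.ring_axioms hom)+
  from ring_hom_ring.img_is_subring[OF this poly_alg.carrier_is_subring]
  have "subring (carrier monodromy_space) analytic_data"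
    by (simp add: carrier_monodromy_space)
  then have "subcring (carrier monodromy_space) analytic_data" by (rule AD.subcringI')
  moreover have "analytic_data\<lparr>carrier := carrier monodromy_space\<rparr> = monodromy_space"
    by (simp add: monodromy_space_def)
  ultimately show "cring monodromy_space"
    using AD.subcring_iff[of "carrier monodromy_space"] subcringE(1) by metis
  have ops: "x \<oplus>\<^bsub>monodromy_space\<^esub> y = x \<oplus>\<^bsub>analytic_data\<^esub> y"
    "x \<otimes>\<^bsub>monodromy_space\<^esub> y = x \<otimes>\<^bsub>analytic_data\<^esub> y" "\<one>\<^bsub>monodromy_space\<^esub> = \<one>\<^bsub>analytic_data\<^esub>"
    "\<zero>\<^bsub>monodromy_space\<^esub> = \<zero>\<^bsub>analytic_data\<^esub>" "scal monodromy_space = scal analytic_data" for x y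
    by (simp_all add: monodromy_space_def)
  show "(\<lambda>f. acl (emb f)) \<in> ring_hom poly_alg monodromy_space"
    by (rule ring_hom_memI) (simp_all add: carrier_monodromy_space ops AD.pi_add AD.pi_mult AD.pi_one)
  show "carrier monodromy_space = range (\<lambda>f. acl (emb f))" by (rule carrier_monodromy_space)
  show "scal monodromy_space c = acl (emb (PConst c))" for c by (simp add: ops AD.scal_eq)
  show "acl (emb p) = \<zero>\<^bsub>monodromy_space\<^esub> \<longleftrightarrow> p \<in> pideal family_relations" for p
    using emb_kernel emb_family_pideal by (auto simp: ops AD.ker)
qed

section \<open>The fibres\<close>

interpretation MS: presented monodromy_space family_relations "\<lambda>f. acl (emb f)"
  by (rule presented_monodromy_space)

definition coord_emb :: "3 cpoly \<Rightarrow> 3 avar cpoly" where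
  "coord_emb = psubst PConst PCoord"

definition specialise :: "complex \<Rightarrow> 3 avar cpoly \<Rightarrow> 3 cpoly" where
  "specialise a = psubst PConst (\<lambda>v. case v of Alpha \<Rightarrow> PConst a | AlphaInv \<Rightarrow> PConst (1 / a) | Coord i \<Rightarrow> PVar i)"

lemma coord_emb_simps [simp]:
  "coord_emb (PConst c) = PConst c" "coord_emb (PVar i) = PCoord i" "coord_emb 0 = 0" "coord_emb 1 = 1"
  "coord_emb (p + q) = coord_emb p + coord_emb q" "coord_emb (p - q) = coord_emb p - coord_emb q"
  "coord_emb (p * q) = coord_emb p * coord_emb q"
  by (simp_all add: coord_emb_def)

lemma specialise_simps [simp]:
  "specialise a (PConst c) = PConst c" "specialise a PAlpha = PConst a" "specialise a PAlphaInv = PConst (1 / a)"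
  "specialise a (PCoord i) = PVar i" "specialise a 0 = 0" "specialise a 1 = 1"
  "specialise a (p + q) = specialise a p + specialise a q" "specialise a (p - q) = specialise a p - specialise a q"
  "specialise a (p * q) = specialise a p * specialise a q"
  by (simp_all add: specialise_def)

lemma specialise_coord_emb: "specialise a (coord_emb p) = p"
  by (induction p rule: cpoly_induct) simp_all

lemma specialise_family_pideal:
  assumes "a \<noteq> 0" "p \<in> pideal family_relations"
  shows "specialise a p \<in> pideal {fibre_cubic a}"
  unfolding specialise_def
proof (rule psubst_pideal[OF assms(2)], fold specialise_def)
  fix s assume "s \<in> family_relations"
  then consider "s = PAlpha * PAlphaInv - 1" | "s = cubic PAlpha PCoord" by (auto simp: family_relations_def)
  then show "specialise a s \<in> pideal {fibre_cubic a}"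
  proof cases
    case 1
    have "PConst a * PConst (1 / a) = (1 :: 3 cpoly)"
      using assms(1) by (simp add: PConst_simps(2) flip: PConst_simps(6))
    then show ?thesis by (simp add: 1)
  next
    case 2
    have "specialise a s = fibre_cubic a"
      unfolding 2 specialise_def PConst.psubst_cubic fibre_cubic_def by simp
    then show ?thesis by (simp add: pideal_self)
  qed
qed

text \<open>Modulo the relations, the kernel of setting \<alpha> = a is generated by \<alpha> - a;
  for \<alpha>^-1 this uses \<alpha>^-1 - 1/a = -(1/a) \<alpha>^-1 (\<alpha> - a).\<close>

lemma specialise_diff:
  assumes "a \<noteq> 0"
  shows "\<exists>h. f - coord_emb (specialise a f) - h * (PAlpha - PConst a) \<in> pideal family_relations"
proof (induction f rule: cpoly_induct)
  case (const c)
  show ?case by (rule exI[of _ 0]) simp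
next
  case (var v)
  show ?case
  proof (cases v)
    case Alpha
    then show ?thesis by (intro exI[of _ 1]) simp
  next
    case AlphaInv
    have "PConst (1 / a) * PConst a = (1 :: 3 avar cpoly)"
      using assms by (simp add: PConst_simps(2) flip: PConst_simps(6))
    then have "PAlphaInv * (PConst (1 / a) * PConst a) = (PAlphaInv :: 3 avar cpoly)" by simp
    then have "PAlphaInv - PConst (1 / a) - - (PConst (1 / a) * PAlphaInv) * (PAlpha - PConst a)
        = PConst (1 / a) * (PAlpha * PAlphaInv - 1 :: 3 avar cpoly)"
      by (simp add: algebra_simps)
    also have "\<dots> \<in> pideal family_relations" by (intro pideal_mult family_relations_pideal)
    finally show ?thesis
      unfolding AlphaInv by (intro exI[of _ "- (PConst (1 / a) * PAlphaInv)"]) simp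
  next
    case (Coord i)
    then show ?thesis by (intro exI[of _ 0]) simp
  qed
next
  case (add p q)
  then obtain h k where "p - coord_emb (specialise a p) - h * (PAlpha - PConst a) \<in> pideal family_relations"
    "q - coord_emb (specialise a q) - k * (PAlpha - PConst a) \<in> pideal family_relations" by blast
  then have "(p - coord_emb (specialise a p) - h * (PAlpha - PConst a))
    + (q - coord_emb (specialise a q) - k * (PAlpha - PConst a)) \<in> pideal family_relations"
    by (rule pideal_add)
  then show ?case by (intro exI[of _ "h + k"]) (simp add: algebra_simps)
next
  case (mult p q)
  then obtain h k where "p - coord_emb (specialise a p) - h * (PAlpha - PConst a) \<in> pideal family_relations"
    "q - coord_emb (specialise a q) - k * (PAlpha - PConst a) \<in> pideal family_relations" by blast
  then have "coord_emb (specialise a q) * (p - coord_emb (specialise a p) - h * (PAlpha - PConst a))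
    + p * (q - coord_emb (specialise a q) - k * (PAlpha - PConst a)) \<in> pideal family_relations"
    by (intro pideal_add pideal_mult)
  then show ?case
    by (intro exI[of _ "coord_emb (specialise a q) * h + p * k"]) (simp add: algebra_simps)
qed

lemma fibre_ideal_eq: "fibre_ideal a = {acl (emb (h * (PAlpha - PConst a))) | h. True}"
proof -
  have "alphaR \<ominus>\<^bsub>monodromy_space\<^esub> scal monodromy_space a = acl (emb (PAlpha - PConst a))"
    using MS.pi_diff[of PAlpha "PConst a"] by (simp add: alphaR_def MS.scal_eq)
  then have "fibre_ideal a = PIdl\<^bsub>monodromy_space\<^esub> (acl (emb (PAlpha - PConst a)))"
    unfolding fibre_ideal_def by (simp only: MS.cgenideal_eq_genideal[OF MS.pi_closed])
  also have "\<dots> = {acl (emb (h * (PAlpha - PConst a))) | h. True}"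
    unfolding cgenideal_def MS.carrier_eq MS.pi_mult by blast
  finally show ?thesis .
qed

lemma ideal_fibre_ideal: "ideal (fibre_ideal a) monodromy_space"
proof -
  have "alphaR \<in> carrier monodromy_space" "scal monodromy_space a \<in> carrier monodromy_space"
    using MS.pi_closed[of PAlpha] MS.pi_closed[of "PConst a"] by (simp_all add: alphaR_def MS.scal_eq)
  then show ?thesis unfolding fibre_ideal_def by (intro MS.genideal_ideal) simp
qed

lemma fibre_ideal_iff:
  "acl (emb f) \<in> fibre_ideal a \<longleftrightarrow> (\<exists>h. f - h * (PAlpha - PConst a) \<in> pideal family_relations)"
  unfolding fibre_ideal_eq mem_Collect_eq MS.pi_eq_iff by simp

text \<open>The quotient is first presented in all five variables. Then \<open>specialise\<close>
  and its section \<open>coord_emb\<close> eliminate \<alpha> and its inverse, leaving the cubic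
  with constant coefficient \<open>a\<close>.\<close>

lemma presented_fibre:
  assumes "a \<noteq> 0"
  shows "presented (fibre a) {fibre_cubic a}
    (\<lambda>p. fibre_ideal a +>\<^bsub>monodromy_space\<^esub> acl (emb (coord_emb p)))"
proof -
  let ?T = "{f. acl (emb f) \<in> fibre_ideal a}"
  let ?k = "\<lambda>f. fibre_ideal a +>\<^bsub>monodromy_space\<^esub> acl (emb f)"
  have "pideal ?T = ?T"
    by (rule MS.pideal_ideal[OF MS.ideal_preimage[OF ideal_fibre_ideal]])
  then have *: "p \<in> pideal ?T \<longleftrightarrow> acl (emb p) \<in> fibre_ideal a" for p by simp
  interpret Q: presented "fibre a" ?T ?k
    unfolding fibre_def by (rule MS.quotient[OF ideal_fibre_ideal *])
  show ?thesis
  proof (rule presented.intro)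
    show "cring (fibre a)" by (rule Q.cring_alg)
    have "coord_emb \<in> ring_hom poly_alg poly_alg" by (rule ring_hom_memI) simp_all
    from ring_hom_trans[OF this Q.hom]
    show "(\<lambda>p. ?k (coord_emb p)) \<in> ring_hom poly_alg (fibre a)" by (simp add: comp_def)
    have "?k f = ?k (coord_emb (specialise a f))" for f
      by (subst Q.pi_eq_iff, subst *, subst fibre_ideal_iff) (rule specialise_diff[OF assms])
    then show "carrier (fibre a) = range (\<lambda>p. ?k (coord_emb p))"
      unfolding Q.carrier_eq by blast
    show "scal (fibre a) c = ?k (coord_emb (PConst c))" for c
      by (simp add: Q.scal_eq)
    fix p
    have "?k (coord_emb p) = \<zero>\<^bsub>fibre a\<^esub>
        \<longleftrightarrow> (\<exists>h. coord_emb p - h * (PAlpha - PConst a) \<in> pideal family_relations)"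
      by (subst Q.ker, subst *, subst fibre_ideal_iff) (rule refl)
    also have "\<dots> \<longleftrightarrow> p \<in> pideal {fibre_cubic a}"
    proof
      assume "\<exists>h. coord_emb p - h * (PAlpha - PConst a) \<in> pideal family_relations"
      then obtain h where "coord_emb p - h * (PAlpha - PConst a) \<in> pideal family_relations" by blast
      from specialise_family_pideal[OF assms this] show "p \<in> pideal {fibre_cubic a}"
        by (simp add: specialise_coord_emb)
    next
      assume p: "p \<in> pideal {fibre_cubic a}"
      have I: "ideal {p. acl (emb (coord_emb p)) \<in> fibre_ideal a} poly_alg"
      proof -
        have T: "ideal ?T poly_alg" by (rule MS.ideal_preimage[OF ideal_fibre_ideal])
        interpret T: ideal ?T poly_alg by (rule T)
        show ?thesis
          using T.zero_closed T.a_closed T.I_l_closed by (intro idealI_poly_alg) simp_all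
      qed
      have "coord_emb (fibre_cubic a) = cubic (PConst a) PCoord"
        unfolding coord_emb_def fibre_cubic_def PConst.psubst_cubic by simp
      \<comment> \<open>The cubic is linear in \<alpha>, so replacing \<open>a\<close> by \<alpha>
        changes it by a multiple of \<alpha> - a.\<close>
      also have "\<dots> = cubic PAlpha PCoord - (1 - PCoord 2) * (PAlpha - PConst a)"
        by (simp add: cubic_def algebra_simps)
      finally have "coord_emb (fibre_cubic a) - (PCoord 2 - 1) * (PAlpha - PConst a) = cubic PAlpha PCoord"
        by (simp add: algebra_simps)
      then have "acl (emb (coord_emb (fibre_cubic a))) \<in> fibre_ideal a"
        unfolding fibre_ideal_iff using family_relations_pideal(2) by metis
      then have "pideal {fibre_cubic a} \<subseteq> {p. acl (emb (coord_emb p)) \<in> fibre_ideal a}"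
        by (intro poly_alg.genideal_minimal[OF I]) simp
      then show "\<exists>h. coord_emb p - h * (PAlpha - PConst a) \<in> pideal family_relations"
        using p unfolding fibre_ideal_iff by blast
    qed
    finally show "?k (coord_emb p) = \<zero>\<^bsub>fibre a\<^esub> \<longleftrightarrow> p \<in> pideal {fibre_cubic a}" .
  qed
qed

lemma xR_eq: "xR i = acl (emb (PCoord i))"
  by (simp add: xR_def)

lemma xF_eq: "xF a i = fibre_ideal a +>\<^bsub>monodromy_space\<^esub> acl (emb (coord_emb (PVar i)))"
  by (simp add: xF_def xR_eq)

lemma total_degree_fibre_cubic: "total_degree (fibre_cubic a) = 3"
proof -
  let ?s = "\<lambda>i :: 3. Poly_Mapping.single i (1 :: nat)"
  let ?m = "?s 1 + ?s 2 + ?s 3"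
  let ?deg = "\<lambda>m :: 3 \<Rightarrow>\<^sub>0 nat. \<Sum>v\<in>Poly_Mapping.keys m. Poly_Mapping.lookup m v"
  have deg: "?deg m = Poly_Mapping.lookup m 1 + Poly_Mapping.lookup m 2 + Poly_Mapping.lookup m 3" for m
  proof -
    have "?deg m = (\<Sum>v\<in>UNIV. Poly_Mapping.lookup m v)"
      by (rule sum.mono_neutral_left) (auto simp: in_keys_iff)
    then show ?thesis by (simp add: sum_3_UNIV)
  qed
  have eq: "fibre_cubic a = Poly_Mapping.single ?m 1 - Poly_Mapping.single (?s 1) 1 - Poly_Mapping.single (?s 2) a
      - Poly_Mapping.single (?s 3) 1 + Poly_Mapping.single 0 a + Poly_Mapping.single 0 1"
    by (simp add: fibre_cubic_def cubic_def PVar_def PConst_def mult_single)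
  have distinct: "?m \<noteq> ?s 1" "?m \<noteq> ?s 2" "?m \<noteq> ?s 3" "?m \<noteq> 0"
  proof -
    have "?deg ?m = 3" "?deg (?s 1) = 1" "?deg (?s 2) = 1" "?deg (?s 3) = 1" "?deg 0 = 0"
      unfolding deg by (simp_all add: lookup_add lookup_single when_def)
    then show "?m \<noteq> ?s 1" "?m \<noteq> ?s 2" "?m \<noteq> ?s 3" "?m \<noteq> 0" by (metis one_eq_numeral_iff semiring_norm(86) zero_neq_numeral)+
  qed
  have keys: "Poly_Mapping.keys (fibre_cubic a) \<subseteq> {?m, ?s 1, ?s 2, ?s 3, 0}"
    by (auto simp: eq in_keys_iff lookup_add lookup_minus lookup_single lookup_one when_def split: if_splits)
  have "Poly_Mapping.lookup (fibre_cubic a) ?m = 1"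
    using distinct by (simp add: eq lookup_add lookup_minus lookup_single lookup_one when_def eq_commute[of _ ?m])
  then have m: "?m \<in> Poly_Mapping.keys (fibre_cubic a)" by (simp add: in_keys_iff)
  have "?deg ?m = 3" unfolding deg by (simp add: lookup_add lookup_single when_def)
  moreover have "?deg k \<le> 3" if "k \<in> Poly_Mapping.keys (fibre_cubic a)" for k
  proof -
    from that keys have "k \<in> {?m, ?s 1, ?s 2, ?s 3, 0}" by blast
    then show ?thesis
      unfolding deg by (elim insertE emptyE) (simp_all add: lookup_add lookup_single when_def)
  qed
  ultimately show ?thesis
    unfolding total_degree_def using m by (intro Max_eqI) (auto intro: rev_image_eqI)
qed

section \<open>The singularity of type A\<close>

lemma holomorphic3_on_const: "holomorphic3_on (\<lambda>x. k) U"
  unfolding holomorphic3_on_def by (intro ballI exI[of _ "\<lambda>_. 0"]) simp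

lemma holomorphic3_on_component: "holomorphic3_on (\<lambda>x. x $ i) U"
  unfolding holomorphic3_on_def
  by (intro ballI exI[of _ "\<lambda>x. x $ i"])
    (simp add: bounded_linear_imp_has_derivative bounded_linear_vec_nth)

lemma holomorphic3_on_add:
  "holomorphic3_on f U \<Longrightarrow> holomorphic3_on g U \<Longrightarrow> holomorphic3_on (\<lambda>x. f x + g x) U"
  unfolding holomorphic3_on_def
proof (intro ballI)
  fix x assume *: "x \<in> U" "\<forall>x\<in>U. \<exists>D. (f has_derivative D) (at x) \<and> (\<forall>c v. D (c *s v) = c * D v)"
    "\<forall>x\<in>U. \<exists>D. (g has_derivative D) (at x) \<and> (\<forall>c v. D (c *s v) = c * D v)"
  then obtain D E where "(f has_derivative D) (at x)" "\<forall>c v. D (c *s v) = c * D v"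
    "(g has_derivative E) (at x)" "\<forall>c v. E (c *s v) = c * E v" by blast
  then show "\<exists>D. ((\<lambda>x. f x + g x) has_derivative D) (at x) \<and> (\<forall>c v. D (c *s v) = c * D v)"
    by (intro exI[of _ "\<lambda>h. D h + E h"]) (simp add: has_derivative_add algebra_simps)
qed

lemma holomorphic3_on_mult:
  "holomorphic3_on f U \<Longrightarrow> holomorphic3_on g U \<Longrightarrow> holomorphic3_on (\<lambda>x. f x * g x) U"
  unfolding holomorphic3_on_def
proof (intro ballI)
  fix x assume *: "x \<in> U" "\<forall>x\<in>U. \<exists>D. (f has_derivative D) (at x) \<and> (\<forall>c v. D (c *s v) = c * D v)"
    "\<forall>x\<in>U. \<exists>D. (g has_derivative D) (at x) \<and> (\<forall>c v. D (c *s v) = c * D v)"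
  then obtain D E where "(f has_derivative D) (at x)" "\<forall>c v. D (c *s v) = c * D v"
    "(g has_derivative E) (at x)" "\<forall>c v. E (c *s v) = c * E v" by blast
  then show "\<exists>D. ((\<lambda>x. f x * g x) has_derivative D) (at x) \<and> (\<forall>c v. D (c *s v) = c * D v)"
    by (intro exI[of _ "\<lambda>h. f x * E h + D h * g x"] conjI has_derivative_mult) (simp_all add: algebra_simps)
qed

lemma holomorphic3_on_inverse:
  "holomorphic3_on g U \<Longrightarrow> (\<And>x. x \<in> U \<Longrightarrow> g x \<noteq> 0) \<Longrightarrow> holomorphic3_on (\<lambda>x. inverse (g x)) U"
  unfolding holomorphic3_on_def
proof (intro ballI)
  fix x assume *: "x \<in> U" "\<forall>x\<in>U. \<exists>D. (g has_derivative D) (at x) \<and> (\<forall>c v. D (c *s v) = c * D v)"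
    "\<And>x. x \<in> U \<Longrightarrow> g x \<noteq> 0"
  then obtain E where "(g has_derivative E) (at x)" "\<forall>c v. E (c *s v) = c * E v" by blast
  then show "\<exists>D. ((\<lambda>x. inverse (g x)) has_derivative D) (at x) \<and> (\<forall>c v. D (c *s v) = c * D v)"
    using *(3)[OF *(1)]
    by (intro exI[of _ "\<lambda>h. - (inverse (g x) * E h * inverse (g x))"] conjI Deriv.has_derivative_inverse)
      (simp_all add: algebra_simps)
qed

lemmas holomorphic3_on_intros =
  holomorphic3_on_const holomorphic3_on_component holomorphic3_on_add holomorphic3_on_mult

lemma open_Collect_component_neq:
  fixes k :: complex
  shows "open {x :: complex^3. k + l * x $ 3 \<noteq> 0}"
  by (intro open_Collect_neq continuous_intros)

text \<open>The coordinate change comes from \<open>x\<^sub>3 f = (x\<^sub>1 x\<^sub>3 - 1) (x\<^sub>2 x\<^sub>3 - 1) - (x\<^sub>3 - 1)\<^sup>2\<close> for the cubic \<open>f\<close>,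
  where the product is written as a sum of two squares.\<close>

lemma hypersurface_type_A1_fibre_cubic: "hypersurface_type_A 1 (fibre_cubic 1) (\<chi> i. 1)"
proof -
  \<comment> \<open>Written in the shape of \<open>open_Collect_component_neq\<close>. In the maps
    below differences appear as sums with a factor -1, to fit the closure rules for holomorphic
    functions.\<close>
  define U where "U = {x :: complex^3. 0 + 1 * x $ 3 \<noteq> 0}"
  define V where "V = {y :: complex^3. 1 + (- \<i>) * y $ 3 \<noteq> 0}"
  \<comment> \<open>With A = x_1 x_3 - 1 and B = x_2 x_3 - 1 the entries are (A + B)/2, \<i> (A -
    B)/2 and \<i> (x_3 - 1); their squares sum to A B - (x_3 - 1)^2.\<close>
  define F :: "complex^3 \<Rightarrow> complex^3" where
    "F x = vector [1 / 2 * (x $ 1 * x $ 3 + x $ 2 * x $ 3) + - 1,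
       \<i> / 2 * (x $ 1 * x $ 3 + - 1 * (x $ 2 * x $ 3)), \<i> * (x $ 3 + - 1)]" for x
  \<comment> \<open>The inverse: x_3 = 1 - \<i> y_3, while y_1 - \<i> y_2 = A and y_1 + \<i> y_2 = B
    give x_1 and x_2 after division by x_3.\<close>
  define G :: "complex^3 \<Rightarrow> complex^3" where
    "G y = vector [(y $ 1 + (- \<i>) * y $ 2 + 1) * inverse (1 + (- \<i>) * y $ 3),
       (y $ 1 + \<i> * y $ 2 + 1) * inverse (1 + (- \<i>) * y $ 3), 1 + (- \<i>) * y $ 3]" for y
  have F_nth: "F x $ 1 = 1 / 2 * (x $ 1 * x $ 3 + x $ 2 * x $ 3) + - 1"
    "F x $ 2 = \<i> / 2 * (x $ 1 * x $ 3 + - 1 * (x $ 2 * x $ 3))" "F x $ 3 = \<i> * (x $ 3 + - 1)" for x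
    by (simp_all add: F_def)
  have G_nth: "G y $ 1 = (y $ 1 + (- \<i>) * y $ 2 + 1) * inverse (1 + (- \<i>) * y $ 3)"
    "G y $ 2 = (y $ 1 + \<i> * y $ 2 + 1) * inverse (1 + (- \<i>) * y $ 3)" "G y $ 3 = 1 + (- \<i>) * y $ 3" for y
    by (simp_all add: G_def)
  have ii: "\<i> * (\<i> * z) = - z" for z by (simp flip: mult.assoc)
  have FU: "F x \<in> V" if "x \<in> U" for x
    using that by (simp add: U_def V_def F_nth ii)
  have GV: "G y \<in> U" if "y \<in> V" for y
    using that by (simp add: U_def V_def G_nth)
  have GF: "G (F x) = x" if "x \<in> U" for x
  proof -
    have "x $ 3 \<noteq> 0" using that by (simp add: U_def)
    then have "G (F x) $ 1 = x $ 1" "G (F x) $ 2 = x $ 2" "G (F x) $ 3 = x $ 3"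
      by (simp_all add: G_nth F_nth ii) (simp_all add: field_simps)
    then show ?thesis by (simp add: vec_eq_iff forall_3)
  qed
  have FG: "F (G y) = y" if "y \<in> V" for y
  proof -
    have "1 - \<i> * y $ 3 \<noteq> 0" using that by (simp add: V_def)
    then have eqs: "G y $ 1 * G y $ 3 = y $ 1 + (- \<i>) * y $ 2 + 1" "G y $ 2 * G y $ 3 = y $ 1 + \<i> * y $ 2 + 1"
      by (simp_all add: G_nth)
    have "F (G y) $ 1 = y $ 1" "F (G y) $ 2 = y $ 2"
      unfolding F_nth eqs by (simp_all add: algebra_simps ii)
    moreover have "F (G y) $ 3 = y $ 3"
      unfolding F_nth by (simp add: G_nth ii)
    ultimately show ?thesis by (simp add: vec_eq_iff forall_3)
  qed
  have hol_F: "holomorphic3_on (\<lambda>x. F x $ i) U" for i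
    by (rule forall_3_cases[of _ i]) (simp_all only: F_nth holomorphic3_on_intros)
  have den: "holomorphic3_on (\<lambda>y. inverse (1 + (- \<i>) * y $ 3)) V"
    by (intro holomorphic3_on_inverse holomorphic3_on_intros) (simp add: V_def)
  have hol_G: "holomorphic3_on (\<lambda>y. G y $ i) V" for i
    by (rule forall_3_cases[of _ i]) (simp_all only: G_nth holomorphic3_on_intros den)
  have cubic_eq: "psubst id (\<lambda>i. x $ i) (fibre_cubic 1)
      = inverse (x $ 3) * ((F x $ 1)\<^sup>2 + (F x $ 2)\<^sup>2 + (F x $ 3) ^ (1 + 1))" if "x \<in> U" for x
  proof -
    have x3: "x $ 3 \<noteq> 0" using that by (simp add: U_def)
    have "(F x $ 1)\<^sup>2 + (F x $ 2)\<^sup>2 + (F x $ 3) ^ (1 + 1)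
        = (x $ 1 * x $ 3 - 1) * (x $ 2 * x $ 3 - 1) - (x $ 3 - 1)\<^sup>2"
      unfolding F_nth by (simp add: power_mult_distrib power_divide) (simp add: power2_eq_square field_simps)
    also have "\<dots> = x $ 3 * cubic 1 (\<lambda>i. x $ i)"
      by (simp add: cubic_def power2_eq_square algebra_simps)
    finally have "(F x $ 1)\<^sup>2 + (F x $ 2)\<^sup>2 + (F x $ 3) ^ (1 + 1) = x $ 3 * cubic 1 (\<lambda>i. x $ i)" .
    moreover have "psubst id (\<lambda>i. x $ i) (fibre_cubic 1) = cubic 1 (\<lambda>i. x $ i)"
      unfolding ev_def[symmetric] by (simp add: fibre_cubic_def)
    ultimately show ?thesis using x3 by simp
  qed
  have UV: "open U" "open V"
    unfolding U_def V_def by (rule open_Collect_component_neq)+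
  have p: "(\<chi> i. 1) \<in> U" "F (\<chi> i. 1) = 0"
    by (simp_all add: U_def F_def vec_eq_iff forall_3)
  have images: "F ` U = V" "G ` V = U"
  proof -
    have "y \<in> F ` U" if "y \<in> V" for y
      using imageI[OF GV[OF that], of F] by (simp only: FG[OF that])
    then show "F ` U = V" using FU by blast
    have "x \<in> G ` V" if "x \<in> U" for x
      using imageI[OF FU[OF that], of G] by (simp only: GF[OF that])
    then show "G ` V = U" using GV by blast
  qed
  have unit: "holomorphic3_on (\<lambda>x. inverse (x $ 3)) U"
    by (intro holomorphic3_on_inverse holomorphic3_on_intros) (simp add: U_def)
  have unit_nz: "inverse (x $ 3) \<noteq> 0" if "x \<in> U" for x :: "complex^3" using that by (simp add: U_def)
  show ?thesis
    unfolding hypersurface_type_A_def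
    by (rule exI[of _ U], rule exI[of _ V], rule exI[of _ F], rule exI[of _ G],
        rule exI[of _ "\<lambda>x :: complex^3. inverse (x $ 3)"], intro conjI ballI allI)
      (rule UV p images hol_F hol_G unit | erule GF FG unit_nz cubic_eq)+
qed

section \<open>The image of the reducible locus and the conclusion\<close>

lemma reducible_locus_nonempty: "reducible_locus \<noteq> {}"
proof -
  \<comment> \<open>The trivial data, with \<alpha> = 1 and all b_i = 0. A point is exhibited
    because the image of the locus has to be exactly one point, not merely contained in one.\<close>
  let ?x = "(\<lambda>v. case v of Coord b \<Rightarrow> 0 | _ \<Rightarrow> 1) :: bvar avar \<Rightarrow> complex"
  have "ev ?x s = 0" if "s \<in> analytic_relations" for s
    by (rule analytic_point[of "\<lambda>_. 0"]) (use that in \<open>simp_all add: n22_def n12_def n21_def\<close>)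
  note point = AD.point_cpoint[OF this] AD.point_eval[OF this]
  have "AD.point ?x \<in> reducible_locus"
    unfolding reducible_locus_def using point(1) by (simp add: point(2))
  then show ?thesis by blast
qed

lemma git_quotient_map_cpoint:
  assumes "\<xi> \<in> cpoints analytic_data"
  shows "git_quotient_map \<xi> \<in> cpoints monodromy_space"
    and "git_quotient_map \<xi> (acl (emb f)) = \<xi> (acl (emb f))"
proof -
  show eq: "git_quotient_map \<xi> (acl (emb f)) = \<xi> (acl (emb f))" for f
    unfolding git_quotient_map_def by (rule restrict_apply') (rule MS.pi_closed)
  have ev: "\<xi> (acl p) = ev (\<lambda>v. \<xi> (acl (PVar v))) p" for p
    by (rule AD.cpoint_eval[OF assms])
  have eq': "git_quotient_map \<xi> (acl (emb f)) = ev (\<lambda>v. \<xi> (acl (PVar v))) (emb f)" for f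
    by (rule trans[OF eq ev])
  have "git_quotient_map \<xi> \<in> ring_hom monodromy_space ring_of_type_algebra"
  proof (rule ring_hom_memI)
    fix c d assume "c \<in> carrier monodromy_space" "d \<in> carrier monodromy_space"
    then obtain f g where cd: "c = acl (emb f)" "d = acl (emb g)" by (auto simp: MS.carrier_eq)
    show "git_quotient_map \<xi> (c \<otimes>\<^bsub>monodromy_space\<^esub> d)
        = git_quotient_map \<xi> c \<otimes>\<^bsub>ring_of_type_algebra\<^esub> git_quotient_map \<xi> d"
      "git_quotient_map \<xi> (c \<oplus>\<^bsub>monodromy_space\<^esub> d)
        = git_quotient_map \<xi> c \<oplus>\<^bsub>ring_of_type_algebra\<^esub> git_quotient_map \<xi> d"
      unfolding cd MS.pi_mult[symmetric] MS.pi_add[symmetric] eq'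
      by (simp_all only: emb_simps ev_simps complex_ring_simps)
  next
    show "git_quotient_map \<xi> \<one>\<^bsub>monodromy_space\<^esub> = \<one>\<^bsub>ring_of_type_algebra\<^esub>"
      unfolding MS.pi_one[symmetric] eq' by (simp only: emb_simps ev_simps complex_ring_simps)
  qed simp
  moreover have "git_quotient_map \<xi> (scal monodromy_space c) = c" for c
    unfolding MS.scal_eq eq' by (simp only: emb_simps ev_simps)
  ultimately show "git_quotient_map \<xi> \<in> cpoints monodromy_space"
    by (simp add: cpoints_def git_quotient_map_def)
qed

text \<open>Each product b_i b_(i+1) in the definition of the x_i has one factor of odd and one of
  even index, so it vanishes on both branches of the locus.\<close>

lemma reducible_locus_values:
  assumes "\<xi> \<in> reducible_locus"
  shows "\<xi> (acl (emb PAlpha)) = 1" "\<xi> (acl (emb (PCoord i))) = 1"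
proof -
  have xi: "\<xi> \<in> cpoints analytic_data" "\<xi> (acl PAlpha) = 1"
    "(\<forall>b\<in>{B1, B3, B5}. \<xi> (acl (PCoord b)) = 0) \<or> (\<forall>b\<in>{B2, B4, B6}. \<xi> (acl (PCoord b)) = 0)"
    using assms by (simp_all add: reducible_locus_def)
  show "\<xi> (acl (emb PAlpha)) = 1" using xi(2) by simp
  have "\<xi> (acl (emb (PCoord i))) = ev (\<lambda>v. \<xi> (acl (PVar v))) (emb (PCoord i))"
    by (rule AD.cpoint_eval[OF xi(1)])
  also have "\<dots> = 1" using xi(3) by auto
  finally show "\<xi> (acl (emb (PCoord i))) = 1" .
qed

theorem mainTheorem10:
  shows
    "(\<exists>h \<in> calg_iso (pquot family_relations) monodromy_space.
        h (pclass family_relations PAlpha) = alphaR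
        \<and> (\<forall>i. h (pclass family_relations (PCoord i)) = xR i))
     \<and> (\<forall>a. a \<noteq> 0 \<longrightarrow> total_degree (fibre_cubic a) = 3 \<and>
          (\<exists>h \<in> calg_iso (pquot {fibre_cubic a}) (fibre a).
             \<forall>i. h (pclass {fibre_cubic a} (PVar i)) = xF a i))
     \<and> (\<exists>\<phi>. singular_points monodromy_space = {\<phi>}
          \<and> \<phi> alphaR = 1 \<and> (\<forall>i. \<phi> (xR i) = 1)
          \<and> git_quotient_map ` reducible_locus = {\<phi>})
     \<and> (\<forall>a. a \<noteq> 0 \<and> a \<noteq> 1 \<longrightarrow> singular_points (fibre a) = {})
     \<and> (\<exists>\<phi>. singular_points (fibre 1) = {\<phi>}
          \<and> (\<forall>i. \<phi> (xF 1 i) = 1)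
          \<and> singularity_type_A 1 (fibre 1) \<phi>)"
proof (intro conjI allI impI)
  have alphaR: "alphaR = acl (emb PAlpha)" by (simp add: alphaR_def)
  show "\<exists>h \<in> calg_iso (pquot family_relations) monodromy_space.
        h (pclass family_relations PAlpha) = alphaR
        \<and> (\<forall>i. h (pclass family_relations (PCoord i)) = xR i)"
    using MS.calg_iso_exists unfolding alphaR xR_eq by blast
  show "total_degree (fibre_cubic a) = 3" for a by (rule total_degree_fibre_cubic)
  show iso: "\<exists>h \<in> calg_iso (pquot {fibre_cubic a}) (fibre a).
      \<forall>i. h (pclass {fibre_cubic a} (PVar i)) = xF a i" if "a \<noteq> 0" for a
    using presented.calg_iso_exists[OF presented_fibre[OF that]] unfolding xF_eq by blast
  show "\<exists>\<phi>. singular_points monodromy_space = {\<phi>}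
          \<and> \<phi> alphaR = 1 \<and> (\<forall>i. \<phi> (xR i) = 1)
          \<and> git_quotient_map ` reducible_locus = {\<phi>}"
  proof (rule family_singular_point[OF presented_monodromy_space])
    fix \<phi> assume phi: "singular_points monodromy_space = {\<phi>}" "\<phi> (acl (emb PAlpha)) = 1"
      "\<And>i. \<phi> (acl (emb (PCoord i))) = 1"
      and uniq: "\<And>\<psi>. \<psi> \<in> cpoints monodromy_space \<Longrightarrow> \<psi> (acl (emb PAlpha)) = 1
        \<Longrightarrow> (\<And>i. \<psi> (acl (emb (PCoord i))) = 1) \<Longrightarrow> \<psi> = \<phi>"
    have "git_quotient_map \<xi> = \<phi>" if xi: "\<xi> \<in> reducible_locus" for \<xi>
    proof -
      have "\<xi> \<in> cpoints analytic_data" using xi by (simp add: reducible_locus_def)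
      note q = git_quotient_map_cpoint[OF this]
      show ?thesis
        by (rule uniq[OF q(1)]) (simp_all only: q(2) reducible_locus_values[OF xi])
    qed
    then have "git_quotient_map ` reducible_locus = {\<phi>}" using reducible_locus_nonempty by auto
    with phi show ?thesis unfolding alphaR xR_eq by blast
  qed
  show "singular_points (fibre a) = {}" if "a \<noteq> 0 \<and> a \<noteq> 1" for a
    using that by (intro fibre_singular_points_empty[OF presented_fibre]) auto
  show "\<exists>\<phi>. singular_points (fibre 1) = {\<phi>} \<and> (\<forall>i. \<phi> (xF 1 i) = 1) \<and> singularity_type_A 1 (fibre 1) \<phi>"
  proof (rule fibre_singular_point[OF presented_fibre])
    fix \<phi> assume phi: "singular_points (fibre 1) = {\<phi>}"
      "\<And>i. \<phi> (fibre_ideal 1 +>\<^bsub>monodromy_space\<^esub> acl (emb (coord_emb (PVar i)))) = 1"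
    then have xF: "\<phi> (xF 1 i) = 1" for i unfolding xF_eq by blast
    \<comment> \<open>The embedding required by \<open>singularity_type_A\<close> is the
      presentation of the fibre itself; the singular point then becomes (1, 1, 1), where the local
      coordinates are centred.\<close>
    obtain h where h: "h \<in> calg_iso (pquot {fibre_cubic 1}) (fibre 1)"
      "\<And>i. h (pclass {fibre_cubic 1} (PVar i)) = xF 1 i" using iso[of 1] by auto
    have "hypersurface_type_A 1 (fibre_cubic 1) (\<chi> i. \<phi> (h (pclass {fibre_cubic 1} (PVar i))))"
      using hypersurface_type_A1_fibre_cubic by (simp only: h(2) xF)
    then have "singularity_type_A 1 (fibre 1) \<phi>"
      unfolding singularity_type_A_def using phi(1) h(1) by blast
    with phi(1) xF show ?thesis by blast
  qed simp
qed

end
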